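(* Let $\mathcal V$ be a ruled quintic surface in $\mathrm{PG}(6,q)$, $q\ge 6$. (1) $\mathcal V$ contains exactly $q+1$ lines, exactly $1$ non-degenerate conic, exactly $q^2$ twisted cubics, exactly $q^4-q^2$ $4$-dim nrcs, and exactly $q^6-q^4$ $5$-dim nrcs. (2) Every $5$-space of $\mathrm{PG}(6,q)$ meets $\mathcal V$ in exactly one of the following configurations, and the number of $5$-spaces of each type is as listed: a $5$-dim nrc: $q^6-q^4$; a $4$-dim nrc and $1$ generator: $q^5+q^4-q^3-q^2$; a twisted cubic (and no generator): $(q^4-q^3)/2$; a twisted cubic and $1$ generator: $q^3+q^2$; a twisted cubic and $2$ generators: $(q^4+q^3)/2$; the conic (and no generator): $(q^3-q)/3$; the conic and $1$ generator: $q^3/2+q/2+1$; the conic and $2$ generators: $q^2+q$; the conic and $3$ generators: $(q^3-q)/6$.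
   Context: Construction: in $\mathrm{PG}(6,q)$ let $\alpha$ be a plane and $\Pi_3$ a $3$-space with $\alpha\cap\Pi_3=\emptyset$. Let $\mathcal C$ be a non-degenerate conic in $\alpha$ and $\mathcal N_3$ a twisted cubic in $\Pi_3$, parametrised as $\mathcal C=\{(1,\theta,\theta^2)\}$ and $\mathcal N_3=\{(1,\epsilon,\epsilon^2,\epsilon^3)\}$ ($\theta,\epsilon\in\mathbb F_q\cup\{\infty\}$), and let $\phi\in\mathrm{PGL}(2,q)$ act on parameters, giving a bijection $\mathcal C\to\mathcal N_3$. The ruled quintic surface $\mathcal V$ is the set of points on the $q+1$ lines (generators) joining each point of $\mathcal C$ to its image under $\phi$; $\mathcal C$ is its conic directrix ("the conic"). An $r$-dim nrc is a normal rational curve spanning an $r$-space; a twisted cubic is a $3$-dim nrc. *)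

theory Defs
  imports "HOL-Analysis.Analysis"
begin

text \<open>
  PG(n-1,q) is modelled on the vector space of n-tuples over a finite field with q elements:
  a point is a vector subspace of rank 1 and an r-space is a vector subspace of rank r + 1.
  Lines, curves and surfaces are sets of points.
\<close>

definition ppoint :: "'a::field ^ 'n \<Rightarrow> ('a ^ 'n) set" where
  "ppoint x = vec.span {x}"

definition rspace :: "nat \<Rightarrow> ('a::field ^ 'n) set \<Rightarrow> bool" where
  "rspace r U \<longleftrightarrow> vec.subspace U \<and> vec.dim U = r + 1"

definition points :: "('a::field ^ 'n) set \<Rightarrow> ('a ^ 'n) set set" where
  "points U = {ppoint x | x. x \<in> U \<and> x \<noteq> 0}"

definition line :: "('a::field ^ 'n) set set \<Rightarrow> bool" where
  "line l \<longleftrightarrow> (\<exists>U. rspace 1 U \<and> l = points U)"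

definition join :: "('a::field ^ 'n) set \<Rightarrow> ('a ^ 'n) set \<Rightarrow> ('a ^ 'n) set set" where
  "join P Q = points (vec.span (P \<union> Q))"

text \<open>
  A parameter in \<open>F\<^sub>q \<union> {\<infinity>}\<close> is given by homogeneous coordinates, that is by a nonzero p in
  \<open>F\<^sub>q\<^sup>2\<close>: the parameter \<open>\<theta>\<close> is (1, \<open>\<theta>\<close>) and \<open>\<infinity>\<close> is (0, 1). With respect to the frame
  v 0, ..., v r, \<open>nrc_point r v p\<close> is then the point \<open>(1, \<theta>, \<theta>\<^sup>2, \<dots>, \<theta>\<^sup>r)\<close>, respectively
  \<open>(0, \<dots>, 0, 1)\<close>. An element of PGL(2,q) acts on parameters through an invertible matrix.
\<close>

definition nrc_point :: "nat \<Rightarrow> (nat \<Rightarrow> 'a::field ^ 'n) \<Rightarrow> 'a ^ 2 \<Rightarrow> ('a ^ 'n) set" where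
  "nrc_point r v p = ppoint (\<Sum>i\<le>r. ((p $ 1) ^ (r - i) * (p $ 2) ^ i) *s v i)"

definition frame :: "nat \<Rightarrow> (nat \<Rightarrow> 'a::field ^ 'n) \<Rightarrow> ('a ^ 'n) set \<Rightarrow> bool" where
  "frame r v U \<longleftrightarrow> inj_on v {..r} \<and> vec.independent (v ` {..r}) \<and> vec.span (v ` {..r}) = U"

definition nrc :: "nat \<Rightarrow> ('a::field ^ 'n) set set \<Rightarrow> bool" where
  "nrc r N \<longleftrightarrow> (\<exists>U v. rspace r U \<and> frame r v U \<and> N = {nrc_point r v p | p. p \<noteq> 0})"

abbreviation nondegenerate_conic :: "('a::field ^ 'n) set set \<Rightarrow> bool" where
  "nondegenerate_conic \<equiv> nrc 2"

abbreviation twisted_cubic :: "('a::field ^ 'n) set set \<Rightarrow> bool" where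
  "twisted_cubic \<equiv> nrc 3"

text \<open>V is a ruled quintic surface with conic directrix C and set of generators G.\<close>

definition ruled_quintic_surface ::
    "('a::field ^ 7) set set \<Rightarrow> ('a ^ 7) set set \<Rightarrow> ('a ^ 7) set set set \<Rightarrow> bool" where
  "ruled_quintic_surface V C G \<longleftrightarrow>
     (\<exists>\<alpha> \<tau> u v (\<phi> :: 'a ^ 2 ^ 2).
        rspace 2 \<alpha> \<and> rspace 3 \<tau> \<and> points \<alpha> \<inter> points \<tau> = {} \<and>
        frame 2 u \<alpha> \<and> frame 3 v \<tau> \<and> invertible \<phi> \<and>
        C = {nrc_point 2 u p | p. p \<noteq> 0} \<and>
        G = {join (nrc_point 2 u p) (nrc_point 3 v (\<phi> *v p)) | p. p \<noteq> 0} \<and>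
        V = \<Union>G)"

text \<open>
  \<open>Nrc_Gens r i\<close>: an r-dim nrc and i generators; \<open>Conic_Gens i\<close>: the conic directrix and
  i generators.
\<close>

datatype configuration = Nrc_Gens nat nat | Conic_Gens nat

definition generators_in :: "('a::field ^ 'n) set set set \<Rightarrow> ('a ^ 'n) set \<Rightarrow> ('a ^ 'n) set set set"
  where "generators_in G S = {g \<in> G. g \<subseteq> points S}"

fun meets_in :: "('a::field ^ 'n) set set \<Rightarrow> ('a ^ 'n) set set \<Rightarrow> ('a ^ 'n) set set set \<Rightarrow>
    ('a ^ 'n) set \<Rightarrow> configuration \<Rightarrow> bool" where
  "meets_in V C G S (Nrc_Gens r i) \<longleftrightarrow>
     (\<exists>N. nrc r N \<and> V \<inter> points S = N \<union> \<Union>(generators_in G S)) \<and> card (generators_in G S) = i"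
| "meets_in V C G S (Conic_Gens i) \<longleftrightarrow>
     V \<inter> points S = C \<union> \<Union>(generators_in G S) \<and> card (generators_in G S) = i"

definition num_5spaces :: "('a::field ^ 'n) set set \<Rightarrow> ('a ^ 'n) set set \<Rightarrow> ('a ^ 'n) set set set \<Rightarrow>
    configuration \<Rightarrow> nat" where
  "num_5spaces V C G c = card {S. rspace 5 S \<and> meets_in V C G S c}"

end

theory Submission
  imports Defs
begin

text \<open>
  The point of the generator with parameter p that has coordinates (a, b) lies on the hyperplane
  given by a binary quadratic form f and a binary cubic form g iff \<open>a f(p) + b g(p) = 0\<close>. Write
  \<open>(f, g) = d (f\<^sub>1, g\<^sub>1)\<close> with \<open>f\<^sub>1, g\<^sub>1\<close> coprime of degrees \<open>r - 3\<close> and \<open>r - 2\<close>. The hyperplane section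
  then consists of the generators at the roots of d and of the curve \<open>p \<mapsto> (g\<^sub>1(p), - f\<^sub>1(p))\<close>, which is
  an r-dim nrc. Conversely, let N be an r-dim nrc on the surface. Take a hyperplane through N and
  \<open>5 - r\<close> generators that meet N and are not contained in its span. If the pair left over after
  dividing by the linear forms of these generators had a common factor, then at least \<open>r + 3\<close> points
  of N would lie on the union of a subspace of rank r and a line, which holds at most \<open>r + 2\<close> of them.
  So N is one of the curves above, and everything is reduced to counting pairs of binary forms.
\<close>

subsection \<open>Binary forms\<close>

text \<open>The degrees of f and g differ by one because the conic and the cubic have degrees 2 and
  3: this makes both terms of \<open>g c2 - f c3\<close> homogeneous of degree r. Forms are kept as
  functions and tested on only q + 1 parameters, so a product that vanishes everywhere yields a zero
  factor only while its degree is at most q. Unique factorisation is replaced by one fact, proved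
  degree by degree: if \<open>A g = B f\<close> with (f, g) coprime, then (A, B) is a multiple of
  (f, g). It makes the decomposition \<open>d (f, g)\<close> unique up to scalars, and it shows that
  a curve spans rank r + 1, by counting the functionals that vanish on it. The hyperplane through N
  and the chosen generators exists because the frame of N and one extra vector per generator are
  only 6 vectors. The bound q at least 7 comes from the points of N: with 8 of them, at most two per
  generator, N meets four generators, and r + 3 points remain after 5 - r are discarded. A field
  never has six elements, so q at least 6 is enough. The divisions in the counts come from scalars:
  a curve arises from q - 1 pairs, a hyperplane from \<open>(q - 1)^2\<close> triples (d, f,
  g).\<close>

text \<open>
  \<open>bform n\<close> consists of the binary forms of degree \<open>n - 1\<close>, as functions on \<open>F\<^sub>q\<^sup>2\<close>. Indexing by the
  dimension makes \<open>bform 0 = {0}\<close> the space of forms of degree \<open>- 1\<close>. Forms and functions may be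
  identified as long as \<open>n \<le> q + 1\<close>.
\<close>

definition bform :: "nat \<Rightarrow> ('a::field ^ 2 \<Rightarrow> 'a) set" where
  "bform n = range (\<lambda>c p. \<Sum>i<n. c i * ((p $ 1) ^ (n - 1 - i) * (p $ 2) ^ i))"

lemma bformI: "f = (\<lambda>p. \<Sum>i<n. c i * ((p $ 1) ^ (n - 1 - i) * (p $ 2) ^ i)) \<Longrightarrow> f \<in> bform n"
  unfolding bform_def by blast

lemma bformE:
  assumes "f \<in> bform n"
  obtains c where "f = (\<lambda>p. \<Sum>i<n. c i * ((p $ 1) ^ (n - 1 - i) * (p $ 2) ^ i))"
  using assms unfolding bform_def by blast

lemma bform_zero: "(\<lambda>p. 0) \<in> bform n"
  by (rule bformI[where c = "\<lambda>_. 0"]) simp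

lemma bform_add: "f \<in> bform n \<Longrightarrow> g \<in> bform n \<Longrightarrow> (\<lambda>p. f p + g p) \<in> bform n"
proof -
  assume "f \<in> bform n" "g \<in> bform n"
  then obtain c d where
    "f = (\<lambda>p. \<Sum>i<n. c i * ((p $ 1) ^ (n - 1 - i) * (p $ 2) ^ i))"
    "g = (\<lambda>p. \<Sum>i<n. d i * ((p $ 1) ^ (n - 1 - i) * (p $ 2) ^ i))"
    by (elim bformE) blast
  then show ?thesis
    by (intro bformI[where c = "\<lambda>i. c i + d i"]) (simp add: sum.distrib distrib_right)
qed

lemma bform_cmult: "f \<in> bform n \<Longrightarrow> (\<lambda>p. k * f p) \<in> bform n"
proof -
  assume "f \<in> bform n"
  then obtain c where
    "f = (\<lambda>p. \<Sum>i<n. c i * ((p $ 1) ^ (n - 1 - i) * (p $ 2) ^ i))"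
    by (elim bformE)
  then show ?thesis
    by (intro bformI[where c = "\<lambda>i. k * c i"]) (simp add: sum_distrib_left mult.assoc)
qed

lemma bform_diff: "f \<in> bform n \<Longrightarrow> g \<in> bform n \<Longrightarrow> (\<lambda>p. f p - g p) \<in> bform n"
  using bform_add[of f n "\<lambda>p. (-1) * g p"] bform_cmult[of g n "-1"] by simp

lemma bform_sum:
  "finite A \<Longrightarrow> (\<And>x. x \<in> A \<Longrightarrow> f x \<in> bform n) \<Longrightarrow> (\<lambda>p. \<Sum>x\<in>A. f x p) \<in> bform n"
  by (induction A rule: finite_induct) (auto intro: bform_zero bform_add)

lemma bform_0: "bform 0 = {\<lambda>p. 0}"
  unfolding bform_def by auto

lemma bform_const: "(\<lambda>p. k) \<in> bform 1"
  by (rule bformI[where c = "\<lambda>_. k"]) simp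

lemma bform_1E:
  assumes "f \<in> bform (Suc 0)"
  obtains k where "f = (\<lambda>p. k)"
  using assms by (elim bformE) (simp add: fun_eq_iff)

lemma bform_monomial: "a + b + 1 = n \<Longrightarrow> (\<lambda>p. (p $ 1) ^ a * (p $ 2) ^ b) \<in> bform n"
  by (rule bformI[where c = "\<lambda>i. if i = b then 1 else 0"])
    (auto simp: fun_eq_iff if_distrib[of "\<lambda>x. x * _"] cong: if_cong)

text \<open>The degrees \<open>m - 1\<close> and \<open>n - 1\<close> add up to
  \<open>k - 1\<close>, which is the equation \<open>m + n = Suc k\<close>. It also covers
  \<open>m = 0\<close>, where the product is the zero form.\<close>

lemma bform_mult:
  assumes f: "f \<in> bform m" and g: "g \<in> bform n" and mn: "m + n = Suc k"
  shows "(\<lambda>p. f p * g p) \<in> bform k"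
proof -
  obtain c where c: "f = (\<lambda>p. \<Sum>i<m. c i * ((p $ 1) ^ (m - 1 - i) * (p $ 2) ^ i))"
    using f by (rule bformE)
  obtain d where d: "g = (\<lambda>p. \<Sum>i<n. d i * ((p $ 1) ^ (n - 1 - i) * (p $ 2) ^ i))"
    using g by (rule bformE)
  have "f p * g p = (\<Sum>i<m. \<Sum>j<n. (c i * d j) * ((p $ 1) ^ (m - 1 - i + (n - 1 - j)) * (p $ 2) ^ (i + j)))" for p
    unfolding c d sum_product by (intro sum.cong refl) (simp only: power_add mult_ac)
  moreover have "(\<lambda>p. \<Sum>i<m. \<Sum>j<n. (c i * d j) *
      ((p $ 1) ^ (m - 1 - i + (n - 1 - j)) * (p $ 2) ^ (i + j))) \<in> bform k"
    by (intro bform_sum finite_lessThan bform_cmult bform_monomial) (use mn in auto)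
  ultimately show ?thesis
    by simp
qed

text \<open>The determinant with columns \<open>a\<close> and \<open>p\<close>. For nonzero
  \<open>a\<close> its zeros are exactly the multiples of \<open>a\<close>, so it is the linear
  factor that belongs to the root \<open>a\<close>.\<close>

definition linform :: "'a::field ^ 2 \<Rightarrow> 'a ^ 2 \<Rightarrow> 'a" where
  "linform a p = a $ 1 * p $ 2 - a $ 2 * p $ 1"

lemma linform_self [simp]: "linform a a = 0"
  by (simp add: linform_def mult.commute)

lemma linform_nonzero:
  assumes "a \<noteq> 0"
  shows "linform a \<noteq> (\<lambda>p. 0)"
proof
  assume "linform a = (\<lambda>p. 0)"
  then have "linform a (vector [0, 1]) = 0" "linform a (vector [1, 0]) = 0"
    by simp_all
  then show False
    using assms by (auto simp: linform_def vec_eq_iff forall_2)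
qed

lemma bform_coords: "(\<lambda>p. p $ 1) \<in> bform 2" "(\<lambda>p. p $ 2) \<in> bform 2"
  using bform_monomial[of 1 0 2] bform_monomial[of 0 1 2] by simp_all

lemma bform_linform: "linform a \<in> bform 2"
proof -
  have "(\<lambda>p. a $ 1 * p $ 2 - a $ 2 * p $ 1) \<in> bform 2"
    by (intro bform_diff bform_cmult bform_coords)
  then show ?thesis
    by (simp add: linform_def[abs_def])
qed

text \<open>For a root at infinity (\<open>a $ 1 = 0\<close>) the last coefficient vanishes and the
  first coordinate splits off. Otherwise, since \<open>f a = 0\<close>, a power of
  \<open>a $ 1\<close> times \<open>f p\<close> is a combination of the differences
  \<open>(a $ 1 * p $ 2) ^ i - (a $ 2 * p $ 1) ^ i\<close>, and each of these is divisible by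
  \<open>linform a p\<close>.\<close>

lemma bform_root_div:
  assumes f: "f \<in> bform n" and a: "a \<noteq> 0" and fa: "f a = 0"
  shows "\<exists>h\<in>bform (n - 1). f = (\<lambda>p. linform a p * h p)"
proof (cases n)
  case 0
  then show ?thesis
    using f by (auto simp: bform_0)
next
  case (Suc k)
  obtain c where c: "f = (\<lambda>p. \<Sum>i<Suc k. c i * ((p $ 1) ^ (k - i) * (p $ 2) ^ i))"
    using f unfolding Suc by (elim bformE) simp
  show ?thesis
  proof (cases "a $ 1 = 0")
    case True
    then have a2: "a $ 2 \<noteq> 0"
      using a by (auto simp: vec_eq_iff forall_2)
    have "f a = c k * (a $ 2) ^ k"
    proof -
      have "(\<Sum>i<k. c i * ((a $ 1) ^ (k - i) * (a $ 2) ^ i)) = 0"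
        by (rule sum.neutral) (simp add: True)
      then show ?thesis
        unfolding c by simp
    qed
    then have ck: "c k = 0"
      using fa a2 by simp
    \<comment> \<open>In this case \<open>linform a p = - (a $ 2 * p $ 1)\<close>, which accounts
      for the scalar.\<close>
    define h where "h = (\<lambda>p::'a^2. - inverse (a $ 2) * (\<Sum>i<k. c i * ((p $ 1) ^ (k - 1 - i) * (p $ 2) ^ i)))"
    have "h \<in> bform k"
      unfolding h_def by (rule bform_cmult) (rule bformI, rule refl)
    moreover have "f p = linform a p * h p" for p
    proof -
      have "f p = (\<Sum>i<k. c i * ((p $ 1) ^ (k - i) * (p $ 2) ^ i))"
        unfolding c by (simp add: ck)
      also have "\<dots> = p $ 1 * (\<Sum>i<k. c i * ((p $ 1) ^ (k - 1 - i) * (p $ 2) ^ i))"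
        unfolding sum_distrib_left
      proof (rule sum.cong)
        fix i assume "i \<in> {..<k}"
        then have "k - i = Suc (k - 1 - i)" by auto
        then show "c i * (p $ 1 ^ (k - i) * p $ 2 ^ i) = p $ 1 * (c i * (p $ 1 ^ (k - 1 - i) * p $ 2 ^ i))"
          by simp
      qed simp
      finally show ?thesis
        using a2 by (simp add: linform_def True h_def)
    qed
    ultimately show ?thesis
      using Suc by auto
  next
    case False
    define h where "h = (\<lambda>p::'a^2. inverse ((a $ 1) ^ k) * (\<Sum>i<Suc k. \<Sum>j<i.
      (c i * (a $ 1) ^ (k - i) * (a $ 1) ^ j * (a $ 2) ^ (i - Suc j)) * ((p $ 1) ^ (k - Suc j) * (p $ 2) ^ j)))"
    have "h \<in> bform k"
      unfolding h_def by (intro bform_cmult bform_sum bform_monomial) auto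
    moreover have "f p = linform a p * h p" for p
    proof -
      have *: "(a $ 1) ^ k * (c i * ((p $ 1) ^ (k - i) * (p $ 2) ^ i)) - (p $ 1) ^ k * (c i * ((a $ 1) ^ (k - i) * (a $ 2) ^ i))
        = linform a p * (\<Sum>j<i. (c i * (a $ 1) ^ (k - i) * (a $ 1) ^ j * (a $ 2) ^ (i - Suc j)) * ((p $ 1) ^ (k - Suc j) * (p $ 2) ^ j))"
        if "i < Suc k" for i
      proof -
        have e: "(a $ 1) ^ k = (a $ 1) ^ (k - i) * (a $ 1) ^ i" "(p $ 1) ^ k = (p $ 1) ^ (k - i) * (p $ 1) ^ i"
          using that by (simp_all flip: power_add)
        have "(a $ 1) ^ k * (c i * ((p $ 1) ^ (k - i) * (p $ 2) ^ i)) - (p $ 1) ^ k * (c i * ((a $ 1) ^ (k - i) * (a $ 2) ^ i))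
          = c i * (a $ 1) ^ (k - i) * (p $ 1) ^ (k - i) * ((a $ 1 * p $ 2) ^ i - (a $ 2 * p $ 1) ^ i)"
          unfolding e power_mult_distrib right_diff_distrib by (simp only: mult_ac)
        also have "\<dots> = linform a p * (\<Sum>j<i. c i * (a $ 1) ^ (k - i) * (p $ 1) ^ (k - i) * ((a $ 2 * p $ 1) ^ (i - Suc j) * (a $ 1 * p $ 2) ^ j))"
          unfolding power_diff_sumr2 linform_def sum_distrib_left by (simp only: mult_ac)
        also have "(\<Sum>j<i. c i * (a $ 1) ^ (k - i) * (p $ 1) ^ (k - i) * ((a $ 2 * p $ 1) ^ (i - Suc j) * (a $ 1 * p $ 2) ^ j))
           = (\<Sum>j<i. (c i * (a $ 1) ^ (k - i) * (a $ 1) ^ j * (a $ 2) ^ (i - Suc j)) * ((p $ 1) ^ (k - Suc j) * (p $ 2) ^ j))"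
        proof (rule sum.cong)
          fix j assume "j \<in> {..<i}"
          then have "k - Suc j = (k - i) + (i - Suc j)" using that by auto
          then have "(p $ 1) ^ (k - Suc j) = (p $ 1) ^ (k - i) * (p $ 1) ^ (i - Suc j)"
            by (simp only: power_add)
          then show "c i * (a $ 1) ^ (k - i) * (p $ 1) ^ (k - i) * ((a $ 2 * p $ 1) ^ (i - Suc j) * (a $ 1 * p $ 2) ^ j)
           = (c i * (a $ 1) ^ (k - i) * (a $ 1) ^ j * (a $ 2) ^ (i - Suc j)) * ((p $ 1) ^ (k - Suc j) * (p $ 2) ^ j)"
            by (simp only: power_mult_distrib mult_ac)
        qed simp
        finally show ?thesis .
      qed
      have "(a $ 1) ^ k * f p = (a $ 1) ^ k * f p - (p $ 1) ^ k * f a"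
        using fa by simp
      also have "\<dots> = (\<Sum>i<Suc k. (a $ 1) ^ k * (c i * ((p $ 1) ^ (k - i) * (p $ 2) ^ i)) - (p $ 1) ^ k * (c i * ((a $ 1) ^ (k - i) * (a $ 2) ^ i)))"
        unfolding c sum_distrib_left sum_subtractf ..
      also have "\<dots> = (\<Sum>i<Suc k. linform a p * (\<Sum>j<i. (c i * (a $ 1) ^ (k - i) * (a $ 1) ^ j * (a $ 2) ^ (i - Suc j)) * ((p $ 1) ^ (k - Suc j) * (p $ 2) ^ j)))"
        by (intro sum.cong refl *) simp
      also have "\<dots> = linform a p * (\<Sum>i<Suc k. \<Sum>j<i. (c i * (a $ 1) ^ (k - i) * (a $ 1) ^ j * (a $ 2) ^ (i - Suc j)) * ((p $ 1) ^ (k - Suc j) * (p $ 2) ^ j))"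
        by (simp only: sum_distrib_left)
      finally have eq: "(a $ 1) ^ k * f p = linform a p * (\<Sum>i<Suc k. \<Sum>j<i. (c i * (a $ 1) ^ (k - i) * (a $ 1) ^ j * (a $ 2) ^ (i - Suc j)) * ((p $ 1) ^ (k - Suc j) * (p $ 2) ^ j))" .
      have "f p = inverse ((a $ 1) ^ k) * ((a $ 1) ^ k * f p)"
        using False by simp
      then show ?thesis
        unfolding eq h_def by (simp only: mult.left_commute)
    qed
    ultimately show ?thesis
      using Suc by auto
  qed
qed

section \<open>The projective line, roots and products of linear forms\<close>

definition proj_line :: "('a::field ^ 2) set" where
  "proj_line = insert (vector [0, 1]) (range (\<lambda>t. vector [1, t]))"

lemma card_proj_line: "card (proj_line :: ('a::{field,finite} ^ 2) set) = CARD('a) + 1"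
proof -
  have inj: "inj (\<lambda>t::'a. vector [1, t] :: 'a ^ 2)"
    by (auto simp: inj_def vec_eq_iff forall_2)
  have "(vector [0, 1] :: 'a ^ 2) \<notin> range (\<lambda>t. vector [1, t])"
    by (auto simp: vec_eq_iff forall_2)
  then show ?thesis
    unfolding proj_line_def by (simp add: card_image[OF inj])
qed

lemma proj_line_nonzero: "a \<in> proj_line \<Longrightarrow> a \<noteq> 0"
  by (auto simp: proj_line_def vec_eq_iff forall_2)

lemma proj_line_rep:
  assumes "p \<noteq> (0 :: 'a::field ^ 2)"
  obtains a k where "a \<in> proj_line" "k \<noteq> 0" "p = k *s a"
proof (cases "p $ 1 = 0")
  case True
  then have "p $ 2 \<noteq> 0" "p = p $ 2 *s vector [0, 1]"
    using assms by (auto simp: vec_eq_iff forall_2)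
  then show ?thesis
    by (intro that[of "vector [0, 1]" "p $ 2"]) (auto simp: proj_line_def)
next
  case False
  then have "p = p $ 1 *s vector [1, p $ 2 / p $ 1]"
    by (auto simp: vec_eq_iff forall_2)
  then show ?thesis
    using False by (intro that[of "vector [1, p $ 2 / p $ 1]" "p $ 1"]) (auto simp: proj_line_def)
qed

lemma linform_eq_0_iff: "a \<in> proj_line \<Longrightarrow> b \<in> proj_line \<Longrightarrow> linform a b = 0 \<longleftrightarrow> a = b"
  by (auto simp: proj_line_def linform_def vec_eq_iff forall_2)

text \<open>Multiplicities and irreducible factors are deliberately invisible here: a generator in a
  section corresponds to a distinct root over the ground field.\<close>

definition roots :: "('a::field ^ 2 \<Rightarrow> 'a) \<Rightarrow> ('a ^ 2) set" where
  "roots f = {a \<in> proj_line. f a = 0}"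

definition linprod :: "('a::field ^ 2) set \<Rightarrow> 'a ^ 2 \<Rightarrow> 'a" where
  "linprod T p = (\<Prod>a\<in>T. linform a p)"

lemma linprod_insert: "finite T \<Longrightarrow> a \<notin> T \<Longrightarrow> linprod (insert a T) p = linform a p * linprod T p"
  by (simp add: linprod_def)

lemma bform_linprod: "finite T \<Longrightarrow> linprod T \<in> bform (Suc (card T))"
proof (induction T rule: finite_induct)
  case empty
  then show ?case using bform_const[of 1] by (simp add: linprod_def[abs_def])
next
  case (insert a T)
  have "(\<lambda>p. linform a p * linprod T p) \<in> bform (Suc (Suc (card T)))"
    by (rule bform_mult[OF bform_linform insert.IH]) simp
  moreover have "linprod (insert a T) = (\<lambda>p. linform a p * linprod T p)"
    using insert.hyps by (intro ext linprod_insert)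
  ultimately show ?case
    using insert.hyps by simp
qed

lemma linprod_eq_0_iff:
  "finite T \<Longrightarrow> T \<subseteq> proj_line \<Longrightarrow> b \<in> proj_line \<Longrightarrow> linprod T b = 0 \<longleftrightarrow> b \<in> T"
  using linform_eq_0_iff[of _ b] by (auto simp: linprod_def subset_eq)

text \<open>The truncated difference carries meaning: with n or more roots the quotient lies in
  \<open>bform 0\<close>, so the form is zero. This is how the bound on the number of roots is
  obtained.\<close>

lemma bform_roots_div:
  assumes "finite T" "f \<in> bform n" "T \<subseteq> roots f"
  shows "\<exists>h\<in>bform (n - card T). f = (\<lambda>p. linprod T p * h p)"
  using assms
proof (induction T rule: finite_induct)
  case empty
  then show ?case by (auto simp: linprod_def[abs_def])
next
  case (insert a T)
  then obtain h where h: "h \<in> bform (n - card T)" "f = (\<lambda>p. linprod T p * h p)"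
    by auto
  have T: "T \<subseteq> proj_line" "a \<in> proj_line" and fa: "f a = 0"
    using insert.prems by (auto simp: roots_def)
  then have "linprod T a \<noteq> 0"
    using insert.hyps by (simp add: linprod_eq_0_iff)
  then have "h a = 0"
    using fa h(2) by simp
  then obtain h' where "h' \<in> bform (n - card T - 1)" "h = (\<lambda>p. linform a p * h' p)"
    using bform_root_div[OF h(1)] proj_line_nonzero[OF T(2)] by blast
  then show ?case
    using insert.hyps h(2) by (intro bexI[of _ h']) (auto simp: linprod_insert fun_eq_iff)
qed

lemma card_roots_less:
  fixes f :: "'a::{field,finite} ^ 2 \<Rightarrow> 'a"
  assumes f: "f \<in> bform n" and nz: "f \<noteq> (\<lambda>p. 0)"
  shows "card (roots f) < n"
proof (rule ccontr)
  assume "\<not> card (roots f) < n"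
  then have "n - card (roots f) = 0" by simp
  then show False
    using bform_roots_div[OF _ f order_refl] nz by (auto simp: bform_0)
qed

text \<open>Two nonzero forms of these dimensions have at most \<open>m + n - 2\<close> roots
  together. That is at most q, too few to cover the q + 1 points of the line.\<close>

lemma bform_mult_eq_0:
  fixes f :: "'a::{field,finite} ^ 2 \<Rightarrow> 'a"
  assumes f: "f \<in> bform m" and g: "g \<in> bform n" and mn: "m + n \<le> CARD('a) + 2"
    and eq: "\<And>a. a \<in> proj_line \<Longrightarrow> f a * g a = 0" and nz: "f \<noteq> (\<lambda>p. 0)"
  shows "g = (\<lambda>p. 0)"
proof (rule ccontr)
  assume "g \<noteq> (\<lambda>p. 0)"
  then have "card (roots f) < m" "card (roots g) < n"
    using card_roots_less f g nz by auto
  moreover have "proj_line = roots f \<union> roots g"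
    using eq by (auto simp: roots_def)
  then have "CARD('a) + 1 \<le> card (roots f) + card (roots g)"
    using card_Un_le[of "roots f" "roots g"] card_proj_line[where 'a = 'a] by simp
  ultimately show False
    using mn by simp
qed

lemma bform_eqI:
  fixes f :: "'a::{field,finite} ^ 2 \<Rightarrow> 'a"
  assumes f: "f \<in> bform n" and g: "g \<in> bform n" and n: "n \<le> CARD('a) + 1"
    and eq: "\<And>a. a \<in> proj_line \<Longrightarrow> f a = g a"
  shows "f = g"
proof -
  have "(\<lambda>p. f p - g p) = (\<lambda>p. 0)"
    by (rule bform_mult_eq_0[OF bform_const[of 1] bform_diff[OF f g]])
      (use n eq in \<open>auto simp: fun_eq_iff\<close>)
  then show ?thesis
    by (simp add: fun_eq_iff)
qed

lemma bform_cancel: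
  fixes f :: "'a::{field,finite} ^ 2 \<Rightarrow> 'a"
  assumes f: "f \<in> bform m" and nz: "f \<noteq> (\<lambda>p. 0)"
    and g: "g \<in> bform n" and h: "h \<in> bform n" and mn: "m + n \<le> CARD('a) + 2"
    and eq: "\<And>a. f a * g a = f a * h a"
  shows "g = h"
proof -
  have "(\<lambda>p. g p - h p) = (\<lambda>p. 0)"
    by (rule bform_mult_eq_0[OF f bform_diff[OF g h] mn _ nz]) (use eq in \<open>simp add: algebra_simps\<close>)
  then show ?thesis
    by (simp add: fun_eq_iff)
qed

section \<open>Interpolation and the number of forms\<close>

lemma bform_nonvanishing:
  assumes "a \<noteq> 0"
  shows "\<exists>h\<in>bform (Suc k). h a \<noteq> 0"
proof (cases "a $ 1 = 0")
  case True
  then have "a $ 2 \<noteq> 0"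
    using assms by (auto simp: vec_eq_iff forall_2)
  then show ?thesis
    using bform_monomial[of 0 k "Suc k"] by (intro bexI[of _ "\<lambda>p. p $ 1 ^ 0 * p $ 2 ^ k"]) auto
next
  case False
  then show ?thesis
    using bform_monomial[of k 0 "Suc k"] by (intro bexI[of _ "\<lambda>p. p $ 1 ^ k * p $ 2 ^ 0"]) auto
qed

text \<open>Lagrange interpolation: the product of the linear forms at the other points, filled up
  to the right degree by a form that does not vanish at \<open>a\<close>, and normalised.\<close>

lemma bform_separates:
  fixes T :: "('a::field ^ 2) set"
  assumes fin: "finite T" and T: "T \<subseteq> proj_line" and n: "card T \<le> n" and a: "a \<in> T"
  obtains h where "h \<in> bform n" "h a = 1" "\<And>b. b \<in> T \<Longrightarrow> b \<noteq> a \<Longrightarrow> h b = 0"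
proof -
  have aP: "a \<in> proj_line"
    using a T by blast
  obtain e where e: "e \<in> bform (Suc (n - card T))" "e a \<noteq> 0"
    using bform_nonvanishing proj_line_nonzero[OF aP] by blast
  have cT: "card T > 0"
    using a fin by (auto simp: card_gt_0_iff)
  define g where "g = (\<lambda>p. linprod (T - {a}) p * e p)"
  have g: "g \<in> bform n"
    unfolding g_def
    by (rule bform_mult[OF bform_linprod e(1)]) (use fin a n cT in auto)
  have z: "linprod (T - {a}) b = 0 \<longleftrightarrow> b \<in> T - {a}" if "b \<in> proj_line" for b
    by (rule linprod_eq_0_iff) (use fin T that in auto)
  have "g a \<noteq> 0"
    using e(2) z[OF aP] by (simp add: g_def)
  moreover have "g b = 0" if "b \<in> T" "b \<noteq> a" for b
    using z[of b] that T by (auto simp: g_def)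
  ultimately show ?thesis
    using bform_cmult[OF g, of "inverse (g a)"]
    by (intro that[of "\<lambda>p. inverse (g a) * g p"]) auto
qed

text \<open>Evaluation at n points of the line is injective by the bound on roots and surjective by
  interpolation. The assumption on n provides the n points.\<close>

lemma card_bform:
  assumes n: "n \<le> CARD('a) + 1"
  shows "card (bform n :: ('a::{field,finite} ^ 2 \<Rightarrow> 'a) set) = CARD('a) ^ n"
proof -
  obtain T :: "('a ^ 2) set" where T: "T \<subseteq> proj_line" "card T = n"
    using obtain_subset_with_card_n[of n "proj_line :: ('a ^ 2) set"] n card_proj_line[where 'a = 'a]
    by (metis)
  have fin: "finite T" by simp
  have "bij_betw (\<lambda>f. restrict f T) (bform n) (T \<rightarrow>\<^sub>E UNIV)"
    unfolding bij_betw_def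
  proof
    show "inj_on (\<lambda>f. restrict f T) (bform n)"
    proof (rule inj_onI)
      fix f g :: "'a ^ 2 \<Rightarrow> 'a" assume fg: "f \<in> bform n" "g \<in> bform n" "restrict f T = restrict g T"
      have "T \<subseteq> roots (\<lambda>p. f p - g p)"
        using T fg(3) by (auto simp: roots_def restrict_def fun_eq_iff) (meson)
      then have "\<not> card (roots (\<lambda>p. f p - g p)) < n"
        using T(2) card_mono[of "roots (\<lambda>p. f p - g p)" T] by simp
      then have "(\<lambda>p. f p - g p) = (\<lambda>p. 0)"
        using card_roots_less[OF bform_diff[OF fg(1,2)]] by blast
      then show "f = g"
        by (simp add: fun_eq_iff)
    qed
    show "(\<lambda>f. restrict f T) ` bform n = (T \<rightarrow>\<^sub>E UNIV)"
    proof
      show "(T \<rightarrow>\<^sub>E UNIV) \<subseteq> (\<lambda>f. restrict f T) ` bform n"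
      proof
        fix x :: "'a ^ 2 \<Rightarrow> 'a" assume x: "x \<in> T \<rightarrow>\<^sub>E UNIV"
        have "\<exists>h. h \<in> bform n \<and> h a = 1 \<and> (\<forall>b\<in>T. b \<noteq> a \<longrightarrow> h b = 0)" if "a \<in> T" for a
          using bform_separates[OF fin T(1) eq_refl[OF T(2)] that] by metis
        then obtain h where h: "\<And>a. a \<in> T \<Longrightarrow> h a \<in> bform n \<and> h a a = 1 \<and> (\<forall>b\<in>T. b \<noteq> a \<longrightarrow> h a b = 0)"
          by metis
        define f where "f = (\<lambda>p. \<Sum>a\<in>T. x a * h a p)"
        have "f \<in> bform n"
          unfolding f_def using h by (intro bform_sum bform_cmult) auto
        moreover have "f b = x b" if "b \<in> T" for b
        proof -
          have "f b = (\<Sum>a\<in>T. if a = b then x b else 0)"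
            unfolding f_def using h that by (intro sum.cong refl) auto
          then show ?thesis using that by simp
        qed
        then have "x = restrict f T"
          using x by (intro ext) (simp add: restrict_def PiE_arb[OF x])
        ultimately show "x \<in> (\<lambda>f. restrict f T) ` bform n"
          by blast
      qed
    qed auto
  qed
  then have "card (bform n :: ('a ^ 2 \<Rightarrow> 'a) set) = card (T \<rightarrow>\<^sub>E (UNIV :: 'a set))"
    by (rule bij_betw_same_card)
  then show ?thesis
    using T(2) by (simp add: card_PiE)
qed

text \<open>A counting argument: the coefficient vectors, \<open>q ^ n\<close> in number, are mapped
  onto the equally many elements of \<open>bform n\<close>, so the map is injective.\<close>

lemma bform_coeff_unique:
  fixes c d :: "nat \<Rightarrow> 'a::{field,finite}"
  assumes n: "n \<le> CARD('a) + 1"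
    and eq: "\<And>p :: 'a ^ 2. (\<Sum>i<n. c i * ((p $ 1) ^ (n - 1 - i) * (p $ 2) ^ i)) = (\<Sum>i<n. d i * ((p $ 1) ^ (n - 1 - i) * (p $ 2) ^ i))"
    and i: "i < n"
  shows "c i = d i"
proof -
  define E where "E = (\<lambda>(c :: nat \<Rightarrow> 'a) (p :: 'a ^ 2). \<Sum>i<n. c i * ((p $ 1) ^ (n - 1 - i) * (p $ 2) ^ i))"
  have r: "E (restrict c {..<n}) = E c" for c
    unfolding E_def by (auto intro!: sum.cong)
  have "E ` ({..<n} \<rightarrow>\<^sub>E UNIV) = bform n"
  proof
    show "bform n \<subseteq> E ` ({..<n} \<rightarrow>\<^sub>E UNIV)"
    proof
      fix f :: "'a ^ 2 \<Rightarrow> 'a" assume "f \<in> bform n"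
      then obtain c where "f = E c"
        unfolding E_def by (elim bformE)
      then have "f = E (restrict c {..<n})"
        using r by simp
      then show "f \<in> E ` ({..<n} \<rightarrow>\<^sub>E UNIV)"
        by (metis image_eqI restrict_PiE_iff UNIV_I)
    qed
  qed (auto simp: E_def bform_def)
  then have "card (E ` ({..<n} \<rightarrow>\<^sub>E UNIV)) = card ({..<n} \<rightarrow>\<^sub>E (UNIV :: 'a set))"
    using card_bform[OF n] by (simp add: card_PiE)
  then have inj: "inj_on E ({..<n} \<rightarrow>\<^sub>E UNIV)"
    by (intro eq_card_imp_inj_on) (auto intro: finite_PiE)
  have "E c = E d"
    using eq by (simp add: E_def fun_eq_iff)
  then have "E (restrict c {..<n}) = E (restrict d {..<n})"
    using r by simp
  then have "restrict c {..<n} = restrict d {..<n}"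
    by (rule inj_onD[OF inj]) simp_all
  then have "restrict c {..<n} i = restrict d {..<n} i"
    by simp
  then show ?thesis
    using i by simp
qed

text \<open>Allows a twisted cubic reparametrised by the projectivity to be treated like one in its
  own parameter.\<close>

lemma bform_compose:
  fixes A :: "'a::field ^ 2 ^ 2"
  assumes "f \<in> bform n"
  shows "(\<lambda>p. f (A *v p)) \<in> bform n"
proof -
  obtain c where c: "f = (\<lambda>p. \<Sum>i<n. c i * ((p $ 1) ^ (n - 1 - i) * (p $ 2) ^ i))"
    using assms by (rule bformE)
  have co: "(\<lambda>p. (A *v p) $ k) \<in> bform 2" for k
    unfolding matrix_vector_mult_def by (simp add: sum_2) (intro bform_add bform_cmult bform_coords)
  have pow: "(\<lambda>p. ((A *v p) $ k) ^ i) \<in> bform (Suc i)" for k i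
  proof (induction i)
    case 0
    then show ?case using bform_const[of 1] by simp
  next
    case (Suc i)
    show ?case
      using bform_mult[OF co Suc.IH] by simp
  qed
  show ?thesis
    unfolding c by (intro bform_sum bform_cmult bform_mult[OF pow pow]) auto
qed

subsection \<open>Primitive pairs of binary forms\<close>

lemma bform_2E:
  assumes "f \<in> bform 2"
  obtains a where "f = linform a"
proof -
  obtain c where c: "f = (\<lambda>p. \<Sum>i<2. c i * ((p $ 1) ^ (2 - 1 - i) * (p $ 2) ^ i))"
    using assms by (rule bformE)
  have "f = linform (vector [c 1, - c 0])"
    unfolding c by (simp add: linform_def fun_eq_iff numeral_2_eq_2)
  then show ?thesis ..
qed

text \<open>
  \<open>prim r f g\<close>: the forms f, g of degrees \<open>r - 3\<close> and \<open>r - 2\<close> have no common factor of positive degree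
  over \<open>F\<^sub>q\<close>, not even one without roots in \<open>F\<^sub>q\<close>.
\<close>

definition prim :: "nat \<Rightarrow> ('a::field ^ 2 \<Rightarrow> 'a) \<Rightarrow> ('a ^ 2 \<Rightarrow> 'a) \<Rightarrow> bool" where
  "prim r f g \<longleftrightarrow> f \<in> bform (r - 2) \<and> g \<in> bform (r - 1) \<and>
     (\<forall>e d f' g'. 1 \<le> e \<longrightarrow> d \<in> bform (Suc e) \<longrightarrow> f' \<in> bform (r - 2 - e) \<longrightarrow> g' \<in> bform (r - 1 - e) \<longrightarrow>
        \<not> (f = (\<lambda>p. d p * f' p) \<and> g = (\<lambda>p. d p * g' p)))"

lemma primD:
  assumes "prim r f g"
  shows "f \<in> bform (r - 2)" "g \<in> bform (r - 1)"
    "\<And>e d f' g'. 1 \<le> e \<Longrightarrow> d \<in> bform (Suc e) \<Longrightarrow> f' \<in> bform (r - 2 - e) \<Longrightarrow>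
       g' \<in> bform (r - 1 - e) \<Longrightarrow> f = (\<lambda>p. d p * f' p) \<Longrightarrow> g = (\<lambda>p. d p * g' p) \<Longrightarrow> False"
  using assms unfolding prim_def by blast+

lemma prim_no_common_root:
  assumes "prim r f g" "a \<noteq> 0"
  shows "f a \<noteq> 0 \<or> g a \<noteq> 0"
proof (rule ccontr)
  assume "\<not> (f a \<noteq> 0 \<or> g a \<noteq> 0)"
  then obtain f' g' where
    "f' \<in> bform (r - 2 - 1)" "f = (\<lambda>p. linform a p * f' p)"
    "g' \<in> bform (r - 1 - 1)" "g = (\<lambda>p. linform a p * g' p)"
    using bform_root_div[OF primD(1)[OF assms(1)] assms(2)]
      bform_root_div[OF primD(2)[OF assms(1)] assms(2)] by auto
  then show False
    using primD(3)[OF assms(1), of 1 "linform a" f' g'] bform_linform[of a]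
    by (simp add: numeral_2_eq_2)
qed

lemma prim_nonzero:
  assumes "prim r f g"
  shows "f \<noteq> (\<lambda>p. 0) \<or> g \<noteq> (\<lambda>p. 0)"
proof -
  have "(vector [1, 1] :: 'a ^ 2) \<noteq> 0"
    by (auto simp: vec_eq_iff forall_2)
  then show ?thesis
    using prim_no_common_root[OF assms, of "vector [1, 1]"] by auto
qed

text \<open>If f were zero, then g, of degree \<open>r - 2\<close>, would itself be a common factor,
  with cofactors 0 and 1. For \<open>r = 2\<close> this g is a constant, and f is indeed
  zero.\<close>

lemma prim_fst_nonzero:
  assumes "prim r f g" "3 \<le> r"
  shows "f \<noteq> (\<lambda>p. 0)"
proof
  assume f: "f = (\<lambda>p. 0)"
  have "Suc (r - 2) = r - 1" "r - 1 - (r - 2) = 1" "1 \<le> r - 2"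
    using assms(2) by auto
  then show False
    using primD(3)[OF assms(1), of "r - 2" g "\<lambda>p. 0" "\<lambda>p. 1"] primD(2)[OF assms(1)] f
      bform_zero bform_const[of 1] by auto
qed

lemma prim_cmult:
  assumes p: "prim r f g" and k: "k \<noteq> 0"
  shows "prim r (\<lambda>p. k * f p) (\<lambda>p. k * g p)"
  unfolding prim_def
proof (intro conjI allI impI notI)
  fix e d f' g'
  assume a: "1 \<le> e" "d \<in> bform (Suc e)" "f' \<in> bform (r - 2 - e)" "g' \<in> bform (r - 1 - e)"
    and eq: "(\<lambda>p. k * f p) = (\<lambda>p. d p * f' p) \<and> (\<lambda>p. k * g p) = (\<lambda>p. d p * g' p)"
  have "f p = inverse k * (k * f p)" "g p = inverse k * (k * g p)" for p
    using k by simp_all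
  then have "f p = inverse k * d p * f' p" "g p = inverse k * d p * g' p" for p
    using eq by (metis mult.assoc)+
  then show False
    using primD(3)[OF p a(1) bform_cmult[OF a(2)] a(3,4)] by blast
qed (use bform_cmult primD(1,2)[OF p] in blast)+

text \<open>Take a common factor of the greatest possible degree e: a further common factor of the
  cofactors would multiply it to one of larger degree. For e above \<open>r - 2\<close> both
  cofactors would lie in \<open>bform 0\<close>, which bounds e.\<close>

lemma prim_factor:
  assumes f: "f \<in> bform (r - 2)" and g: "g \<in> bform (r - 1)"
    and nz: "f \<noteq> (\<lambda>p. 0) \<or> g \<noteq> (\<lambda>p. 0)" and r: "2 \<le> r"
  obtains e d f' g' where "e \<le> r - 2" "d \<in> bform (Suc e)" "prim (r - e) f' g'"
    "f = (\<lambda>p. d p * f' p)" "g = (\<lambda>p. d p * g' p)"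
proof -
  define Q where "Q = (\<lambda>e. \<exists>d\<in>bform (Suc e). \<exists>f'\<in>bform (r - 2 - e). \<exists>g'\<in>bform (r - 1 - e).
    f = (\<lambda>p. d p * f' p) \<and> g = (\<lambda>p. d p * g' p))"
  have "Q 0"
    unfolding Q_def using f g bform_const[of 1] by (intro bexI[of _ "\<lambda>p. 1"] bexI[of _ f] bexI[of _ g]) auto
  have le: "e \<le> r - 2" if "Q e" for e
  proof (rule ccontr)
    assume "\<not> e \<le> r - 2"
    then have "r - 2 - e = 0" "r - 1 - e = 0" by auto
    then show False
      using that nz by (auto simp: Q_def bform_0)
  qed
  obtain e where e: "Q e" and max: "\<And>e'. Q e' \<Longrightarrow> e' \<le> e"
    using Nat.ex_has_greatest_nat[of Q 0 "r - 2"] \<open>Q 0\<close> le by blast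
  obtain d f' g' where d: "d \<in> bform (Suc e)" and f': "f' \<in> bform (r - 2 - e)"
    and g': "g' \<in> bform (r - 1 - e)" and eq: "f = (\<lambda>p. d p * f' p)" "g = (\<lambda>p. d p * g' p)"
    using e unfolding Q_def by blast
  have "prim (r - e) f' g'"
    unfolding prim_def
  proof (intro conjI allI impI notI)
    show "f' \<in> bform (r - e - 2)" "g' \<in> bform (r - e - 1)"
      using f' g' by (simp_all add: diff_commute)
    fix e' d' f'' g''
    assume a: "1 \<le> e'" "d' \<in> bform (Suc e')" "f'' \<in> bform (r - e - 2 - e')" "g'' \<in> bform (r - e - 1 - e')"
      "f' = (\<lambda>p. d' p * f'' p) \<and> g' = (\<lambda>p. d' p * g'' p)"
    have "(\<lambda>p. d p * d' p) \<in> bform (Suc (e + e'))"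
      by (rule bform_mult[OF d a(2)]) simp
    moreover have "r - e - 2 - e' = r - 2 - (e + e')" "r - e - 1 - e' = r - 1 - (e + e')"
      by auto
    ultimately have "Q (e + e')"
      unfolding Q_def using a(3-5) eq
      by (intro bexI[of _ "\<lambda>p. d p * d' p"] bexI[of _ f''] bexI[of _ g'']) (auto simp: mult.assoc)
    then show False
      using max a(1) by fastforce
  qed
  then show ?thesis
    using that le[OF e] d eq by blast
qed

text \<open>The quadratic f would be a common factor, with cofactors 1 and \<open>B\<close>.\<close>

lemma prim_5_kernel_const:
  assumes p: "prim 5 f g" and B: "B \<in> bform 2" and eq: "g = (\<lambda>p. B p * f p)"
  shows False
  using primD(3)[OF p, of 2 f "\<lambda>p. 1" B] primD(1)[OF p] B eq bform_const[of 1]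
  by (simp add: mult.commute numeral_3_eq_3)

text \<open>At the root of a nonzero linear \<open>A\<close>, either B or f vanishes. Cancelling
  \<open>A\<close> gives in the first case \<open>g = B' f\<close>, which is already excluded, and
  in the second \<open>f = A m\<close> and \<open>g = m B\<close>, with the common factor m.\<close>

lemma prim_5_kernel_linear:
  fixes f :: "'a::{field,finite} ^ 2 \<Rightarrow> 'a"
  assumes q: "5 \<le> CARD('a)" and p: "prim 5 f g" and A: "A \<in> bform 2" and B: "B \<in> bform 3"
    and eq: "\<And>p. A p * g p = B p * f p"
  shows "A = (\<lambda>p. 0)"
proof (rule ccontr)
  assume nz: "A \<noteq> (\<lambda>p. 0)"
  have f: "f \<in> bform 3" and g: "g \<in> bform 4"
    using primD(1,2)[OF p] by simp_all
  obtain a where a: "A = linform a"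
    using A by (rule bform_2E)
  have a0: "a \<noteq> 0"
    using nz a by (auto simp: linform_def fun_eq_iff)
  show False
  proof (cases "f a = 0")
    case False
    then have "B a = 0"
      using eq[of a] a by simp
    then obtain B' where B': "B' \<in> bform 2" "B = (\<lambda>p. linform a p * B' p)"
      using bform_root_div[OF B a0] by auto
    have "(\<lambda>p. B' p * f p) \<in> bform 4"
      by (rule bform_mult[OF B'(1) f]) simp
    then have "g = (\<lambda>p. B' p * f p)"
      by (rule bform_cancel[OF A nz g]) (use q eq a B' in \<open>auto simp: mult.assoc\<close>)
    then show False
      using prim_5_kernel_const[OF p B'(1)] by blast
  next
    case True
    then obtain m where m: "m \<in> bform 2" "f = (\<lambda>p. linform a p * m p)"
      using bform_root_div[OF f a0] by auto
    have "(\<lambda>p. m p * B p) \<in> bform 4"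
      by (rule bform_mult[OF m(1) B]) simp
    then have "g = (\<lambda>p. m p * B p)"
      by (rule bform_cancel[OF A nz g]) (use q eq a m in \<open>auto simp: mult_ac\<close>)
    then show False
      using primD(3)[OF p, of 1 m "linform a" B] m B bform_linform[of a]
      by (simp add: mult.commute numeral_2_eq_2)
  qed
qed

text \<open>This stands in for Euclid's lemma. As r is at most 5, f is zero, constant, linear or
  quadratic, and each case is settled by hand. If \<open>s < r\<close>, the multiplier lies in
  \<open>bform 0\<close>, so A and B vanish.\<close>

lemma prim_kernel:
  fixes f :: "'a::{field,finite} ^ 2 \<Rightarrow> 'a"
  assumes q: "5 \<le> CARD('a)" and p: "prim r f g" and r: "2 \<le> r" "r \<le> 5" and s: "s \<le> 5"
    and A: "A \<in> bform (s - 2)" and B: "B \<in> bform (s - 1)"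
    and eq: "\<And>p. A p * g p = B p * f p"
  shows "\<exists>h\<in>bform (s + 1 - r). A = (\<lambda>p. h p * f p) \<and> B = (\<lambda>p. h p * g p)"
proof -
  have f: "f \<in> bform (r - 2)" and g: "g \<in> bform (r - 1)"
    using primD(1,2)[OF p] by simp_all
  have B0: "B = (\<lambda>p. 0)" if "A = (\<lambda>p. 0)" "3 \<le> r"
    by (rule bform_mult_eq_0[OF f B _ _ prim_fst_nonzero[OF p that(2)]])
      (use q s r that eq in \<open>auto simp: mult.commute\<close>)
  have triv: ?thesis if "A = (\<lambda>p. 0)" "3 \<le> r"
    using B0[OF that] that bform_zero by (intro bexI[of _ "\<lambda>p. 0"]) auto
  have s3: "3 \<le> s" if "A \<noteq> (\<lambda>p. 0)"
  proof (rule ccontr)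
    assume "\<not> 3 \<le> s"
    then show False
      using A that by (simp add: bform_0)
  qed
  consider "r = 2" | "r = 3" | "r = 4" | "r = 5"
    using r by linarith
  then show ?thesis
  proof cases
    case 1
    then have f0: "f = (\<lambda>p. 0)"
      using f by (simp add: bform_0)
    obtain k where k: "g = (\<lambda>p. k)"
      using g 1 by (auto elim: bform_1E)
    have "k \<noteq> 0"
      using prim_nonzero[OF p] f0 k by auto
    then show ?thesis
      using eq bform_cmult[OF B, of "inverse k"] 1 f0 k
      by (intro bexI[of _ "\<lambda>p. inverse k * B p"]) (auto simp: fun_eq_iff)
  next
    case 2
    obtain k where k: "f = (\<lambda>p. k)"
      using f 2 by (auto elim: bform_1E)
    have "k \<noteq> 0"
      using prim_fst_nonzero[OF p] 2 k by auto
    moreover have "B p = inverse k * A p * g p" for p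
      using eq[of p] k \<open>k \<noteq> 0\<close> by (simp add: field_simps)
    ultimately show ?thesis
      using bform_cmult[OF A, of "inverse k"] 2 k
      by (intro bexI[of _ "\<lambda>p. inverse k * A p"]) (auto simp: fun_eq_iff)
  next
    case 3
    show ?thesis
    proof (cases "A = (\<lambda>p. 0)")
      case True
      then show ?thesis using triv 3 by simp
    next
      case False
      have f2: "f \<in> bform 2"
        using f 3 by simp
      then obtain a where a: "f = linform a"
        by (rule bform_2E)
      have nz: "f \<noteq> (\<lambda>p. 0)"
        using prim_fst_nonzero[OF p] 3 by simp
      then have a0: "a \<noteq> 0"
        using a by (auto simp: linform_def fun_eq_iff)
      then have "A a = 0"
        using prim_no_common_root[OF p a0] eq[of a] a by simp
      then obtain h where h: "h \<in> bform (s - 3)" "A = (\<lambda>p. linform a p * h p)"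
        using bform_root_div[OF A a0] by auto
      have "(\<lambda>p. h p * g p) \<in> bform (s - 1)"
        by (rule bform_mult[OF h(1) g]) (use 3 s3[OF False] in simp)
      moreover have "f p * B p = f p * (h p * g p)" for p
        using eq[of p] by (simp only: a h mult_ac)
      ultimately have "B = (\<lambda>p. h p * g p)"
        by (intro bform_cancel[OF f2 nz B]) (use q s in auto)
      then show ?thesis
        using h a 3 by (intro bexI[of _ h]) (auto simp: mult.commute)
    qed
  next
    case 4
    have p5: "prim 5 f g" and f3: "f \<in> bform 3" and g4: "g \<in> bform 4"
      using p f g 4 by simp_all
    have nz: "f \<noteq> (\<lambda>p. 0)"
      using prim_fst_nonzero[OF p] 4 by simp
    show ?thesis
    proof (cases "A = (\<lambda>p. 0)")
      case True
      then show ?thesis using triv 4 by simp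
    next
      case False
      consider "s = 3" | "s = 4" | "s = 5"
        using s3[OF False] s by linarith
      then show ?thesis
      proof cases
        case 1
        then obtain k where k: "A = (\<lambda>p. k)"
          using A by (auto elim: bform_1E)
        then have "k \<noteq> 0"
          using False by auto
        then have "g = (\<lambda>p. inverse k * B p * f p)"
          using eq k by (simp add: fun_eq_iff field_simps)
        moreover have "(\<lambda>p. inverse k * B p) \<in> bform 2"
          using bform_cmult[OF B] 1 by simp
        ultimately show ?thesis
          using prim_5_kernel_const[OF p5] by blast
      next
        case 2
        then show ?thesis
          using prim_5_kernel_linear[OF q p5 _ _ eq] A B False by simp
      next
        case 3
        obtain a where a: "a \<in> proj_line" "f a \<noteq> 0"
          using bform_eqI[OF f3 bform_zero] nz q by auto
        \<comment> \<open>Subtracting t times (f, g) makes \<open>A'\<close> vanish at a point where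
          f does not. Then \<open>B'\<close> vanishes there too, a linear form cancels, and the
          linear case shows that nothing is left over, so t is the multiplier.\<close>
        define t where "t = A a / f a"
        define A' where "A' = (\<lambda>p. A p - t * f p)"
        define B' where "B' = (\<lambda>p. B p - t * g p)"
        have A': "A' \<in> bform 3" and B': "B' \<in> bform 4"
          unfolding A'_def B'_def using A B 3 by (auto intro!: bform_diff bform_cmult f3 g4)
        have eq': "A' p * g p = B' p * f p" for p
          using eq[of p] by (simp add: A'_def B'_def algebra_simps)
        have "A' a = 0"
          using a by (simp add: A'_def t_def)
        moreover from this have "B' a = 0"
          using eq'[of a] a by simp
        ultimately obtain A'' B'' where AB:
          "A'' \<in> bform 2" "A' = (\<lambda>p. linform a p * A'' p)"
          "B'' \<in> bform 3" "B' = (\<lambda>p. linform a p * B'' p)"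
          using bform_root_div[OF A' proj_line_nonzero[OF a(1)]]
            bform_root_div[OF B' proj_line_nonzero[OF a(1)]] by auto
        have "(\<lambda>p. A'' p * g p) \<in> bform 5" "(\<lambda>p. B'' p * f p) \<in> bform 5"
          by (rule bform_mult[OF AB(1) g4] bform_mult[OF AB(3) f3]; simp)+
        then have "(\<lambda>p. A'' p * g p) = (\<lambda>p. B'' p * f p)"
        proof (rule bform_cancel[OF bform_linform[of a], rotated])
          show "linform a \<noteq> (\<lambda>p. 0)"
            using linform_nonzero proj_line_nonzero[OF a(1)] by blast
          show "linform a p * (A'' p * g p) = linform a p * (B'' p * f p)" for p
            using eq'[of p] AB by (simp add: mult.assoc)
        qed (use q in auto)
        then have "A'' = (\<lambda>p. 0)"
          using prim_5_kernel_linear[OF q p5 AB(1,3)] by (simp add: fun_eq_iff)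
        then have A'0: "A' = (\<lambda>p. 0)"
          using AB by simp
        have "B' = (\<lambda>p. 0)"
          by (rule bform_mult_eq_0[OF f3 B' _ _ nz]) (use q eq' A'0 in \<open>auto simp: mult.commute\<close>)
        then show ?thesis
          using A'0 bform_const[of t] 3 4
          by (intro bexI[of _ "\<lambda>p. t"]) (auto simp: A'_def B'_def fun_eq_iff)
      qed
    qed
  qed
qed

text \<open>The kernel lemma applies in both directions. A nonzero multiplier forces
  \<open>r \<le> s\<close> in one direction and \<open>s \<le> r\<close> in the other, so the
  multiplier is constant.\<close>

lemma prim_unique:
  fixes f :: "'a::{field,finite} ^ 2 \<Rightarrow> 'a"
  assumes q: "5 \<le> CARD('a)" and p: "prim r f g" "r \<in> {2..5}" and p': "prim s f' g'" "s \<in> {2..5}"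
    and eq: "\<And>p. f' p * g p = g' p * f p"
  shows "s = r \<and> (\<exists>k. k \<noteq> 0 \<and> f' = (\<lambda>p. k * f p) \<and> g' = (\<lambda>p. k * g p))"
proof -
  obtain h where h: "h \<in> bform (s + 1 - r)" "f' = (\<lambda>p. h p * f p)" "g' = (\<lambda>p. h p * g p)"
    using prim_kernel[OF q p(1) _ _ _ primD(1,2)[OF p'(1)] eq] p p' by auto
  have "\<exists>h\<in>bform (r + 1 - s). f = (\<lambda>p. h p * f' p) \<and> g = (\<lambda>p. h p * g' p)"
    by (rule prim_kernel[OF q p'(1) _ _ _ primD(1,2)[OF p(1)]]) (use p p' eq in \<open>auto simp: mult.commute\<close>)
  then have "r + 1 - s \<noteq> 0"
    using prim_nonzero[OF p(1)] by (metis bform_0 singletonD mult_zero_left)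
  moreover have "s + 1 - r \<noteq> 0"
    using prim_nonzero[OF p'(1)] h by (metis bform_0 singletonD mult_zero_left)
  ultimately have sr: "s = r" by simp
  then obtain k where "h = (\<lambda>p. k)"
    using h(1) by (auto elim: bform_1E)
  moreover from this have "k \<noteq> 0"
    using prim_nonzero[OF p'(1)] h by auto
  ultimately show ?thesis
    using h sr by blast
qed

text \<open>Cross-multiplying and cancelling \<open>d'\<close> shows that the two primitive pairs
  are proportional; cancelling a nonzero member of the pair then compares the factors d.\<close>

lemma prim_factor_unique:
  fixes f :: "'a::{field,finite} ^ 2 \<Rightarrow> 'a"
  assumes q: "5 \<le> CARD('a)" and p: "prim r f g" "r \<in> {2..5}" and p': "prim s f' g'" "s \<in> {2..5}"
    and d: "d \<in> bform (6 - r)" "d \<noteq> (\<lambda>p. 0)" and d': "d' \<in> bform (6 - s)" "d' \<noteq> (\<lambda>p. 0)"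
    and eqf: "\<And>p. d' p * f' p = d p * f p" and eqg: "\<And>p. d' p * g' p = d p * g p"
  shows "s = r \<and> (\<exists>k. k \<noteq> 0 \<and> d = (\<lambda>p. k * d' p) \<and> f' = (\<lambda>p. k * f p) \<and> g' = (\<lambda>p. k * g p))"
proof -
  have "(\<lambda>p. f' p * g p) \<in> bform (r + s - 4)" "(\<lambda>p. g' p * f p) \<in> bform (r + s - 4)"
    by (rule bform_mult[OF primD(1)[OF p'(1)] primD(2)[OF p(1)]]
      bform_mult[OF primD(2)[OF p'(1)] primD(1)[OF p(1)]]; use p p' in auto)+
  then have "(\<lambda>p. f' p * g p) = (\<lambda>p. g' p * f p)"
  proof (rule bform_cancel[OF d'])
    show "d' p * (f' p * g p) = d' p * (g' p * f p)" for p
    proof -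
      have "d' p * (f' p * g p) = d p * f p * g p" "d' p * (g' p * f p) = d p * g p * f p"
        by (simp_all only: eqf eqg flip: mult.assoc)
      then show ?thesis
        by (simp only: mult_ac)
    qed
  qed (use q p p' in auto)
  then have sr: "s = r" "\<exists>k. k \<noteq> 0 \<and> f' = (\<lambda>p. k * f p) \<and> g' = (\<lambda>p. k * g p)"
    using prim_unique[OF q p p'] by (auto simp: fun_eq_iff)
  then obtain k where k: "k \<noteq> 0" "f' = (\<lambda>p. k * f p)" "g' = (\<lambda>p. k * g p)"
    by blast
  have kd: "(\<lambda>p. k * d' p) \<in> bform (6 - r)"
    using bform_cmult[OF d'(1)] sr by simp
  have eqs: "g p * d p = g p * (k * d' p)" "f p * d p = f p * (k * d' p)" for p
    using eqf[of p] eqg[of p] by (simp_all only: k(2,3) mult_ac)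
  have "d = (\<lambda>p. k * d' p)"
  \<comment> \<open>The zero case is that of \<open>r = 2\<close>, where d has to be recovered from
    g.\<close>
  proof (cases "f = (\<lambda>p. 0)")
    case True
    then show ?thesis
      by (intro bform_cancel[OF primD(2)[OF p(1)] _ d(1) kd _ eqs(1)])
        (use prim_nonzero[OF p(1)] q p in auto)
  next
    case False
    then show ?thesis
      by (intro bform_cancel[OF primD(1)[OF p(1)] _ d(1) kd _ eqs(2)]) (use q p in auto)
  qed
  then show ?thesis
    using sr k by blast
qed

subsection \<open>Counting binary forms and primitive pairs\<close>

lemma card_eq_mult_fibres:
  assumes fin: "finite A" and img: "\<phi> ` A = B" and fib: "\<And>a. a \<in> A \<Longrightarrow> card {x \<in> A. \<phi> x = \<phi> a} = k"
  shows "card A = k * card B"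
proof -
  have "card A = (\<Sum>b\<in>B. card {x \<in> A. \<phi> x = b})"
    using sum.group[OF fin, of B \<phi> "\<lambda>_. 1 :: nat"] fin img by auto
  also have "\<dots> = (\<Sum>b\<in>B. k)"
    using fib img by (intro sum.cong) auto
  finally show ?thesis
    by simp
qed

text \<open>These forms are the multiples of \<open>linprod T\<close> by arbitrary forms. As T has
  at most q elements, some point lies outside it, so \<open>linprod T\<close> is not the zero
  function and can be cancelled.\<close>

lemma card_bform_vanishing:
  fixes T :: "('a::{field,finite} ^ 2) set"
  assumes T: "T \<subseteq> proj_line" "card T \<le> n" and n: "n \<le> CARD('a)"
  shows "card {f \<in> bform n. T \<subseteq> roots f} = CARD('a) ^ (n - card T)"
proof -
  have "proj_line - T \<noteq> {}"
    using card_mono[of T proj_line] T n card_proj_line[where 'a = 'a] by auto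
  then obtain b where "b \<in> proj_line" "b \<notin> T" by blast
  then have "linprod T b \<noteq> 0"
    using T by (simp add: linprod_eq_0_iff)
  then have nz: "linprod T \<noteq> (\<lambda>p. 0)"
    by auto
  have "inj_on (\<lambda>h p. linprod T p * h p) (bform (n - card T))"
    by (rule inj_onI, rule bform_cancel[OF bform_linprod nz]) (use T n in \<open>auto simp: fun_eq_iff\<close>)
  moreover have "(\<lambda>h p. linprod T p * h p) ` bform (n - card T) = {f \<in> bform n. T \<subseteq> roots f}"
  proof (intro equalityI subsetI)
    fix f assume "f \<in> (\<lambda>h p. linprod T p * h p) ` bform (n - card T)"
    then obtain h where h: "h \<in> bform (n - card T)" "f = (\<lambda>p. linprod T p * h p)" by blast
    moreover have "(\<lambda>p. linprod T p * h p) \<in> bform n"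
      by (rule bform_mult[OF bform_linprod h(1)]) (use T in auto)
    moreover have "T \<subseteq> roots f"
      using T(1) linprod_eq_0_iff[of T] by (auto simp: roots_def h)
    ultimately show "f \<in> {f \<in> bform n. T \<subseteq> roots f}" by simp
  next
    fix f assume "f \<in> {f \<in> bform n. T \<subseteq> roots f}"
    then show "f \<in> (\<lambda>h p. linprod T p * h p) ` bform (n - card T)"
      using bform_roots_div[of T f n] by auto
  qed
  ultimately have "card {f \<in> bform n. T \<subseteq> roots f} = card (bform (n - card T) :: ('a ^ 2 \<Rightarrow> 'a) set)"
    by (metis card_image)
  then show ?thesis
    using card_bform[where n = "n - card T" and 'a = 'a] n by simp
qed

definition rooted :: "nat \<Rightarrow> nat \<Rightarrow> ('a::field ^ 2 \<Rightarrow> 'a) set" where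
  "rooted n i = {f \<in> bform n. f \<noteq> (\<lambda>p. 0) \<and> card (roots f) = i}"

text \<open>Double counting of the pairs of a nonzero form and a set of k of its roots.\<close>

lemma rooted_moments:
  assumes k: "k \<le> n" and n: "n \<le> CARD('a)"
  shows "(\<Sum>i<n. (i choose k) * card (rooted n i :: ('a::{field,finite} ^ 2 \<Rightarrow> 'a) set))
    = ((CARD('a) + 1) choose k) * (CARD('a) ^ (n - k) - 1)"
proof -
  define X where "X = (bform n - {\<lambda>p. 0} :: ('a ^ 2 \<Rightarrow> 'a) set)"
  define Sub where "Sub = {T :: ('a ^ 2) set. T \<subseteq> proj_line \<and> card T = k}"
  have "(\<Sum>f\<in>X. card (roots f) choose k) = (\<Sum>f\<in>X. card {T \<in> Sub. T \<subseteq> roots f})"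
  proof (rule sum.cong)
    fix f assume "f \<in> X"
    have "{T \<in> Sub. T \<subseteq> roots f} = {T. T \<subseteq> roots f \<and> card T = k}"
      by (auto simp: Sub_def roots_def)
    then show "card (roots f) choose k = card {T \<in> Sub. T \<subseteq> roots f}"
      by (simp add: n_subsets)
  qed simp
  also have "\<dots> = (\<Sum>T\<in>Sub. CARD('a) ^ (n - k) - 1)"
  proof (rule sum_multicount_gen)
    show "\<forall>T\<in>Sub. card {f \<in> X. T \<subseteq> roots f} = CARD('a) ^ (n - k) - 1"
    proof
      fix T assume T: "T \<in> Sub"
      have "{f \<in> X. T \<subseteq> roots f} = {f \<in> bform n. T \<subseteq> roots f} - {\<lambda>p. 0}"
        by (auto simp: X_def)
      moreover have "(\<lambda>p. 0) \<in> {f \<in> bform n. T \<subseteq> roots f}"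
        using T by (auto simp: Sub_def roots_def bform_zero)
      ultimately show "card {f \<in> X. T \<subseteq> roots f} = CARD('a) ^ (n - k) - 1"
        using card_bform_vanishing[of T n] T k n by (simp add: Sub_def)
    qed
  qed simp_all
  also have "\<dots> = ((CARD('a) + 1) choose k) * (CARD('a) ^ (n - k) - 1)"
    using n_subsets[of "proj_line :: ('a ^ 2) set" k] card_proj_line[where 'a = 'a] by (simp add: Sub_def)
  finally have 1: "(\<Sum>f\<in>X. card (roots f) choose k) = ((CARD('a) + 1) choose k) * (CARD('a) ^ (n - k) - 1)" .
  have "(\<Sum>f\<in>X. card (roots f) choose k) = (\<Sum>i<n. \<Sum>f\<in>{f \<in> X. card (roots f) = i}. card (roots f) choose k)"
    by (rule sum.group[symmetric]) (auto simp: X_def intro: card_roots_less)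
  also have "\<dots> = (\<Sum>i<n. (i choose k) * card (rooted n i :: ('a ^ 2 \<Rightarrow> 'a) set))"
  proof (rule sum.cong)
    fix i
    have "{f \<in> X. card (roots f) = i} = rooted n i"
      by (auto simp: X_def rooted_def)
    then show "(\<Sum>f\<in>{f \<in> X. card (roots f) = i}. card (roots f) choose k)
      = (i choose k) * card (rooted n i :: ('a ^ 2 \<Rightarrow> 'a) set)"
      by (simp add: rooted_def)
  qed simp
  finally show ?thesis
    using 1 by simp
qed

lemma real_choose_2: "real (Suc n choose 2) = (real n ^ 2 + real n) / 2"
  by (simp add: choose_two real_of_nat_div power2_eq_square field_simps)

lemma real_choose_3: "real (Suc n choose 3) = (real n ^ 3 - real n) / 6"
proof -
  have "3 * (Suc n choose 3) = Suc n * (n choose 2)"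
    using Suc_times_binomial[of 2 n] by (simp add: numeral_3_eq_3 numeral_2_eq_2)
  then have "3 * real (Suc n choose 3) = (real n + 1) * real (n choose 2)"
    by (metis of_nat_mult of_nat_Suc of_nat_numeral add.commute)
  moreover have "real (n choose 2) = real n * (real n - 1) / 2"
  proof (cases n)
    case (Suc m)
    then show ?thesis
      unfolding Suc real_choose_2 by (simp add: power2_eq_square field_simps)
  qed simp
  ultimately show ?thesis
    by (simp add: power3_eq_cube field_simps)
qed

context
  fixes q :: real
  assumes q: "q = real CARD('a::{field,finite})" and q5: "5 \<le> CARD('a)"
begin

lemma rooted_moments_real:
  assumes "k \<le> n" "n \<le> 4"
  shows "(\<Sum>i<n. real (i choose k) * real (card (rooted n i :: ('a ^ 2 \<Rightarrow> 'a) set)))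
    = real ((CARD('a) + 1) choose k) * (q ^ (n - k) - 1)"
proof -
  have "real (\<Sum>i<n. (i choose k) * card (rooted n i :: ('a ^ 2 \<Rightarrow> 'a) set))
    = real ((CARD('a) + 1) choose k) * real (CARD('a) ^ (n - k) - 1)"
    using rooted_moments[of k n, where 'a = 'a] assms q5 by simp
  moreover have "real (CARD('a) ^ (n - k) - 1) = q ^ (n - k) - 1"
    using q q5 by (simp add: of_nat_diff)
  ultimately show ?thesis
    by simp
qed

text \<open>The binomial moments for \<open>k < n\<close> form a triangular system, solved from the
  largest k downwards. The factor \<open>q - 1\<close> counts scalar multiples and is kept apart:
  the cofactors for \<open>n = 4\<close> become the numbers of 5-spaces that meet the surface in the
  conic and generators.\<close>

lemma card_rooted:
  shows "real (card (rooted 1 0 :: ('a ^ 2 \<Rightarrow> 'a) set)) = q - 1"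
    and "real (card (rooted 2 1 :: ('a ^ 2 \<Rightarrow> 'a) set)) = (q - 1) * (q + 1)"
    and "real (card (rooted 3 0 :: ('a ^ 2 \<Rightarrow> 'a) set)) = (q - 1) * ((q^2 - q) / 2)"
    and "real (card (rooted 3 1 :: ('a ^ 2 \<Rightarrow> 'a) set)) = (q - 1) * (q + 1)"
    and "real (card (rooted 3 2 :: ('a ^ 2 \<Rightarrow> 'a) set)) = (q - 1) * ((q^2 + q) / 2)"
    and "real (card (rooted 4 0 :: ('a ^ 2 \<Rightarrow> 'a) set)) = (q - 1) * ((q^3 - q) / 3)"
    and "real (card (rooted 4 1 :: ('a ^ 2 \<Rightarrow> 'a) set)) = (q - 1) * (q^3 / 2 + q / 2 + 1)"
    and "real (card (rooted 4 2 :: ('a ^ 2 \<Rightarrow> 'a) set)) = (q - 1) * (q^2 + q)"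
    and "real (card (rooted 4 3 :: ('a ^ 2 \<Rightarrow> 'a) set)) = (q - 1) * ((q^3 - q) / 6)"
proof -
  note m = rooted_moments_real
  have c2: "real (Suc CARD('a) choose 2) = (q^2 + q) / 2"
    using real_choose_2[of "CARD('a)"] q by simp
  have c3: "real (Suc CARD('a) choose 3) = (q^3 - q) / 6"
    using real_choose_3[of "CARD('a)"] q by simp
  note n = eval_nat_numeral
  show "real (card (rooted 1 0 :: ('a ^ 2 \<Rightarrow> 'a) set)) = q - 1"
    using m[of 0 1] by simp
  show "real (card (rooted 2 1 :: ('a ^ 2 \<Rightarrow> 'a) set)) = (q - 1) * (q + 1)"
    using m[of 1 2] q by (simp add: n)
  define a where "a = (\<lambda>i. real (card (rooted 3 i :: ('a ^ 2 \<Rightarrow> 'a) set)))"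
  define b where "b = (\<lambda>i. real (card (rooted 4 i :: ('a ^ 2 \<Rightarrow> 'a) set)))"
  have sum3: "(\<Sum>i<3. f i) = f 0 + f 1 + f 2" and sum4: "(\<Sum>i<4. f i) = f 0 + f 1 + f 2 + f 3" for f :: "nat \<Rightarrow> real"
    by (simp_all add: n)
  have a: "a 0 + a 1 + a 2 = q ^ 3 - 1" "a 1 + 2 * a 2 = (q + 1) * (q^2 - 1)"
    "a 2 = (q^2 + q) / 2 * (q - 1)"
    using m[of 0 3] m[of 1 3] m[of 2 3] q c2 by (simp_all add: a_def sum3 binomial_eq_0)
  have t: "3 choose 2 = (3::nat)" by (simp add: n)
  have b: "b 0 + b 1 + b 2 + b 3 = q ^ 4 - 1" "b 1 + 2 * b 2 + 3 * b 3 = (q + 1) * (q^3 - 1)"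
    "b 2 + 3 * b 3 = (q^2 + q) / 2 * (q^2 - 1)" "b 3 = (q^3 - q) / 6 * (q - 1)"
    using m[of 0 4] m[of 1 4] m[of 2 4] m[of 3 4] q c2 c3 by (simp_all add: b_def sum4 t binomial_eq_0)
  have 32: "a 2 = (q - 1) * ((q^2 + q) / 2)" using a(3) by simp
  have 31: "a 1 = (q - 1) * (q + 1)" using a(2) unfolding 32 by (simp add: power2_eq_square field_simps)
  have 30: "a 0 = (q - 1) * ((q^2 - q) / 2)" using a(1) unfolding 32 31
    by (simp add: power2_eq_square power3_eq_cube field_simps)
  have 43: "b 3 = (q - 1) * ((q^3 - q) / 6)" using b(4) by simp
  have 42: "b 2 = (q - 1) * (q^2 + q)" using b(3) unfolding 43
    by (simp add: power2_eq_square power3_eq_cube field_simps)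
  have 41: "b 1 = (q - 1) * (q^3 / 2 + q / 2 + 1)" using b(2) unfolding 43 42
    by (simp add: power2_eq_square power3_eq_cube field_simps)
  have 40: "b 0 = (q - 1) * ((q^3 - q) / 3)" using b(1) unfolding 43 42 41
    by (simp add: power2_eq_square power3_eq_cube power4_eq_xxxx field_simps)
  show "real (card (rooted 3 0 :: ('a ^ 2 \<Rightarrow> 'a) set)) = (q - 1) * ((q^2 - q) / 2)"
    and "real (card (rooted 3 1 :: ('a ^ 2 \<Rightarrow> 'a) set)) = (q - 1) * (q + 1)"
    and "real (card (rooted 3 2 :: ('a ^ 2 \<Rightarrow> 'a) set)) = (q - 1) * ((q^2 + q) / 2)"
    and "real (card (rooted 4 0 :: ('a ^ 2 \<Rightarrow> 'a) set)) = (q - 1) * ((q^3 - q) / 3)"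
    and "real (card (rooted 4 1 :: ('a ^ 2 \<Rightarrow> 'a) set)) = (q - 1) * (q^3 / 2 + q / 2 + 1)"
    and "real (card (rooted 4 2 :: ('a ^ 2 \<Rightarrow> 'a) set)) = (q - 1) * (q^2 + q)"
    and "real (card (rooted 4 3 :: ('a ^ 2 \<Rightarrow> 'a) set)) = (q - 1) * ((q^3 - q) / 6)"
    using 30 31 32 40 41 42 43 unfolding a_def b_def by blast+
qed

end

section \<open>Counting primitive pairs\<close>

definition primset :: "nat \<Rightarrow> (('a::field ^ 2 \<Rightarrow> 'a) \<times> ('a ^ 2 \<Rightarrow> 'a)) set" where
  "primset r = {(f, g). prim r f g}"

lemma primset_2: "primset 2 = {\<lambda>p. 0} \<times> (bform 1 - {\<lambda>p. 0})"
proof (intro equalityI subsetI)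
  fix x :: "('a::field ^ 2 \<Rightarrow> 'a) \<times> ('a ^ 2 \<Rightarrow> 'a)" assume "x \<in> primset 2"
  then obtain f g where x: "x = (f, g)" and p: "prim 2 f g"
    by (auto simp: primset_def)
  then have "f = (\<lambda>p. 0)"
    using primD(1)[OF p] by (simp add: bform_0)
  then show "x \<in> {\<lambda>p. 0} \<times> (bform 1 - {\<lambda>p. 0})"
    using primD(2)[OF p] prim_nonzero[OF p] x by auto
next
  fix x :: "('a::field ^ 2 \<Rightarrow> 'a) \<times> ('a ^ 2 \<Rightarrow> 'a)" assume "x \<in> {\<lambda>p. 0} \<times> (bform 1 - {\<lambda>p. 0})"
  then obtain g where x: "x = (\<lambda>p. 0, g)" and g: "g \<in> bform 1" "g \<noteq> (\<lambda>p. 0)"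
    by auto
  have "prim 2 (\<lambda>p. 0) g"
    unfolding prim_def using g by (auto simp: bform_zero bform_0)
  then show "x \<in> primset 2"
    using x by (simp add: primset_def)
qed

lemma primset_3: "primset 3 = (bform 1 - {\<lambda>p. 0}) \<times> bform 2"
proof (intro equalityI subsetI)
  fix x :: "('a::field ^ 2 \<Rightarrow> 'a) \<times> ('a ^ 2 \<Rightarrow> 'a)" assume "x \<in> primset 3"
  then obtain f g where x: "x = (f, g)" and p: "prim 3 f g"
    by (auto simp: primset_def)
  then show "x \<in> (bform 1 - {\<lambda>p. 0}) \<times> bform 2"
    using primD(1,2)[OF p] prim_fst_nonzero[OF p] x by auto
next
  fix x :: "('a::field ^ 2 \<Rightarrow> 'a) \<times> ('a ^ 2 \<Rightarrow> 'a)" assume "x \<in> (bform 1 - {\<lambda>p. 0}) \<times> bform 2"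
  then obtain f g where x: "x = (f, g)" and fg: "f \<in> bform 1" "f \<noteq> (\<lambda>p. 0)" "g \<in> bform 2"
    by auto
  have "prim 3 f g"
    unfolding prim_def using fg by (auto simp: bform_0)
  then show "x \<in> primset 3"
    using x by (simp add: primset_def)
qed

lemma card_roots_linear:
  assumes "f \<in> bform 2" "f \<noteq> (\<lambda>p. 0)"
  shows "card (roots f) = 1"
proof -
  obtain a where a: "f = linform a"
    using assms(1) by (rule bform_2E)
  have "a \<noteq> 0"
    using assms(2) a by (auto simp: linform_def fun_eq_iff)
  then obtain b k where b: "b \<in> proj_line" "k \<noteq> 0" "a = k *s b"
    by (rule proj_line_rep)
  have "linform a p = k * linform b p" for p
    by (simp add: b(3) linform_def algebra_simps)
  then have "roots f = {b}"
    using b linform_eq_0_iff[OF b(1)] by (auto simp: roots_def a)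
  then show ?thesis
    by simp
qed

text \<open>As f is linear, the only possible common factor of positive degree is f itself, up to a
  scalar; it divides g exactly when g vanishes at its root.\<close>

lemma primset_4: "primset 4 = (SIGMA f : bform 2 - {\<lambda>p. 0}. {g \<in> bform 3. \<not> roots f \<subseteq> roots g})"
proof (intro equalityI subsetI)
  fix x :: "('a::field ^ 2 \<Rightarrow> 'a) \<times> ('a ^ 2 \<Rightarrow> 'a)" assume "x \<in> primset 4"
  then obtain f g where x: "x = (f, g)" and p: "prim 4 f g"
    by (auto simp: primset_def)
  have f: "f \<in> bform 2" "f \<noteq> (\<lambda>p. 0)" and g: "g \<in> bform 3"
    using primD(1,2)[OF p] prim_fst_nonzero[OF p] by simp_all
  obtain b where "b \<in> roots f"
    using card_roots_linear[OF f] by (metis card.empty ex_in_conv zero_neq_one)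
  moreover from this have "b \<notin> roots g"
    using prim_no_common_root[OF p, of b] proj_line_nonzero by (auto simp: roots_def)
  ultimately show "x \<in> (SIGMA f : bform 2 - {\<lambda>p. 0}. {g \<in> bform 3. \<not> roots f \<subseteq> roots g})"
    using x f g by auto
next
  fix x :: "('a::field ^ 2 \<Rightarrow> 'a) \<times> ('a ^ 2 \<Rightarrow> 'a)"
  assume "x \<in> (SIGMA f : bform 2 - {\<lambda>p. 0}. {g \<in> bform 3. \<not> roots f \<subseteq> roots g})"
  then obtain f g where x: "x = (f, g)" and fg: "f \<in> bform 2" "f \<noteq> (\<lambda>p. 0)" "g \<in> bform 3" "\<not> roots f \<subseteq> roots g"
    by auto
  have "prim 4 f g"
    unfolding prim_def
  proof (intro conjI allI impI notI)
    fix e d f' g'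
    assume e: "1 \<le> e" "d \<in> bform (Suc e)" "f' \<in> bform (4 - 2 - e)" "g' \<in> bform (4 - 1 - e)"
      and eq: "f = (\<lambda>p. d p * f' p) \<and> g = (\<lambda>p. d p * g' p)"
    have "e = 1"
    proof (rule ccontr)
      assume "e \<noteq> 1"
      then have "4 - 2 - e = 0" using e(1) by simp
      then show False using e(3) eq fg(2) by (simp add: bform_0)
    qed
    then obtain k where k: "f' = (\<lambda>p. k)"
      using e(3) by (auto elim: bform_1E)
    then have "k \<noteq> 0"
      using eq fg(2) by auto
    then have "roots f \<subseteq> roots g"
      using eq k by (auto simp: roots_def)
    then show False
      using fg(4) by simp
  qed (use fg in simp_all)
  then show "x \<in> primset 4"
    using x by (simp add: primset_def)
qed

text \<open>Every nonzero pair of a quadratic and a cubic form has exactly \<open>q - 1\<close>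
  decompositions, one for each scalar moved between d and (f, g). Since the smaller r are counted
  directly, this count of all nonzero pairs leaves \<open>primset 5\<close> as the only
  unknown.\<close>

lemma primset_total:
  assumes q5: "5 \<le> CARD('a::{field,finite})"
  shows "(\<Sum>r\<in>{2..5}. (CARD('a) ^ (6 - r) - 1) * card (primset r :: (('a ^ 2 \<Rightarrow> 'a) \<times> ('a ^ 2 \<Rightarrow> 'a)) set))
    = (CARD('a) - 1) * (CARD('a) ^ 7 - 1)"
proof -
  define A :: "(nat \<times> ('a ^ 2 \<Rightarrow> 'a) \<times> ('a ^ 2 \<Rightarrow> 'a) \<times> ('a ^ 2 \<Rightarrow> 'a)) set"
    where "A = (SIGMA r : {2..5}. (bform (6 - r) - {\<lambda>p. 0}) \<times> primset r)"
  define \<phi> where "\<phi> = (\<lambda>(r :: nat, d, f, g). ((\<lambda>p. d p * f p) :: 'a ^ 2 \<Rightarrow> 'a, (\<lambda>p. d p * g p) :: 'a ^ 2 \<Rightarrow> 'a))"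
  define B :: "(('a ^ 2 \<Rightarrow> 'a) \<times> ('a ^ 2 \<Rightarrow> 'a)) set" where "B = bform 3 \<times> bform 4 - {(\<lambda>p. 0, \<lambda>p. 0)}"
  have A_iff: "(r, d, f, g) \<in> A \<longleftrightarrow> r \<in> {2..5} \<and> d \<in> bform (6 - r) \<and> d \<noteq> (\<lambda>p. 0) \<and> prim r f g" for r d f g
    by (auto simp: A_def primset_def)
  have "card A = (CARD('a) - 1) * card B"
  proof (rule card_eq_mult_fibres[where \<phi> = \<phi>])
    show "\<phi> ` A = B"
    proof (intro equalityI subsetI)
      fix x assume "x \<in> \<phi> ` A"
      then obtain r d f g where a: "(r, d, f, g) \<in> A" and x: "x = (\<lambda>p. d p * f p, \<lambda>p. d p * g p)"
        by (force simp: \<phi>_def)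
      then have r: "r \<in> {2..5}" and d: "d \<in> bform (6 - r)" "d \<noteq> (\<lambda>p. 0)" and p: "prim r f g"
        by (auto simp: A_iff)
      note fg = primD(1,2)[OF p]
      have "(\<lambda>p. d p * f p) \<in> bform 3" "(\<lambda>p. d p * g p) \<in> bform 4"
        by (rule bform_mult[OF d(1) fg(1)] bform_mult[OF d(1) fg(2)]; use r in auto)+
      moreover have "\<not> ((\<lambda>p. d p * f p) = (\<lambda>p. 0) \<and> (\<lambda>p. d p * g p) = (\<lambda>p. 0))"
      proof
        assume z: "(\<lambda>p. d p * f p) = (\<lambda>p. 0) \<and> (\<lambda>p. d p * g p) = (\<lambda>p. 0)"
        have "f = (\<lambda>p. 0)" "g = (\<lambda>p. 0)"
          by (rule bform_mult_eq_0[OF d(1) fg(1) _ _ d(2)] bform_mult_eq_0[OF d(1) fg(2) _ _ d(2)];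
              use z r q5 in \<open>auto simp: fun_eq_iff\<close>)+
        then show False
          using prim_nonzero[OF p] by simp
      qed
      ultimately show "x \<in> B"
        using x by (auto simp: B_def)
    next
      fix x assume "x \<in> B"
      then obtain f g where x: "x = (f, g)" and fg: "f \<in> bform (5 - 2)" "g \<in> bform (5 - 1)" "f \<noteq> (\<lambda>p. 0) \<or> g \<noteq> (\<lambda>p. 0)"
        by (auto simp: B_def)
      obtain e d f' g' where e: "e \<le> 5 - 2" "d \<in> bform (Suc e)" "prim (5 - e) f' g'"
        "f = (\<lambda>p. d p * f' p)" "g = (\<lambda>p. d p * g' p)"
        by (rule prim_factor[OF fg]) auto
      have "6 - (5 - e) = Suc e"
        using e(1) by simp
      moreover have "d \<noteq> (\<lambda>p. 0)"
        using fg(3) e(4,5) by auto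
      ultimately have "(5 - e, d, f', g') \<in> A"
        using e by (auto simp: A_iff)
      then show "x \<in> \<phi> ` A"
        using x e(4,5) by (force simp: \<phi>_def)
    qed
    fix a assume "a \<in> A"
    then obtain r d f g where a: "a = (r, d, f, g)" and r: "r \<in> {2..5}"
      and d: "d \<in> bform (6 - r)" "d \<noteq> (\<lambda>p. 0)" and p: "prim r f g"
      by (metis A_iff prod_cases4)
    define \<psi> where "\<psi> = (\<lambda>k. (r, (\<lambda>p. inverse k * d p), (\<lambda>p. k * f p), (\<lambda>p. k * g p)))"
    have "{x \<in> A. \<phi> x = \<phi> a} = \<psi> ` (UNIV - {0})"
    proof (intro equalityI subsetI)
      fix x assume "x \<in> {x \<in> A. \<phi> x = \<phi> a}"
      then have "x \<in> A" and eq: "\<phi> x = \<phi> a"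
        by simp_all
      then obtain s d' f' g' where x: "x = (s, d', f', g')" and s: "s \<in> {2..5}"
        and d': "d' \<in> bform (6 - s)" "d' \<noteq> (\<lambda>p. 0)" and p': "prim s f' g'"
        by (metis A_iff prod_cases4)
      have "s = r \<and> (\<exists>k. k \<noteq> 0 \<and> d = (\<lambda>p. k * d' p) \<and> f' = (\<lambda>p. k * f p) \<and> g' = (\<lambda>p. k * g p))"
        by (rule prim_factor_unique[OF q5 p r p' s d d']) (use eq x a in \<open>auto simp: \<phi>_def fun_eq_iff\<close>)
      then obtain k where k: "s = r" "k \<noteq> 0" "d = (\<lambda>p. k * d' p)" "f' = (\<lambda>p. k * f p)" "g' = (\<lambda>p. k * g p)"
        by blast
      then have "d' = (\<lambda>p. inverse k * d p)"
        by (simp add: fun_eq_iff)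
      then have "x = \<psi> k"
        using k x by (simp add: \<psi>_def)
      then show "x \<in> \<psi> ` (UNIV - {0})"
        using k(2) by blast
    next
      fix x assume "x \<in> \<psi> ` (UNIV - {0})"
      then obtain k where k: "k \<noteq> 0" "x = \<psi> k" by blast
      have "prim r (\<lambda>p. k * f p) (\<lambda>p. k * g p)"
        using prim_cmult[OF p k(1)] .
      moreover have "(\<lambda>p. inverse k * d p) \<noteq> (\<lambda>p. 0)"
        using d(2) k(1) by (auto simp: fun_eq_iff)
      ultimately have "x \<in> A"
        using k r bform_cmult[OF d(1)] by (auto simp: \<psi>_def A_iff)
      moreover have "\<phi> x = \<phi> a"
        using k a by (auto simp: \<psi>_def \<phi>_def fun_eq_iff)
      ultimately show "x \<in> {x \<in> A. \<phi> x = \<phi> a}" by simp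
    qed
    moreover have "inj_on \<psi> (UNIV - {0})"
      using d(2) by (auto simp: inj_on_def \<psi>_def fun_eq_iff)
    ultimately show "card {x \<in> A. \<phi> x = \<phi> a} = CARD('a) - 1"
      by (simp add: card_image card_Diff_singleton)
  qed (simp add: A_def)
  moreover have "card B = CARD('a) ^ 7 - 1"
  proof -
    have "card (bform 3 \<times> bform 4 :: (('a ^ 2 \<Rightarrow> 'a) \<times> ('a ^ 2 \<Rightarrow> 'a)) set) = CARD('a) ^ 3 * CARD('a) ^ 4"
      using card_bform[of 3, where 'a = 'a] card_bform[of 4, where 'a = 'a] q5 by (simp add: card_cartesian_product)
    also have "\<dots> = CARD('a) ^ 7"
      by (simp flip: power_add)
    finally show ?thesis
      unfolding B_def by (simp add: card_Diff_singleton bform_zero)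
  qed
  moreover have "card A = (\<Sum>r\<in>{2..5}. card (bform (6 - r) - {\<lambda>p. 0} :: ('a ^ 2 \<Rightarrow> 'a) set) * card (primset r :: (('a ^ 2 \<Rightarrow> 'a) \<times> ('a ^ 2 \<Rightarrow> 'a)) set))"
    unfolding A_def by (simp add: card_cartesian_product)
  moreover have "card (bform (6 - r) - {\<lambda>p. 0} :: ('a ^ 2 \<Rightarrow> 'a) set) = CARD('a) ^ (6 - r) - 1" if "r \<in> {2..5}" for r
    using card_bform[of "6 - r", where 'a = 'a] that q5 by (simp add: card_Diff_singleton bform_zero)
  ultimately show ?thesis
    by simp
qed

lemma card_primset:
  assumes q: "q = real CARD('a::{field,finite})" and q5: "5 \<le> CARD('a)"
  shows "real (card (primset 2 :: (('a ^ 2 \<Rightarrow> 'a) \<times> ('a ^ 2 \<Rightarrow> 'a)) set)) = q - 1"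
    and "real (card (primset 3 :: (('a ^ 2 \<Rightarrow> 'a) \<times> ('a ^ 2 \<Rightarrow> 'a)) set)) = (q - 1) * q^2"
    and "real (card (primset 4 :: (('a ^ 2 \<Rightarrow> 'a) \<times> ('a ^ 2 \<Rightarrow> 'a)) set)) = (q - 1) * (q^4 - q^2)"
    and "real (card (primset 5 :: (('a ^ 2 \<Rightarrow> 'a) \<times> ('a ^ 2 \<Rightarrow> 'a)) set)) = (q - 1) * (q^6 - q^4)"
proof -
  have c: "card (bform n :: ('a ^ 2 \<Rightarrow> 'a) set) = CARD('a) ^ n" if "n \<le> 4" for n
    using card_bform[of n, where 'a = 'a] that q5 by simp
  have c': "real (card (bform n - {\<lambda>p. 0} :: ('a ^ 2 \<Rightarrow> 'a) set)) = q ^ n - 1" if "n \<le> 4" for n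
    using c[OF that] q q5 by (simp add: card_Diff_singleton bform_zero of_nat_diff)
  show 2: "real (card (primset 2 :: (('a ^ 2 \<Rightarrow> 'a) \<times> ('a ^ 2 \<Rightarrow> 'a)) set)) = q - 1"
    using c'[of 1] by (simp add: primset_2 card_cartesian_product)
  show 3: "real (card (primset 3 :: (('a ^ 2 \<Rightarrow> 'a) \<times> ('a ^ 2 \<Rightarrow> 'a)) set)) = (q - 1) * q^2"
    using c'[of 1] c[of 2] q by (simp add: primset_3 card_cartesian_product)
  have "real (card {g \<in> bform 3. \<not> roots f \<subseteq> roots g}) = q^3 - q^2" if f: "f \<in> bform 2 - {\<lambda>p. 0}" for f :: "'a ^ 2 \<Rightarrow> 'a"
  proof -
    have "card {g \<in> bform 3. roots f \<subseteq> roots g} = CARD('a) ^ 2"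
      using card_bform_vanishing[of "roots f" 3] card_roots_linear[of f] f q5 by (auto simp: roots_def)
    moreover have "{g \<in> bform 3. \<not> roots f \<subseteq> roots g} = bform 3 - {g \<in> bform 3. roots f \<subseteq> roots g}"
      by auto
    ultimately have "card {g \<in> bform 3. \<not> roots f \<subseteq> roots g} = CARD('a) ^ 3 - CARD('a) ^ 2"
      using c[of 3] by (simp add: card_Diff_subset)
    moreover have "CARD('a) ^ 2 \<le> CARD('a) ^ 3"
      using q5 by (intro power_increasing) auto
    ultimately show ?thesis
      using q by (simp add: of_nat_diff)
  qed
  then have "real (card (primset 4 :: (('a ^ 2 \<Rightarrow> 'a) \<times> ('a ^ 2 \<Rightarrow> 'a)) set)) = (q^2 - 1) * (q^3 - q^2)"
    using c'[of 2] by (simp add: primset_4)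
  then show 4: "real (card (primset 4 :: (('a ^ 2 \<Rightarrow> 'a) \<times> ('a ^ 2 \<Rightarrow> 'a)) set)) = (q - 1) * (q^4 - q^2)"
    by (simp add: power2_eq_square power3_eq_cube power4_eq_xxxx algebra_simps)
  \<comment> \<open>The case \<open>r = 5\<close> is solved from the total, where its coefficient is
    \<open>q ^ 1 - 1\<close>.\<close>
  have "real (\<Sum>r\<in>{2..5}. (CARD('a) ^ (6 - r) - 1) * card (primset r :: (('a ^ 2 \<Rightarrow> 'a) \<times> ('a ^ 2 \<Rightarrow> 'a)) set))
    = (q - 1) * (q ^ 7 - 1)"
    unfolding primset_total[OF q5] using q q5 by (simp add: of_nat_diff)
  moreover have "real (CARD('a) ^ n - 1) = q ^ n - 1" for n
    using q q5 by (simp add: of_nat_diff)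
  moreover have "{2..5} = {2, 3, 4, 5::nat}" by auto
  ultimately have "(q^4 - 1) * (q - 1) + ((q^3 - 1) * ((q - 1) * q^2) + ((q^2 - 1) * ((q - 1) * (q^4 - q^2)) +
      (q - 1) * real (card (primset 5 :: (('a ^ 2 \<Rightarrow> 'a) \<times> ('a ^ 2 \<Rightarrow> 'a)) set)))) = (q - 1) * (q ^ 7 - 1)"
    using 2 3 4 q by simp
  moreover have "(q^4 - 1) * (q - 1) + ((q^3 - 1) * ((q - 1) * q^2) + ((q^2 - 1) * ((q - 1) * (q^4 - q^2)) +
      (q - 1) * ((q - 1) * (q^6 - q^4)))) = (q - 1) * (q ^ 7 - 1)"
    by (simp add: eval_nat_numeral algebra_simps)
  ultimately have "(q - 1) * real (card (primset 5 :: (('a ^ 2 \<Rightarrow> 'a) \<times> ('a ^ 2 \<Rightarrow> 'a)) set)) = (q - 1) * ((q - 1) * (q^6 - q^4))"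
    by linarith
  then show "real (card (primset 5 :: (('a ^ 2 \<Rightarrow> 'a) \<times> ('a ^ 2 \<Rightarrow> 'a)) set)) = (q - 1) * (q^6 - q^4)"
    using q q5 by simp
qed

subsection \<open>Hyperplanes and normal rational curves\<close>

definition dotp :: "'a::field ^ 'n \<Rightarrow> 'a ^ 'n \<Rightarrow> 'a" where
  "dotp w x = (\<Sum>k\<in>UNIV. w $ k * x $ k)"

lemma dotp_add: "dotp w (x + y) = dotp w x + dotp w y"
  by (simp add: dotp_def distrib_left sum.distrib)

lemma dotp_diff: "dotp w (x - y) = dotp w x - dotp w y"
  by (simp add: dotp_def right_diff_distrib sum_subtractf)

lemma dotp_scale: "dotp w (k *s x) = k * dotp w x"
  by (simp add: dotp_def sum_distrib_left mult_ac)

lemma dotp_zero [simp]: "dotp w 0 = 0"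
  by (simp add: dotp_def)

lemma dotp_sum: "dotp w (\<Sum>i\<in>I. x i) = (\<Sum>i\<in>I. dotp w (x i))"
  unfolding dotp_def by (subst sum.swap) (simp add: sum_component sum_distrib_left)

lemma dotp_left_add: "dotp (v + w) x = dotp v x + dotp w x"
  by (simp add: dotp_def distrib_right sum.distrib)

lemma dotp_left_diff: "dotp (v - w) x = dotp v x - dotp w x"
  by (simp add: dotp_def left_diff_distrib sum_subtractf)

lemma dotp_left_scale: "dotp (k *s w) x = k * dotp w x"
  by (simp add: dotp_def sum_distrib_left mult_ac)

lemma dotp_axis: "dotp (axis k 1) x = x $ k"
  by (simp add: dotp_def axis_def if_distrib[of "\<lambda>z. z * _"] cong: if_cong)

lemma dotp_eq_0D:
  assumes "\<And>x. dotp w x = 0"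
  shows "w = 0"
proof -
  have "dotp w (axis k 1) = w $ k" for k
    by (simp add: dotp_def axis_def if_distrib[of "\<lambda>z. _ * z"] cong: if_cong)
  then show ?thesis
    using assms by (simp add: vec_eq_iff)
qed

definition hyp :: "'a::field ^ 'n \<Rightarrow> ('a ^ 'n) set" where
  "hyp w = {x. dotp w x = 0}"

lemma subspace_hyp: "vec.subspace (hyp w)"
  unfolding vec.subspace_def hyp_def by (auto simp: dotp_add dotp_scale)

lemma annihilator_exists:
  fixes S :: "('a::field ^ 'n) set"
  assumes "vec.dim S < CARD('n)"
  obtains w where "w \<noteq> 0" "S \<subseteq> hyp w"
proof -
  obtain B where B: "B \<subseteq> S" "vec.independent B" "S \<subseteq> vec.span B" "card B = vec.dim S"
    by (rule vec.basis_exists)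
  obtain B' where B': "B \<subseteq> B'" "B' \<subseteq> UNIV" "vec.independent B'" "UNIV \<subseteq> vec.span B'"
    by (rule vec.maximal_independent_subset_extend[OF subset_UNIV B(2)])
  have "card B' = CARD('n)"
    using vec.dim_eq_card[of B' UNIV] B' vec_dim_card[where 'a = 'a and 'n = 'n]
    by (metis top.extremum_unique vec.span_UNIV)
  then have "B \<noteq> B'"
    using B(4) assms by auto
  then obtain b where b: "b \<in> B'" "b \<notin> B"
    using B'(1) by blast
  \<comment> \<open>The functional takes values in the one-dimensional space \<open>'a ^ 1\<close>,
    so that its matrix has a single row; this row is w.\<close>
  obtain g :: "'a ^ 'n \<Rightarrow> 'a ^ 1" where g: "Vector_Spaces.linear (*s) (*s) g"
    and gB: "\<And>x. x \<in> B' \<Longrightarrow> g x = (if x = b then 1 else 0)"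
    using vec.linear_independent_extend[OF B'(3), of "\<lambda>x. if x = b then 1 else 0"] by blast
  define w where "w = matrix g $ 1"
  have w: "dotp w x = g x $ 1" for x
    using matrix_works[OF g, of x] by (simp add: w_def dotp_def matrix_vector_mult_def vec_eq_iff)
  have "dotp w b = 1"
    using gB[OF b(1)] w by simp
  then have "w \<noteq> 0"
    by (auto simp: dotp_def)
  moreover have "vec.span B \<subseteq> hyp w"
  proof (rule vec.span_minimal[OF _ subspace_hyp])
    show "B \<subseteq> hyp w"
      using gB B'(1) b(2) by (auto simp: hyp_def w)
  qed
  ultimately show ?thesis
    using that B(3) by blast
qed

lemma dim_hyp:
  fixes w :: "'a::field ^ 'n"
  assumes "w \<noteq> 0"
  shows "vec.dim (hyp w) + 1 = CARD('n)"
proof -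
  obtain x where x: "dotp w x \<noteq> 0"
    using dotp_eq_0D assms by blast
  have "UNIV \<subseteq> vec.span (insert x (hyp w))"
  proof
    fix y
    have "y - (dotp w y / dotp w x) *s x \<in> hyp w"
      using x by (simp add: hyp_def dotp_diff dotp_scale)
    then show "y \<in> vec.span (insert x (hyp w))"
      unfolding vec.span_breakdown_eq by (blast intro: vec.span_base)
  qed
  then have "vec.span (insert x (hyp w)) = UNIV" by blast
  then have "vec.dim (insert x (hyp w)) = CARD('n)"
    by (metis vec.dim_span vec_dim_card)
  moreover have "vec.dim (insert x (hyp w)) = vec.dim (hyp w) + 1"
  proof -
    have "vec.span (hyp w) = hyp w"
      using subspace_hyp[of w] by (simp add: vec.span_eq_iff)
    moreover have "x \<notin> hyp w"
      using x by (simp add: hyp_def)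
    ultimately have "x \<notin> vec.span (hyp w)"
      by metis
    then show ?thesis
      by (simp add: vec.dim_insert)
  qed
  ultimately show ?thesis by simp
qed

lemma hyperplane_obtain:
  fixes S :: "('a::field ^ 'n) set"
  assumes S: "vec.subspace S" and d: "vec.dim S + 1 = CARD('n)"
  obtains w where "w \<noteq> 0" "S = hyp w"
proof -
  obtain w where w: "w \<noteq> 0" "S \<subseteq> hyp w"
    by (rule annihilator_exists[of S]) (use d in auto)
  have "S = hyp w"
    by (rule vec.subspace_dim_equal[OF S subspace_hyp w(2)]) (use d dim_hyp[OF w(1)] in simp)
  then show ?thesis
    using w(1) that by blast
qed

lemma hyp_eqD:
  assumes "w' \<noteq> 0" "hyp w = hyp w'"
  shows "\<exists>k. w = k *s w'"
proof -
  obtain z where z: "dotp w' z \<noteq> 0"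
    using dotp_eq_0D assms(1) by blast
  define k where "k = dotp w z / dotp w' z"
  have "dotp (w - k *s w') x = 0" for x
  proof -
    have "x - (dotp w' x / dotp w' z) *s z \<in> hyp w'"
      using z by (simp add: hyp_def dotp_diff dotp_scale)
    then have "x - (dotp w' x / dotp w' z) *s z \<in> hyp w"
      using assms(2) by simp
    then have "dotp w x = dotp w' x / dotp w' z * dotp w z"
      by (simp add: hyp_def dotp_diff dotp_scale)
    then show ?thesis
      by (simp add: dotp_left_diff dotp_left_scale k_def)
  qed
  then have "w - k *s w' = 0"
    by (rule dotp_eq_0D)
  then show ?thesis
    by auto
qed

lemma hyp_scale: "k \<noteq> 0 \<Longrightarrow> hyp (k *s w) = hyp w"
  by (simp add: hyp_def dotp_left_scale)

lemma ppoint_eqI: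
  assumes "k \<noteq> 0" "y = k *s x"
  shows "ppoint y = ppoint x"
proof -
  have "x = inverse k *s y"
    using assms by simp
  then have "x \<in> vec.span {y}" "y \<in> vec.span {x}"
    using assms(2) by (metis vec.span_base vec.span_scale singletonI)+
  then show ?thesis
    unfolding ppoint_def by (intro equalityI vec.span_minimal) auto
qed

lemma ppoint_self: "x \<in> ppoint x"
  unfolding ppoint_def by (simp add: vec.span_base)

lemma ppoint_eqD: "ppoint x = ppoint y \<Longrightarrow> \<exists>k. y = k *s x"
  using ppoint_self[of y] by (auto simp: ppoint_def vec.span_singleton)

lemma ppoint_in_points_iff:
  assumes "vec.subspace S" "x \<noteq> 0"
  shows "ppoint x \<in> points S \<longleftrightarrow> x \<in> S"
proof
  assume "ppoint x \<in> points S"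
  then obtain y where y: "y \<in> S" "ppoint x = ppoint y"
    by (auto simp: points_def)
  then obtain k where "x = k *s y"
    using ppoint_eqD[of y x] by auto
  then show "x \<in> S"
    using y(1) assms(1) by (simp add: vec.subspace_scale)
qed (use assms in \<open>auto simp: points_def\<close>)

lemma points_mono: "S \<subseteq> T \<Longrightarrow> points S \<subseteq> points T"
  by (auto simp: points_def)

lemma points_subset_iff:
  assumes "vec.subspace S" "vec.subspace T"
  shows "points S \<subseteq> points T \<longleftrightarrow> S \<subseteq> T"
proof
  assume l: "points S \<subseteq> points T"
  show "S \<subseteq> T"
  proof
    fix x assume x: "x \<in> S"
    show "x \<in> T"
    proof (cases "x = 0")
      case True
      then show ?thesis using assms(2) by (simp add: vec.subspace_0)
    next
      case False
      then show ?thesis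
        using x l assms ppoint_in_points_iff by blast
    qed
  qed
qed (rule points_mono)

text \<open>Independence of a set cannot see repeated vectors, so injectivity is derived as well:
  two equal members would satisfy the relation with coefficients 1 and -1.\<close>

lemma independent_family:
  fixes m :: "'i \<Rightarrow> 'a::field ^ 'n"
  assumes fin: "finite T" and ind: "\<And>c. (\<Sum>p\<in>T. c p *s m p) = 0 \<Longrightarrow> \<forall>p\<in>T. c p = 0"
  shows "inj_on m T" "vec.independent (m ` T)"
proof -
  show inj: "inj_on m T"
  proof (rule inj_onI, rule ccontr)
    fix x y assume xy: "x \<in> T" "y \<in> T" "m x = m y" "x \<noteq> y"
    define c :: "'i \<Rightarrow> 'a" where "c = (\<lambda>p. if p = x then 1 else if p = y then - 1 else 0)"
    have "(\<Sum>p\<in>T. c p *s m p) = (\<Sum>p\<in>{x, y}. c p *s m p)"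
      using xy fin by (intro sum.mono_neutral_right) (auto simp: c_def)
    also have "\<dots> = 0"
      using xy by (simp add: c_def)
    finally have "c x = 0"
      using ind xy(1) by blast
    then show False
      by (simp add: c_def)
  qed
  show "vec.independent (m ` T)"
  proof -
    have "\<forall>v\<in>m ` T. c v = 0" if "(\<Sum>v\<in>m ` T. c v *s v) = 0" for c
      using ind[of "\<lambda>p. c (m p)"] that by (auto simp: sum.reindex[OF inj])
    then show ?thesis
      using fin unfolding vec.independent_explicit by auto
  qed
qed

lemma frame_coeff_0:
  assumes "frame r v U" "(\<Sum>i\<le>r. c i *s v i) = 0" "i \<le> r"
  shows "c i = 0"
proof -
  have inj: "inj_on v {..r}" and ind: "vec.independent (v ` {..r})"
    using assms(1) by (auto simp: frame_def)
  define d where "d = (\<lambda>x. c (the_inv_into {..r} v x))"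
  have d: "d (v i) = c i" if "i \<le> r" for i
    using that inj by (simp add: d_def the_inv_into_f_f)
  have "(\<Sum>x\<in>v ` {..r}. d x *s x) = (\<Sum>i\<le>r. c i *s v i)"
    unfolding sum.reindex[OF inj] using d by (auto intro!: sum.cong)
  then have "d (v i) = 0"
    using ind assms(2,3) unfolding vec.independent_explicit by auto
  then show ?thesis
    using d assms(3) by simp
qed

section \<open>Normal rational curves: independence of their points and intersection with
  subspaces\<close>

definition nvec :: "nat \<Rightarrow> (nat \<Rightarrow> 'a::field ^ 'n) \<Rightarrow> 'a ^ 2 \<Rightarrow> 'a ^ 'n" where
  "nvec r v p = (\<Sum>i\<le>r. ((p $ 1) ^ (r - i) * (p $ 2) ^ i) *s v i)"

lemma nvec_scale: "nvec r v (k *s p) = k ^ r *s nvec r v p"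
proof -
  have "k ^ r = k ^ (r - i) * k ^ i" if "i \<le> r" for i
    using that by (simp flip: power_add)
  then have "(((k *s p) $ 1) ^ (r - i) * ((k *s p) $ 2) ^ i) *s v i = k ^ r *s (((p $ 1) ^ (r - i) * (p $ 2) ^ i) *s v i)"
    if "i \<le> r" for i
    using that by (simp add: power_mult_distrib mult_ac)
  then show ?thesis
    unfolding nvec_def vec.scale_sum_right by (intro sum.cong) auto
qed

lemma dotp_nvec_bform: "(\<lambda>p. dotp w (nvec r v p)) \<in> bform (Suc r)"
proof -
  have "(\<lambda>p. dotp w (nvec r v p)) = (\<lambda>p. \<Sum>i<Suc r. dotp w (v i) * ((p $ 1) ^ (Suc r - 1 - i) * (p $ 2) ^ i))"
    unfolding nvec_def dotp_sum dotp_scale lessThan_Suc_atMost by (simp add: mult_ac)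
  then show ?thesis
    by (rule bformI)
qed

lemma image_proj_line:
  assumes "\<And>k p. k \<noteq> 0 \<Longrightarrow> P (k *s p) = P p"
  shows "{P p | p. p \<noteq> 0} = P ` proj_line"
proof (intro equalityI subsetI)
  fix x assume "x \<in> {P p | p. p \<noteq> 0}"
  then obtain p where p: "p \<noteq> 0" "x = P p" by blast
  from p(1) obtain a k where "a \<in> proj_line" "k \<noteq> 0" "p = k *s a"
    by (rule proj_line_rep)
  then show "x \<in> P ` proj_line"
    using p(2) assms by auto
qed (use proj_line_nonzero in auto)

lemma nrc_iff: "nrc r N \<longleftrightarrow> (\<exists>v. frame r v (vec.span (v ` {..r})) \<and> N = (\<lambda>p. ppoint (nvec r v p)) ` proj_line)"
proof -
  have e: "{nrc_point r v p | p. p \<noteq> 0} = (\<lambda>p. ppoint (nvec r v p)) ` proj_line" for v :: "nat \<Rightarrow> 'a ^ 'n"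
  proof -
    have "nrc_point r v = (\<lambda>p. ppoint (nvec r v p))"
      by (simp add: nrc_point_def nvec_def fun_eq_iff)
    moreover have "ppoint (nvec r v (k *s p)) = ppoint (nvec r v p)" if "k \<noteq> 0" for k p
      using that by (intro ppoint_eqI[of "k ^ r"]) (auto simp: nvec_scale)
    ultimately show ?thesis
      by (simp add: image_proj_line)
  qed
  have "rspace r U" if "frame r v U" for v :: "nat \<Rightarrow> 'a ^ 'n" and U
    using that vec.dim_span_eq_card_independent[of "v ` {..r}"]
    by (auto simp: frame_def rspace_def card_image)
  then show ?thesis
    unfolding nrc_def e by (metis frame_def)
qed

text \<open>A relation between the points can be paired with every form of degree r. The form that
  is 1 at one point of T and 0 at the others isolates a single coefficient; it exists because T has
  at most \<open>r + 1\<close> elements.\<close>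

lemma nvec_independent:
  fixes v :: "nat \<Rightarrow> 'a::field ^ 'n"
  assumes fr: "frame r v U" and fin: "finite T" and T: "T \<subseteq> proj_line" "card T \<le> Suc r"
  shows "inj_on (nvec r v) T" "vec.independent (nvec r v ` T)"
proof -
  have "\<forall>p\<in>T. c p = 0" if z: "(\<Sum>p\<in>T. c p *s nvec r v p) = 0" for c
  proof
    fix p assume p: "p \<in> T"
    have "(\<Sum>p\<in>T. c p *s nvec r v p) = (\<Sum>i\<le>r. (\<Sum>p\<in>T. c p * ((p $ 1) ^ (r - i) * (p $ 2) ^ i)) *s v i)"
      unfolding nvec_def vec.scale_sum_right vec.scale_sum_left vec.scale_scale by (rule sum.swap)
    then have c0: "(\<Sum>p\<in>T. c p * ((p $ 1) ^ (r - i) * (p $ 2) ^ i)) = 0" if "i \<le> r" for i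
      using frame_coeff_0[OF fr _ that, of "\<lambda>i. \<Sum>p\<in>T. c p * ((p $ 1) ^ (r - i) * (p $ 2) ^ i)"] z by simp
    obtain h where h: "h \<in> bform (Suc r)" "h p = 1" "\<And>b. b \<in> T \<Longrightarrow> b \<noteq> p \<Longrightarrow> h b = 0"
      using bform_separates[OF fin T p] by blast
    obtain d where d: "h = (\<lambda>p. \<Sum>i<Suc r. d i * ((p $ 1) ^ (Suc r - 1 - i) * (p $ 2) ^ i))"
      using h(1) by (rule bformE)
    have "(\<Sum>b\<in>T. c b * h b) = (\<Sum>b\<in>T. if b = p then c p else 0)"
      using h by (intro sum.cong) auto
    then have "c p = (\<Sum>b\<in>T. c b * h b)"
      using fin p by simp
    also have "\<dots> = (\<Sum>b\<in>T. \<Sum>i\<le>r. d i * (c b * ((b $ 1) ^ (r - i) * (b $ 2) ^ i)))"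
      unfolding d lessThan_Suc_atMost by (simp add: sum_distrib_left mult_ac)
    also have "\<dots> = (\<Sum>i\<le>r. d i * (\<Sum>b\<in>T. c b * ((b $ 1) ^ (r - i) * (b $ 2) ^ i)))"
      unfolding sum_distrib_left by (rule sum.swap)
    also have "\<dots> = 0"
      using c0 by (intro sum.neutral) auto
    finally show "c p = 0" .
  qed
  then show "inj_on (nvec r v) T" "vec.independent (nvec r v ` T)"
    using independent_family[OF fin] by blast+
qed

lemma nvec_nonzero:
  assumes "frame r v U" "p \<in> proj_line"
  shows "nvec r v p \<noteq> 0"
  using nvec_independent(2)[OF assms(1), of "{p}"] assms(2) by (auto simp: vec.dependent_single)

lemma nvec_in_frame: "frame r v U \<Longrightarrow> nvec r v p \<in> U"
  unfolding frame_def nvec_def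
  by (elim conjE, erule subst, intro vec.span_sum vec.span_scale vec.span_base) auto

lemma nrc_card_in_subspace:
  fixes v :: "nat \<Rightarrow> 'a::{field,finite} ^ 'n"
  assumes fr: "frame r v U" and W: "vec.dim W \<le> r"
  shows "card {p \<in> proj_line. nvec r v p \<in> W} \<le> vec.dim W"
proof (rule ccontr)
  assume "\<not> ?thesis"
  then have "Suc (vec.dim W) \<le> card {p \<in> proj_line. nvec r v p \<in> W}"
    by simp
  then obtain T where T: "T \<subseteq> {p \<in> proj_line. nvec r v p \<in> W}" "card T = Suc (vec.dim W)"
    by (rule obtain_subset_with_card_n)
  have "T \<subseteq> proj_line" "card T \<le> Suc r"
    using T W by auto
  then have "inj_on (nvec r v) T" "vec.independent (nvec r v ` T)"
    using nvec_independent[OF fr] by auto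
  moreover from this have "card (nvec r v ` T) \<le> vec.dim W"
    using T by (intro vec.independent_card_le_dim) auto
  ultimately show False
    using T(2) by (simp add: card_image)
qed

lemma dim_frame: "frame r v U \<Longrightarrow> vec.dim U = Suc r"
  using vec.dim_span_eq_card_independent[of "v ` {..r}"] by (auto simp: frame_def card_image)

lemma subspace_frame: "frame r v U \<Longrightarrow> vec.subspace U"
  by (auto simp: frame_def)

text \<open>Any \<open>r + 1\<close> points of the curve already form a basis of its span.\<close>

lemma nrc_contained:
  fixes v :: "nat \<Rightarrow> 'a::{field,finite} ^ 'n"
  assumes fr: "frame r v U" and W: "vec.subspace W" and c: "Suc r \<le> card {p \<in> proj_line. nvec r v p \<in> W}"
  shows "U \<subseteq> W"
proof -
  obtain T where T: "T \<subseteq> {p \<in> proj_line. nvec r v p \<in> W}" "card T = Suc r"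
    using c by (rule obtain_subset_with_card_n)
  have "T \<subseteq> proj_line" "card T \<le> Suc r"
    using T by auto
  then have *: "inj_on (nvec r v) T" "vec.independent (nvec r v ` T)"
    using nvec_independent[OF fr] by auto
  then have "U \<subseteq> vec.span (nvec r v ` T)"
    using T(2) nvec_in_frame[OF fr]
    by (intro vec.card_ge_dim_independent) (auto simp: card_image dim_frame[OF fr])
  also have "\<dots> \<subseteq> W"
    using T W by (intro vec.span_minimal) auto
  finally show ?thesis .
qed

text \<open>A point is a subspace of rank 1, so the bound on points in a subspace leaves room for
  only one parameter.\<close>

lemma inj_nrc_points:
  fixes v :: "nat \<Rightarrow> 'a::{field,finite} ^ 'n"
  assumes fr: "frame r v U" and r: "1 \<le> r"
  shows "inj_on (\<lambda>p. ppoint (nvec r v p)) proj_line"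
proof (rule inj_onI, rule ccontr)
  fix x y :: "'a ^ 2" assume xy: "x \<in> proj_line" "y \<in> proj_line" "ppoint (nvec r v x) = ppoint (nvec r v y)" "x \<noteq> y"
  have dim: "vec.dim (ppoint (nvec r v x)) = 1"
    unfolding ppoint_def vec.dim_span using nvec_nonzero[OF fr xy(1)]
    by (simp add: vec.dim_eq_card_independent vec.dependent_single)
  have "{x, y} \<subseteq> {p \<in> proj_line. nvec r v p \<in> ppoint (nvec r v x)}"
    using xy ppoint_self by force
  then have "card {x, y} \<le> card {p \<in> proj_line. nvec r v p \<in> ppoint (nvec r v x)}"
    by (intro card_mono) auto
  also have "\<dots> \<le> 1"
    using nrc_card_in_subspace[OF fr, of "ppoint (nvec r v x)"] dim r by simp
  finally show False
    using xy(4) by simp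
qed

lemma card_nrc:
  fixes N :: "('a::{field,finite} ^ 'n) set set"
  assumes "nrc r N" "1 \<le> r"
  shows "card N = CARD('a) + 1"
proof -
  obtain v where v: "frame r v (vec.span (v ` {..r}))" "N = (\<lambda>p. ppoint (nvec r v p)) ` proj_line"
    using assms(1) unfolding nrc_iff by blast
  then show ?thesis
    using inj_nrc_points[OF v(1) assms(2)] card_proj_line[where 'a = 'a] by (simp add: card_image)
qed

text \<open>The common points lie in the span of the curve of lower dimension, a subspace of rank
  \<open>s + 1\<close>. This is what separates sections whose curves have different
  dimensions.\<close>

lemma nrc_common_points:
  fixes N N' :: "('a::{field,finite} ^ 'n) set set"
  assumes "nrc r N" "nrc s N'" "s < r" "Y \<subseteq> N" "Y \<subseteq> N'"
  shows "card Y \<le> Suc s"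
proof -
  obtain v where fr: "frame r v (vec.span (v ` {..r}))" and N: "N = (\<lambda>p. ppoint (nvec r v p)) ` proj_line"
    using assms(1) unfolding nrc_iff by blast
  obtain v' where fr': "frame s v' (vec.span (v' ` {..s}))" and N': "N' = (\<lambda>p. ppoint (nvec s v' p)) ` proj_line"
    using assms(2) unfolding nrc_iff by blast
  define U where "U = vec.span (v' ` {..s})"
  have frU: "frame s v' U"
    using fr' by (simp add: U_def)
  have "Y \<subseteq> (\<lambda>p. ppoint (nvec r v p)) ` {p \<in> proj_line. nvec r v p \<in> U}"
  proof
    fix X assume X: "X \<in> Y"
    obtain p where p: "p \<in> proj_line" "X = ppoint (nvec r v p)"
      using X assms(4) N by blast
    obtain p' where p': "p' \<in> proj_line" "X = ppoint (nvec s v' p')"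
      using X assms(5) N' by blast
    have "X \<in> points U"
      using p'(2) nvec_in_frame[OF frU, of p'] nvec_nonzero[OF frU p'(1)] by (auto simp: points_def)
    then have "nvec r v p \<in> U"
      using p(2) ppoint_in_points_iff[OF subspace_frame[OF frU] nvec_nonzero[OF fr p(1)]] by simp
    then show "X \<in> (\<lambda>p. ppoint (nvec r v p)) ` {p \<in> proj_line. nvec r v p \<in> U}"
      using p by blast
  qed
  then have "card Y \<le> card {p \<in> proj_line. nvec r v p \<in> U}"
    by (meson card_image_le card_mono finite finite_imageI order_trans)
  also have "\<dots> \<le> Suc s"
    using nrc_card_in_subspace[OF fr, of U] dim_frame[OF frU] assms(3) by simp
  finally show ?thesis .
qed

subsection \<open>Hyperplane sections of the scroll\<close>

text \<open>
  c2 and c3 parametrise the conic and the twisted cubic, the latter after the projectivity has been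
  absorbed into its frame. The linear functionals on \<open>F\<^sub>q\<^sup>7\<close> then correspond to the pairs of a quadratic
  and a cubic form.
\<close>

locale scroll =
  fixes c2 c3 :: "'a::{field,finite} ^ 2 \<Rightarrow> 'a ^ 7"
  assumes c2_bform: "(\<lambda>p. dotp w (c2 p)) \<in> bform 3"
    and c3_bform: "(\<lambda>p. dotp w (c3 p)) \<in> bform 4"
    and nondegenerate: "(\<And>p. dotp w (c2 p) = 0) \<Longrightarrow> (\<And>p. dotp w (c3 p) = 0) \<Longrightarrow> w = 0"
    and card_ge_7: "7 \<le> CARD('a)"
begin

text \<open>By nondegeneracy the map from functionals to pairs of forms is injective, and both sides
  have \<open>q ^ 7\<close> elements.\<close>

lemma functional_exists:
  assumes f: "f \<in> bform 3" and g: "g \<in> bform 4"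
  obtains w where "\<And>p. dotp w (c2 p) = f p" "\<And>p. dotp w (c3 p) = g p"
proof -
  define \<Phi> where "\<Phi> = (\<lambda>w. (\<lambda>p. dotp w (c2 p), \<lambda>p. dotp w (c3 p)))"
  have "inj \<Phi>"
  proof (rule injI)
    fix v w assume "\<Phi> v = \<Phi> w"
    then have "v - w = 0"
      by (intro nondegenerate) (auto simp: \<Phi>_def fun_eq_iff dotp_left_diff)
    then show "v = w" by simp
  qed
  then have "card (range \<Phi>) = CARD('a) ^ 7"
    by (simp add: card_image CARD_vec)
  moreover have "card (bform 3 \<times> bform 4 :: (('a ^ 2 \<Rightarrow> 'a) \<times> ('a ^ 2 \<Rightarrow> 'a)) set) = CARD('a) ^ (3 + 4)"
    using card_bform[of 3, where 'a = 'a] card_bform[of 4, where 'a = 'a] card_ge_7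
    by (simp only: card_cartesian_product power_add)
  moreover have "range \<Phi> \<subseteq> bform 3 \<times> bform 4"
    using c2_bform c3_bform by (auto simp: \<Phi>_def)
  ultimately have "range \<Phi> = bform 3 \<times> bform 4"
    by (intro card_subset_eq) auto
  then have "(f, g) \<in> range \<Phi>"
    using f g by simp
  then show ?thesis
    using that by (auto simp: \<Phi>_def fun_eq_iff)
qed

definition gen :: "'a ^ 2 \<Rightarrow> ('a ^ 7) set" where
  "gen p = vec.span {c2 p, c3 p}"

lemma subspace_gen: "vec.subspace (gen p)"
  by (simp add: gen_def)

lemma gen_iff: "x \<in> gen p \<longleftrightarrow> (\<exists>a b. x = a *s c2 p + b *s c3 p)"
  unfolding gen_def vec.span_insert vec.span_singleton
  by (auto simp: algebra_simps image_iff)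

lemma gen_subset_hyp_iff: "gen p \<subseteq> hyp w \<longleftrightarrow> dotp w (c2 p) = 0 \<and> dotp w (c3 p) = 0"
proof
  assume "gen p \<subseteq> hyp w"
  moreover have "c2 p \<in> gen p" "c3 p \<in> gen p"
    by (auto simp: gen_def intro: vec.span_base)
  ultimately show "dotp w (c2 p) = 0 \<and> dotp w (c3 p) = 0"
    by (auto simp: hyp_def)
next
  assume "dotp w (c2 p) = 0 \<and> dotp w (c3 p) = 0"
  then show "gen p \<subseteq> hyp w"
    unfolding gen_def by (intro vec.span_minimal subspace_hyp) (auto simp: hyp_def)
qed

text \<open>Three generators span rank 6. A functional that restricts to a separating form on one
  directrix and to zero on the other isolates a single coefficient. The limit of three is that of
  separation by quadratic forms.\<close>

lemma generators_independent:
  assumes T: "T \<subseteq> proj_line" "card T \<le> 3" and z: "(\<Sum>p\<in>T. a p *s c2 p + b p *s c3 p) = 0" and p: "p \<in> T"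
  shows "a p = 0 \<and> b p = 0"
proof -
  have fin: "finite T" by simp
  have e: "(\<Sum>p\<in>T. a p * dotp w (c2 p) + b p * dotp w (c3 p)) = 0" for w
    using arg_cong[OF z, of "dotp w"] by (simp add: dotp_sum dotp_add dotp_scale)
  obtain h where h: "h \<in> bform 3" "h p = 1" "\<And>b. b \<in> T \<Longrightarrow> b \<noteq> p \<Longrightarrow> h b = 0"
    using bform_separates[OF fin T p] by blast
  obtain w where w: "\<And>p. dotp w (c2 p) = h p" "\<And>p. dotp w (c3 p) = 0"
    using functional_exists[OF h(1) bform_zero] by blast
  have "(\<Sum>x\<in>T. a x * h x) = (\<Sum>x\<in>T. if x = p then a p else 0)"
    using h by (intro sum.cong) auto
  then have 1: "a p = 0"
    using e[of w] w p fin by simp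
  have T4: "card T \<le> 4"
    using T(2) by simp
  obtain h where h: "h \<in> bform 4" "h p = 1" "\<And>b. b \<in> T \<Longrightarrow> b \<noteq> p \<Longrightarrow> h b = 0"
    using bform_separates[OF fin T(1) T4 p] by blast
  obtain w where w: "\<And>p. dotp w (c2 p) = 0" "\<And>p. dotp w (c3 p) = h p"
    using functional_exists[OF bform_zero h(1)] by blast
  have "(\<Sum>x\<in>T. b x * h x) = (\<Sum>x\<in>T. if x = p then b p else 0)"
    using h by (intro sum.cong) auto
  then have "b p = 0"
    using e[of w] w p fin by simp
  with 1 show ?thesis by simp
qed

lemma generator_coeffs_unique:
  assumes "p \<in> proj_line" "a *s c2 p + b *s c3 p = 0"
  shows "a = 0 \<and> b = 0"
  using generators_independent[of "{p}" "\<lambda>_. a" "\<lambda>_. b" p] assms by simp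

lemma c2_nonzero: "p \<in> proj_line \<Longrightarrow> c2 p \<noteq> 0"
  using generator_coeffs_unique[of p 1 0] by auto

lemma gen_disjoint:
  assumes p: "p \<in> proj_line" "p' \<in> proj_line" "p \<noteq> p'" and x: "x \<in> gen p" "x \<in> gen p'"
  shows "x = 0"
proof -
  obtain a b where ab: "x = a *s c2 p + b *s c3 p"
    using x(1) unfolding gen_iff by blast
  obtain a' b' where ab': "x = a' *s c2 p' + b' *s c3 p'"
    using x(2) unfolding gen_iff by blast
  define A where "A = (\<lambda>y. if y = p then a else - a')"
  define B where "B = (\<lambda>y. if y = p then b else - b')"
  have "(\<Sum>y\<in>{p, p'}. A y *s c2 y + B y *s c3 y) = x - x"
    using p(3) unfolding A_def B_def by (subst (1) ab, subst ab') simp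
  then have "(\<Sum>y\<in>{p, p'}. A y *s c2 y + B y *s c3 y) = 0"
    by simp
  then have "A p = 0 \<and> B p = 0"
    by (rule generators_independent[rotated 2]) (use p in \<open>auto simp: card_insert_if\<close>)
  then show ?thesis
    using ab by (simp add: A_def B_def)
qed

lemma dim_gen: 
  assumes "p \<in> proj_line" shows "vec.dim (gen p) = 2"
proof -
  define m where "m = (\<lambda>i::bool. if i then c2 p else c3 p)"
  have *: "\<forall>i\<in>UNIV. c i = 0" if "(\<Sum>i\<in>UNIV. c i *s m i) = 0" for c
    using generator_coeffs_unique[OF assms, of "c True" "c False"] that
    by (auto simp: UNIV_bool m_def add.commute)
  have "inj m" "vec.independent (range m)"
    using independent_family[OF finite_class.finite_UNIV *] by blast+
  moreover have "range m = {c2 p, c3 p}"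
    by (auto simp: m_def UNIV_bool)
  moreover have "card (range m) = 2"
    using \<open>inj m\<close> by (simp add: card_image)
  ultimately show ?thesis
    unfolding gen_def vec.dim_span by (simp add: vec.dim_eq_card_independent)
qed

definition curve_vec :: "('a ^ 2 \<Rightarrow> 'a) \<Rightarrow> ('a ^ 2 \<Rightarrow> 'a) \<Rightarrow> 'a ^ 2 \<Rightarrow> 'a ^ 7" where
  "curve_vec f g p = g p *s c2 p - f p *s c3 p"

lemma dotp_curve_vec: "dotp w (curve_vec f g p) = g p * dotp w (c2 p) - f p * dotp w (c3 p)"
  by (simp add: curve_vec_def dotp_diff dotp_scale)

lemma curve_vec_in_gen: "curve_vec f g p \<in> gen p"
  unfolding gen_iff curve_vec_def by (rule exI[of _ "g p"], rule exI[of _ "- f p"]) simp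

lemma curve_vec_nonzero:
  assumes "p \<in> proj_line" "f p \<noteq> 0 \<or> g p \<noteq> 0"
  shows "curve_vec f g p \<noteq> 0"
  using generator_coeffs_unique[OF assms(1), of "g p" "- f p"] assms(2) by (auto simp: curve_vec_def)

lemma curve_vec_multiple:
  assumes "a * f p + b * g p = 0" "f p \<noteq> 0 \<or> g p \<noteq> 0"
  shows "\<exists>k. a *s c2 p + b *s c3 p = k *s curve_vec f g p"
proof (cases "f p = 0")
  case True
  then have "b = 0" "g p \<noteq> 0"
    using assms by auto
  then show ?thesis
    using True by (intro exI[of _ "a / g p"]) (simp add: curve_vec_def)
next
  case False
  then have "a = - b / f p * g p"
    using assms(1) by (simp add: field_simps eq_neg_iff_add_eq_0)
  then show ?thesis
    using False by (intro exI[of _ "- b / f p"]) (simp add: curve_vec_def vec.scale_right_diff_distrib)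
qed

text \<open>Both products have degree r, as \<open>(r - 2) + 2 = (r - 3) + 3\<close>; the unequal
  degrees of a primitive pair compensate for those of the two directrices.\<close>

lemma dotp_curve_vec_bform:
  assumes p: "prim r f g" and r: "r \<in> {2..5}"
  shows "(\<lambda>p. dotp w (curve_vec f g p)) \<in> bform (Suc r)"
  unfolding dotp_curve_vec
  by (intro bform_diff bform_mult[OF primD(2)[OF p] c2_bform] bform_mult[OF primD(1)[OF p] c3_bform])
    (use r in auto)

text \<open>
  The curve spans rank \<open>r + 1\<close> because the functionals vanishing on it are exactly the multiples
  \<open>h (f, g)\<close> with h of degree \<open>5 - r\<close>.
\<close>

lemma curve_vec_annihilator_card:
  assumes p: "prim r f g" and r: "r \<in> {2..5}"
  shows "card {w. \<forall>p. dotp w (curve_vec f g p) = 0} = CARD('a) ^ (6 - r)"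
proof -
  define K where "K = {w. \<forall>p. dotp w (curve_vec f g p) = 0}"
  define \<Phi> where "\<Phi> = (\<lambda>w. (\<lambda>p. dotp w (c2 p), \<lambda>p. dotp w (c3 p)))"
  define H where "H = (\<lambda>h. (\<lambda>p. h p * f p, \<lambda>p. h p * g p))"
  have card_ge_5: "5 \<le> CARD('a)"
    using card_ge_7 by simp
  have "inj_on \<Phi> K"
  proof (rule inj_onI)
    fix v w assume "\<Phi> v = \<Phi> w"
    then have "v - w = 0"
      by (intro nondegenerate) (auto simp: \<Phi>_def fun_eq_iff dotp_left_diff)
    then show "v = w" by simp
  qed
  moreover have "\<Phi> ` K = H ` bform (6 - r)"
  proof (intro equalityI subsetI)
    fix x assume "x \<in> \<Phi> ` K"
    then obtain w where w: "w \<in> K" "x = \<Phi> w" by blast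
    \<comment> \<open>For the forms F and G of the functional w, vanishing on the curve means
      \<open>F g = G f\<close>, so the kernel lemma applies with \<open>s = 5\<close>.\<close>
    have "\<exists>h\<in>bform (5 + 1 - r). (\<lambda>p. dotp w (c2 p)) = (\<lambda>p. h p * f p) \<and> (\<lambda>p. dotp w (c3 p)) = (\<lambda>p. h p * g p)"
      by (rule prim_kernel[OF card_ge_5 p])
        (use r w c2_bform[of w] c3_bform[of w] in \<open>auto simp: K_def dotp_curve_vec mult.commute\<close>)
    then show "x \<in> H ` bform (6 - r)"
      using w(2) by (auto simp: \<Phi>_def H_def)
  next
    fix x assume "x \<in> H ` bform (6 - r)"
    then obtain h where h: "h \<in> bform (6 - r)" "x = H h" by blast
    have "(\<lambda>p. h p * f p) \<in> bform 3" "(\<lambda>p. h p * g p) \<in> bform 4"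
      by (rule bform_mult[OF h(1) primD(1)[OF p]] bform_mult[OF h(1) primD(2)[OF p]]; use r in auto)+
    then obtain w where w: "\<And>p. dotp w (c2 p) = h p * f p" "\<And>p. dotp w (c3 p) = h p * g p"
      by (rule functional_exists) blast
    have "w \<in> K" "x = \<Phi> w"
      using h(2) w by (auto simp: K_def dotp_curve_vec H_def \<Phi>_def)
    then show "x \<in> \<Phi> ` K" by blast
  qed
  moreover have "inj_on H (bform (6 - r))"
  proof (rule inj_onI)
    fix h h' assume h: "h \<in> bform (6 - r)" "h' \<in> bform (6 - r)" "H h = H h'"
    then have e: "f p * h p = f p * h' p" "g p * h p = g p * h' p" for p
      by (auto simp: H_def fun_eq_iff mult.commute)
    show "h = h'"
    proof (cases "f = (\<lambda>p. 0)")
      case True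
      then have "g \<noteq> (\<lambda>p. 0)"
        using prim_nonzero[OF p] by simp
      then show ?thesis
        by (rule bform_cancel[OF primD(2)[OF p] _ h(1,2) _ e(2)]) (use r card_ge_5 in auto)
    next
      case False
      then show ?thesis
        by (rule bform_cancel[OF primD(1)[OF p] _ h(1,2) _ e(1)]) (use r card_ge_5 in auto)
    qed
  qed
  ultimately have "card K = card (bform (6 - r) :: ('a ^ 2 \<Rightarrow> 'a) set)"
    by (metis card_image)
  then show ?thesis
    using card_bform[of "6 - r", where 'a = 'a] card_ge_5 r by (simp add: K_def)
qed

text \<open>The fibres are cosets of the annihilator of the curve, of size
  \<open>q ^ (6 - r)\<close>. Hence the image of the \<open>q ^ 7\<close> functionals has
  \<open>q ^ (r + 1)\<close> elements, as many as there are forms of degree r.\<close>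

lemma curve_vec_functional_surj:
  assumes p: "prim r f g" and r: "r \<in> {2..5}" and h: "h \<in> bform (Suc r)"
  obtains w where "\<And>p. dotp w (curve_vec f g p) = h p"
proof -
  define \<Psi> where "\<Psi> = (\<lambda>w p. dotp w (curve_vec f g p))"
  have "card (UNIV :: ('a ^ 7) set) = CARD('a) ^ (6 - r) * card (range \<Psi>)"
  proof (rule card_eq_mult_fibres[where \<phi> = \<Psi>])
    fix a :: "'a ^ 7"
    have "bij_betw (\<lambda>w. w - a) {x \<in> UNIV. \<Psi> x = \<Psi> a} {w. \<forall>p. dotp w (curve_vec f g p) = 0}"
      by (rule bij_betw_byWitness[where f' = "\<lambda>w. w + a"])
        (auto simp: \<Psi>_def fun_eq_iff dotp_left_diff dotp_left_add)
    then show "card {x \<in> UNIV. \<Psi> x = \<Psi> a} = CARD('a) ^ (6 - r)"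
      using curve_vec_annihilator_card[OF p r] by (simp add: bij_betw_same_card)
  qed auto
  then have "CARD('a) ^ (6 - r + Suc r) = CARD('a) ^ (6 - r) * card (range \<Psi>)"
    using r by (simp add: CARD_vec)
  then have "card (range \<Psi>) = CARD('a) ^ Suc r"
    unfolding power_add by simp
  then have "card (range \<Psi>) = card (bform (Suc r) :: ('a ^ 2 \<Rightarrow> 'a) set)"
    using card_bform[of "Suc r", where 'a = 'a] card_ge_7 r by simp
  moreover have "range \<Psi> \<subseteq> bform (Suc r)"
    using dotp_curve_vec_bform[OF p r] by (auto simp: \<Psi>_def)
  ultimately have "range \<Psi> = bform (Suc r)"
    by (intro card_subset_eq) auto
  then have "h \<in> range \<Psi>"
    using h by simp
  then show ?thesis
    using that by (auto simp: \<Psi>_def)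
qed

text \<open>The frame consists of the coefficient vectors of the parametrisation. They are
  independent because each monomial of degree r is the restriction of some functional, and these
  functionals are dual to the frame.\<close>

lemma curve_vec_frame:
  assumes p: "prim r f g" and r: "r \<in> {2..5}"
  obtains v where "frame r v (vec.span (v ` {..r}))" "curve_vec f g = nvec r v"
proof -
  have ex: "\<forall>k. \<exists>c. (\<lambda>p. dotp (axis k 1) (curve_vec f g p)) = (\<lambda>p. \<Sum>i<Suc r. c i * ((p $ 1) ^ (Suc r - 1 - i) * (p $ 2) ^ i))"
    using dotp_curve_vec_bform[OF p r] unfolding bform_def by blast
  obtain c where c: "\<And>k. (\<lambda>p. dotp (axis k 1) (curve_vec f g p)) = (\<lambda>p. \<Sum>i<Suc r. c k i * ((p $ 1) ^ (Suc r - 1 - i) * (p $ 2) ^ i))"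
    using choice[OF ex] by blast
  define v where "v = (\<lambda>i. \<chi> k. c k i)"
  have curve_vec: "curve_vec f g p = nvec r v p" for p
  proof -
    have "curve_vec f g p $ k = nvec r v p $ k" for k
      using fun_cong[OF c[of k], of p]
      by (simp add: dotp_axis nvec_def v_def sum_component lessThan_Suc_atMost mult_ac)
    then show ?thesis
      by (simp add: vec_eq_iff)
  qed
  have "\<forall>j\<in>{..r}. a j = 0" if z: "(\<Sum>i\<in>{..r}. a i *s v i) = 0" for a
  proof
    fix j assume j: "j \<in> {..r}"
    have "(\<lambda>p. (p $ 1) ^ (r - j) * (p $ 2) ^ j) \<in> bform (Suc r)"
      using j by (intro bform_monomial) auto
    then obtain w where w: "\<And>p. dotp w (curve_vec f g p) = (p $ 1) ^ (r - j) * (p $ 2) ^ j"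
      by (rule curve_vec_functional_surj[OF p r]) blast
    have "dotp w (v i) = (if i = j then 1 else 0)" if i: "i \<in> {..r}" for i
    proof (rule bform_coeff_unique[of "Suc r" "\<lambda>i. dotp w (v i)" "\<lambda>i. if i = j then 1 else 0"])
      fix p :: "'a ^ 2"
      have "(\<Sum>i<Suc r. dotp w (v i) * ((p $ 1) ^ (Suc r - 1 - i) * (p $ 2) ^ i)) = dotp w (curve_vec f g p)"
        unfolding curve_vec nvec_def dotp_sum dotp_scale lessThan_Suc_atMost by (simp add: mult_ac)
      also have "\<dots> = (\<Sum>i<Suc r. (if i = j then 1 else 0) * ((p $ 1) ^ (Suc r - 1 - i) * (p $ 2) ^ i))"
        unfolding w lessThan_Suc_atMost using j by (simp add: if_distrib[of "\<lambda>x. x * _"] cong: if_cong)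
      finally show "(\<Sum>i<Suc r. dotp w (v i) * ((p $ 1) ^ (Suc r - 1 - i) * (p $ 2) ^ i))
        = (\<Sum>i<Suc r. (if i = j then 1 else 0) * ((p $ 1) ^ (Suc r - 1 - i) * (p $ 2) ^ i))" .
    qed (use r card_ge_7 i in auto)
    then have "(\<Sum>i\<le>r. a i * dotp w (v i)) = (\<Sum>i\<le>r. if i = j then a j else 0)"
      by (intro sum.cong) auto
    moreover have "(\<Sum>i\<le>r. a i * dotp w (v i)) = 0"
      using arg_cong[OF z, of "dotp w"] by (simp add: dotp_sum dotp_scale)
    ultimately show "a j = 0"
      using j by simp
  qed
  then have "inj_on v {..r}" "vec.independent (v ` {..r})"
    using independent_family[of "{..r}" v] by blast+
  then show ?thesis
    using that[of v] curve_vec by (auto simp: frame_def)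
qed

definition curve :: "('a ^ 2 \<Rightarrow> 'a) \<Rightarrow> ('a ^ 2 \<Rightarrow> 'a) \<Rightarrow> ('a ^ 7) set set" where
  "curve f g = (\<lambda>p. ppoint (curve_vec f g p)) ` proj_line"

lemma nrc_curve:
  assumes "prim r f g" "r \<in> {2..5}"
  shows "nrc r (curve f g)"
proof -
  obtain v where "frame r v (vec.span (v ` {..r}))" "curve_vec f g = nvec r v"
    using curve_vec_frame[OF assms] .
  then show ?thesis
    unfolding nrc_iff curve_def by auto
qed

definition surface :: "('a ^ 7) set set" where
  "surface = (\<Union>p\<in>proj_line. points (gen p))"

definition gens :: "('a ^ 7) set set set" where
  "gens = (\<lambda>p. points (gen p)) ` proj_line"

lemma inj_generators: "inj_on (\<lambda>p. points (gen p)) proj_line"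
proof (rule inj_onI, rule ccontr)
  fix p p' assume p: "p \<in> proj_line" "p' \<in> proj_line" "points (gen p) = points (gen p')" "p \<noteq> p'"
  have "c2 p \<in> gen p"
    by (simp add: gen_def vec.span_base)
  moreover from this have "c2 p \<in> gen p'"
    using p(3) points_subset_iff[OF subspace_gen[of p] subspace_gen[of p']] by blast
  ultimately show False
    using gen_disjoint[OF p(1,2,4)] c2_nonzero[OF p(1)] by blast
qed

lemma ppoint_in_surface_iff:
  assumes "x \<noteq> 0"
  shows "ppoint x \<in> surface \<longleftrightarrow> (\<exists>p\<in>proj_line. x \<in> gen p)"
  using ppoint_in_points_iff[OF subspace_gen assms] by (auto simp: surface_def)

lemma curve_subset_surface:
  assumes "prim r f g"
  shows "curve f g \<subseteq> surface"
proof
  fix X assume "X \<in> curve f g"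
  then obtain p where p: "p \<in> proj_line" "X = ppoint (curve_vec f g p)"
    by (auto simp: curve_def)
  then show "X \<in> surface"
    using curve_vec_in_gen[of f g p] curve_vec_nonzero[OF p(1)] prim_no_common_root[OF assms proj_line_nonzero[OF p(1)]]
    by (auto simp: ppoint_in_surface_iff)
qed

text \<open>A primitive pair has no common root, so \<open>d p * f p\<close> and
  \<open>d p * g p\<close> both vanish only where d does.\<close>

lemma generators_in_hyp:
  assumes p: "prim r f g"
    and w: "\<And>p. dotp w (c2 p) = d p * f p" "\<And>p. dotp w (c3 p) = d p * g p"
  shows "generators_in gens (hyp w) = (\<lambda>p. points (gen p)) ` roots d"
    "card (generators_in gens (hyp w)) = card (roots d)"
proof -
  have "points (gen x) \<subseteq> points (hyp w) \<longleftrightarrow> x \<in> roots d" if "x \<in> proj_line" for x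
    using prim_no_common_root[OF p proj_line_nonzero[OF that]] that
    unfolding points_subset_iff[OF subspace_gen subspace_hyp] gen_subset_hyp_iff w by (auto simp: roots_def)
  then show 1: "generators_in gens (hyp w) = (\<lambda>p. points (gen p)) ` roots d"
    by (auto simp: generators_in_def gens_def roots_def)
  show "card (generators_in gens (hyp w)) = card (roots d)"
    unfolding 1 by (intro card_image inj_on_subset[OF inj_generators]) (auto simp: roots_def)
qed

lemma surface_inter_hyp:
  assumes p: "prim r f g"
    and w: "\<And>p. dotp w (c2 p) = d p * f p" "\<And>p. dotp w (c3 p) = d p * g p"
  shows "surface \<inter> points (hyp w) = curve f g \<union> \<Union> (generators_in gens (hyp w))"
proof (intro equalityI subsetI)
  fix X assume X: "X \<in> surface \<inter> points (hyp w)"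
  then obtain x t where x: "x \<noteq> 0" "X = ppoint x" "t \<in> proj_line" "x \<in> gen t"
    by (auto simp: surface_def points_def)
  have xw: "x \<in> hyp w"
    using X x ppoint_in_points_iff[OF subspace_hyp] by auto
  obtain a b where ab: "x = a *s c2 t + b *s c3 t"
    using x(4) by (auto simp: gen_iff)
  have "d t * (a * f t + b * g t) = dotp w x"
    unfolding ab by (simp add: dotp_add dotp_scale w algebra_simps)
  then have "d t * (a * f t + b * g t) = 0"
    using xw by (simp add: hyp_def)
  then consider "d t = 0" | "a * f t + b * g t = 0" by auto
  then show "X \<in> curve f g \<union> \<Union> (generators_in gens (hyp w))"
  proof cases
    case 1
    then have "t \<in> roots d"
      using x(3) by (simp add: roots_def)
    moreover have "X \<in> points (gen t)"
      using x by (auto simp: points_def)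
    ultimately show ?thesis
      unfolding generators_in_hyp(1)[OF p w] by blast
  next
    case 2
    then obtain k where k: "x = k *s curve_vec f g t"
      using curve_vec_multiple[of a f t b g] prim_no_common_root[OF p proj_line_nonzero[OF x(3)]] ab by auto
    then have "k \<noteq> 0"
      using x(1) by auto
    then have "X = ppoint (curve_vec f g t)"
      unfolding x(2) using k by (rule ppoint_eqI)
    then show ?thesis
      using x(3) by (auto simp: curve_def)
  qed
next
  fix X assume "X \<in> curve f g \<union> \<Union> (generators_in gens (hyp w))"
  then consider "X \<in> curve f g" | "X \<in> \<Union> (generators_in gens (hyp w))" by blast
  then show "X \<in> surface \<inter> points (hyp w)"
  proof cases
    case 1
    then obtain t where t: "t \<in> proj_line" "X = ppoint (curve_vec f g t)"
      by (auto simp: curve_def)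
    have "curve_vec f g t \<noteq> 0"
      using curve_vec_nonzero[OF t(1)] prim_no_common_root[OF p proj_line_nonzero[OF t(1)]] by blast
    moreover have "curve_vec f g t \<in> hyp w"
      by (simp add: hyp_def dotp_curve_vec w)
    ultimately show ?thesis
      using curve_subset_surface[OF p] 1 t(2) by (auto simp: points_def)
  next
    case 2
    then show ?thesis
      by (auto simp: generators_in_def gens_def surface_def)
  qed
qed

end

subsection \<open>Curves and lines on the scroll\<close>

lemma dim_le_1_multiple:
  fixes x y :: "'a::field ^ 'n"
  assumes "vec.dim X' \<le> 1" "x \<in> X'" "y \<in> X'" "x \<noteq> 0"
  shows "\<exists>k. y = k *s x"
proof -
  have "X' \<subseteq> vec.span {x}"
    by (rule vec.card_ge_dim_independent) (use assms in \<open>auto simp: vec.dependent_single\<close>)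
  then show ?thesis
    using assms(3) by (auto simp: vec.span_singleton)
qed

context scroll
begin

text \<open>The two directrix vectors on each of the generators form an independent family. This
  limits how many generators the span of a curve can contain.\<close>

lemma dim_contains_generators:
  assumes T: "T \<subseteq> proj_line" "card T \<le> 3" and U: "\<And>a. a \<in> T \<Longrightarrow> gen a \<subseteq> U"
  shows "2 * card T \<le> vec.dim U"
proof -
  define m where "m = (\<lambda>(a, i::bool). if i then c2 a else c3 a)"
  have ind: "\<forall>x\<in>T \<times> UNIV. c x = 0" if z: "(\<Sum>x\<in>T \<times> UNIV. c x *s m x) = 0" for c
  proof -
    have "(\<Sum>x\<in>T \<times> UNIV. c x *s m x) = (\<Sum>a\<in>T. \<Sum>i\<in>UNIV. c (a, i) *s m (a, i))"
      by (simp add: sum.cartesian_product)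
    also have "\<dots> = (\<Sum>a\<in>T. c (a, True) *s c2 a + c (a, False) *s c3 a)"
      by (intro sum.cong) (auto simp: UNIV_bool m_def add.commute)
    finally have "(\<Sum>a\<in>T. c (a, True) *s c2 a + c (a, False) *s c3 a) = 0"
      using z by simp
    then have "c (a, True) = 0 \<and> c (a, False) = 0" if "a \<in> T" for a
      by (rule generators_independent[OF T _ that])
    then show ?thesis
      by (metis (full_types) SigmaE)
  qed
  have fin: "finite (T \<times> (UNIV :: bool set))" by simp
  have inj: "inj_on m (T \<times> UNIV)"
    by (rule independent_family(1)[OF fin]) (rule ind)
  have indep: "vec.independent (m ` (T \<times> UNIV))"
    by (rule independent_family(2)[OF fin]) (rule ind)
  from inj have "card (m ` (T \<times> UNIV)) = 2 * card T"
    by (simp add: card_image card_cartesian_product)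
  moreover have "m ` (T \<times> UNIV) \<subseteq> U"
  proof -
    have "c2 a \<in> U" "c3 a \<in> U" if "a \<in> T" for a
      using U[OF that] by (auto simp: gen_def intro: vec.span_base)
    then show ?thesis
      by (auto simp: m_def)
  qed
  ultimately show ?thesis
    using vec.independent_card_le_dim[OF _ indep] by simp
qed

lemma gen_spanned:
  assumes a: "a \<in> proj_line" and x: "x \<in> gen a" "x \<noteq> 0" and y: "y \<in> gen a" "y \<notin> vec.span {x}"
  shows "gen a \<subseteq> vec.span {x, y}"
proof -
  have "vec.independent {y, x}"
    using x y by (simp add: vec.independent_insert vec.dependent_single)
  moreover have "y \<noteq> x"
    using y(2) by (auto simp: vec.span_base)
  ultimately show ?thesis
    using dim_gen[OF a] x y by (intro vec.card_ge_dim_independent) (auto simp: insert_commute)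
qed

lemma gen_complement:
  assumes a: "a \<in> proj_line" and x: "x \<in> gen a" "x \<noteq> 0"
  obtains y where "gen a \<subseteq> vec.span {x, y}"
proof -
  have "\<not> gen a \<subseteq> vec.span {x}"
    using vec.dim_subset[of "gen a" "vec.span {x}"] dim_gen[OF a] x(2)
    by (auto simp: vec.dim_eq_card_independent vec.dependent_single)
  then obtain y where "y \<in> gen a" "y \<notin> vec.span {x}"
    by blast
  then show ?thesis
    using gen_spanned[OF a x] that by blast
qed

lemma dim_gen_inter:
  assumes a: "a \<in> proj_line" and U: "vec.subspace U" "\<not> gen a \<subseteq> U"
  shows "vec.dim (gen a \<inter> U) \<le> 1"
proof (rule ccontr)
  assume "\<not> ?thesis"
  then have "gen a \<inter> U = gen a"
    using dim_gen[OF a] by (intro vec.subspace_dim_equal vec.subspace_inter subspace_gen U(1)) auto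
  then show False
    using U(2) by blast
qed

text \<open>The difficulty is that the parameter of N has no known relation to that of the
  generators: a generator may carry several points of N or none. The proof therefore works with
  counts of points and gets the final equality from inclusion and cardinality.\<close>

theorem nrc_in_surface:
  assumes N: "nrc r N" "N \<subseteq> surface" and r: "r \<in> {2..5}"
  obtains f g where "prim r f g" "N = curve f g"
proof -
  obtain v where fr: "frame r v (vec.span (v ` {..r}))" and Nv: "N = (\<lambda>p. ppoint (nvec r v p)) ` proj_line"
    using N(1) unfolding nrc_iff by blast
  define U where "U = vec.span (v ` {..r})"
  define m where "m = nvec r v"
  have frU: "frame r v U"
    using fr by (simp add: U_def)
  note subU = subspace_frame[OF frU]
  have mU: "m p \<in> U" for p
    unfolding m_def by (rule nvec_in_frame[OF frU])
  have m0: "m p \<noteq> 0" if "p \<in> proj_line" for p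
    unfolding m_def by (rule nvec_nonzero[OF frU that])
  have "\<forall>p\<in>proj_line. \<exists>a. a \<in> proj_line \<and> m p \<in> gen a"
  proof
    fix p :: "'a ^ 2" assume p: "p \<in> proj_line"
    then have "ppoint (m p) \<in> surface"
      using N(2) unfolding Nv m_def by auto
    then show "\<exists>a. a \<in> proj_line \<and> m p \<in> gen a"
      using ppoint_in_surface_iff[OF m0[OF p]] by blast
  qed
  then obtain \<pi> where \<pi>: "\<And>p. p \<in> proj_line \<Longrightarrow> \<pi> p \<in> proj_line" "\<And>p. p \<in> proj_line \<Longrightarrow> m p \<in> gen (\<pi> p)"
    by (metis bchoice)
  \<comment> \<open>A generator has rank 2, so it contains at most two points of N, even for a
    conic.\<close>
  define fib where "fib = (\<lambda>a. {p \<in> proj_line. m p \<in> gen a})"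
  have fib2: "card (fib a) \<le> 2" if "a \<in> proj_line" for a
    using nrc_card_in_subspace[OF frU, of "gen a"] dim_gen[OF that] r by (simp add: fib_def m_def)
  define A where "A = \<pi> ` proj_line"
  have A: "A \<subseteq> proj_line"
    using \<pi>(1) by (auto simp: A_def)
  \<comment> \<open>N has at least 8 points and a generator carries at most two of them.\<close>
  have cardA: "4 \<le> card A"
  proof -
    have "(proj_line :: ('a ^ 2) set) \<subseteq> (\<Union>a\<in>A. fib a)"
      using \<pi> by (auto simp: A_def fib_def)
    then have "CARD('a) + 1 \<le> card (\<Union>a\<in>A. fib a)"
      using card_mono[of "\<Union>a\<in>A. fib a" proj_line] card_proj_line[where 'a = 'a] by simp
    also have "\<dots> \<le> (\<Sum>a\<in>A. card (fib a))"
      by (rule card_UN_le) simp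
    also have "\<dots> \<le> (\<Sum>a\<in>A. 2)"
      using fib2 A by (intro sum_mono) auto
    finally show ?thesis
      using card_ge_7 by simp
  qed
  define Bad where "Bad = {a \<in> proj_line. gen a \<subseteq> U}"
  have bad: "2 * card T \<le> Suc r" if "T \<subseteq> Bad" "card T \<le> 3" for T
    using dim_contains_generators[of T U] that dim_frame[OF frU] by (auto simp: Bad_def)
  \<comment> \<open>For \<open>r < 5\<close> the span of N has rank at most 5, so it contains at
    most two generators, and in fact at most half of \<open>r + 1\<close>. Removing these from the
    four leaves at least \<open>5 - r\<close>.\<close>
  have "5 - r \<le> card (A - Bad)"
  proof (cases "r = 5")
    case False
    have "card Bad \<le> 2"
    proof (rule ccontr)
      assume "\<not> card Bad \<le> 2"
      then have "3 \<le> card Bad" by simp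
      then obtain T where "T \<subseteq> Bad" "card T = 3"
        by (rule obtain_subset_with_card_n)
      then show False
        using bad[of T] r False by auto
    qed
    moreover from this have "2 * card Bad \<le> Suc r"
      by (intro bad) auto
    moreover have "card A - card Bad \<le> card (A - Bad)"
      by (rule diff_card_le_card_Diff) simp
    ultimately show ?thesis
      using cardA r False by auto
  qed simp
  then obtain P where P: "P \<subseteq> A - Bad" "card P = 5 - r"
    by (rule obtain_subset_with_card_n)
  have Pline: "P \<subseteq> proj_line" and PU: "\<And>a. a \<in> P \<Longrightarrow> \<not> gen a \<subseteq> U"
    using P(1) A by (auto simp: Bad_def)
  have dimP: "vec.dim (gen a \<inter> U) \<le> 1" if "a \<in> P" for a
    using dim_gen_inter[OF _ subU PU[OF that]] Pline that by blast
  have fib1: "card (fib a) \<le> 1" if "a \<in> P" for a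
  proof -
    have "fib a = {p \<in> proj_line. nvec r v p \<in> gen a \<inter> U}"
      using mU by (auto simp: fib_def m_def)
    then show ?thesis
      using nrc_card_in_subspace[OF frU, of "gen a \<inter> U"] dimP[OF that] r by simp
  qed
  have "\<forall>a\<in>P. \<exists>z. z \<in> gen a \<and> z \<notin> U"
    using PU by blast
  then obtain z where z: "\<And>a. a \<in> P \<Longrightarrow> z a \<in> gen a" "\<And>a. a \<in> P \<Longrightarrow> z a \<notin> U"
    by (metis bchoice)
  \<comment> \<open>The \<open>r + 1\<close> frame vectors and one vector outside the span on each
    of the \<open>5 - r\<close> chosen generators are at most 6 vectors, so some hyperplane contains
    them all. It contains the chosen generators too, since each also has a point on N.\<close>
  have "card (v ` {..r} \<union> z ` P) \<le> card (v ` {..r}) + card (z ` P)"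
    by (rule card_Un_le)
  also have "\<dots> \<le> Suc r + (5 - r)"
    using card_image_le[of "{..r}" v] card_image_le[of P z] P(2) by simp
  also have "\<dots> < 7"
    using r by simp
  finally have "vec.dim (v ` {..r} \<union> z ` P) < CARD(7)"
    using vec.dim_le_card'[of "v ` {..r} \<union> z ` P"] by simp
  then obtain w where w: "w \<noteq> 0" "v ` {..r} \<union> z ` P \<subseteq> hyp w"
    by (rule annihilator_exists)
  have Uw: "U \<subseteq> hyp w"
    unfolding U_def using w(2) by (intro vec.span_minimal subspace_hyp) auto
  have LPw: "gen a \<subseteq> hyp w" if a: "a \<in> P" for a
  proof -
    obtain p where p: "p \<in> proj_line" "\<pi> p = a"
      using P(1) a by (auto simp: A_def)
    have mp: "m p \<in> gen a" "m p \<noteq> 0"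
      using \<pi>(2)[OF p(1)] p m0 by auto
    have "vec.span {m p} \<subseteq> U"
      using mU subU by (intro vec.span_minimal) auto
    then have "z a \<notin> vec.span {m p}"
      using z(2)[OF a] by blast
    then have "gen a \<subseteq> vec.span {m p, z a}"
      using gen_spanned[OF _ mp z(1)[OF a]] Pline a by blast
    also have "\<dots> \<subseteq> hyp w"
      using mU[of p] Uw w(2) a by (intro vec.span_minimal subspace_hyp) auto
    finally show ?thesis .
  qed
  have rF: "P \<subseteq> roots (\<lambda>p. dotp w (c2 p))" and rG: "P \<subseteq> roots (\<lambda>p. dotp w (c3 p))"
    using LPw Pline unfolding gen_subset_hyp_iff by (auto simp: roots_def)
  \<comment> \<open>Removing \<open>5 - r\<close> roots leaves the dimensions of a pair of index r:
    \<open>3 - (5 - r) = r - 2\<close> and \<open>4 - (5 - r) = r - 1\<close>.\<close>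
  obtain f1 where f1: "f1 \<in> bform (r - 2)" "(\<lambda>p. dotp w (c2 p)) = (\<lambda>p. linprod P p * f1 p)"
    using bform_roots_div[OF _ c2_bform rF] P(2) r by auto
  obtain g1 where g1: "g1 \<in> bform (r - 1)" "(\<lambda>p. dotp w (c3 p)) = (\<lambda>p. linprod P p * g1 p)"
    using bform_roots_div[OF _ c3_bform rG] P(2) r by auto
  have nz: "f1 \<noteq> (\<lambda>p. 0) \<or> g1 \<noteq> (\<lambda>p. 0)"
  proof (rule ccontr)
    assume "\<not> ?thesis"
    then have "w = 0"
      using f1(2) g1(2) by (intro nondegenerate) (auto simp: fun_eq_iff)
    then show False
      using w(1) by simp
  qed
  obtain e d f g where e: "e \<le> r - 2" and d: "d \<in> bform (Suc e)" and pr: "prim (r - e) f g"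
    and fd: "f1 = (\<lambda>p. d p * f p)" and gd: "g1 = (\<lambda>p. d p * g p)"
    by (rule prim_factor[OF f1(1) g1(1) nz]) (use r in auto)
  have d0: "d \<noteq> (\<lambda>p. 0)"
    using nz fd gd by auto
  have re: "r - e \<in> {2..5}"
    using e r by auto
  \<comment> \<open>Away from the chosen generators and the roots of d, the hyperplane meets a
    generator only in the point of the curve belonging to (f, g), so a point of N there must be that
    point.\<close>
  have key: "\<exists>k. k \<noteq> 0 \<and> m p = k *s curve_vec f g (\<pi> p)" if p: "p \<in> proj_line" "\<pi> p \<notin> P" "d (\<pi> p) \<noteq> 0" for p
  proof -
    obtain a b where ab: "m p = a *s c2 (\<pi> p) + b *s c3 (\<pi> p)"
      using \<pi>(2)[OF p(1)] by (auto simp: gen_iff)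
    have eqs: "dotp w (c2 x) = linprod P x * (d x * f x)" "dotp w (c3 x) = linprod P x * (d x * g x)" for x
      using fun_cong[OF f1(2), of x] fun_cong[OF g1(2), of x] by (simp_all add: fd gd)
    have "linprod P (\<pi> p) * d (\<pi> p) * (a * f (\<pi> p) + b * g (\<pi> p)) = dotp w (m p)"
      unfolding ab by (simp add: dotp_add dotp_scale eqs algebra_simps)
    also have "\<dots> = 0"
      using mU[of p] Uw by (auto simp: hyp_def)
    finally have "a * f (\<pi> p) + b * g (\<pi> p) = 0"
      using p \<pi>(1)[OF p(1)] Pline by (simp add: linprod_eq_0_iff)
    then obtain k where "m p = k *s curve_vec f g (\<pi> p)"
      using curve_vec_multiple[of a f "\<pi> p" b g] prim_no_common_root[OF pr proj_line_nonzero[OF \<pi>(1)[OF p(1)]]] ab by auto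
    then show ?thesis
      using m0[OF p(1)] by auto
  qed
  define Q where "Q = {p \<in> proj_line. \<pi> p \<notin> P}"
  \<comment> \<open>Each chosen generator carries at most one point of N, since it meets the span in
    rank at most 1. Of at least 8 points at most \<open>5 - r\<close> are lost.\<close>
  have cardQ: "r + 3 \<le> card Q"
  proof -
    have "proj_line - Q \<subseteq> (\<Union>a\<in>P. fib a)"
      using \<pi> by (auto simp: Q_def fib_def)
    then have "card (proj_line - Q) \<le> card (\<Union>a\<in>P. fib a)"
      by (intro card_mono) auto
    also have "\<dots> \<le> (\<Sum>a\<in>P. card (fib a))"
      by (rule card_UN_le) simp
    also have "\<dots> \<le> (\<Sum>a\<in>P. 1)"
      using fib1 by (intro sum_mono) auto
    finally have "card (proj_line - Q) \<le> 5 - r"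
      using P(2) by simp
    moreover have "card (proj_line - Q) = CARD('a) + 1 - card Q"
      using card_proj_line[where 'a = 'a] by (subst card_Diff_subset) (auto simp: Q_def)
    ultimately show ?thesis
      using card_ge_7 r by auto
  qed
  obtain v' where fr': "frame (r - e) v' (vec.span (v' ` {..r - e}))" and v': "curve_vec f g = nvec (r - e) v'"
    by (rule curve_vec_frame[OF pr re])
  define U' where "U' = vec.span (v' ` {..r - e})"
  have frU': "frame (r - e) v' U'"
    using fr' by (simp add: U'_def)
  have muU': "curve_vec f g p \<in> U'" for p
    unfolding v' by (rule nvec_in_frame[OF frU'])
  have mu0: "curve_vec f g a \<noteq> 0" if "a \<in> proj_line" for a
    using curve_vec_nonzero[OF that] prim_no_common_root[OF pr proj_line_nonzero[OF that]] by blast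
  have "e = 0"
  proof (rule ccontr)
    assume e0: "e \<noteq> 0"
    define Z where "Z = roots d"
    have Z: "card Z \<le> e" "Z \<subseteq> proj_line"
      using card_roots_less[OF d d0] by (auto simp: Z_def roots_def)
    \<comment> \<open>One root of d is set aside, so that at most \<open>e - 1\<close> further
      vectors are needed for the other generators and the rank below stays at r instead of
      \<open>r + 1\<close>. If d has no root, z0 is arbitrary.\<close>
    obtain z0 where z0: "z0 \<in> proj_line" "Z \<noteq> {} \<Longrightarrow> z0 \<in> Z"
    proof (cases "Z = {}")
      case True
      then show ?thesis
        using that[of "vector [0, 1]"] by (simp add: proj_line_def)
    next
      case False
      then show ?thesis
        using that Z(2) by blast
    qed
    have cZ: "card (Z - {z0}) \<le> e - 1"
      using z0(2) Z(1) by (cases "Z = {}") (auto simp: card_Diff_singleton)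
    have "\<forall>a\<in>proj_line. \<exists>y. gen a \<subseteq> vec.span {curve_vec f g a, y}"
      using gen_complement curve_vec_in_gen mu0 by metis
    then obtain y where y: "\<And>a. a \<in> proj_line \<Longrightarrow> gen a \<subseteq> vec.span {curve_vec f g a, y a}"
      by (metis bchoice)
    \<comment> \<open>The span of the curve of dimension \<open>r - e\<close>, enlarged by one
      vector for each remaining root of d, contains all generators at these roots. Its rank is at
      most \<open>(r - e + 1) + (e - 1) = r\<close>.\<close>
    define X where "X = v' ` {..r - e} \<union> y ` (Z - {z0})"
    define X' where "X' = vec.span X"
    have "card X \<le> card (v' ` {..r - e}) + card (y ` (Z - {z0}))"
      unfolding X_def by (rule card_Un_le)
    also have "\<dots> \<le> Suc (r - e) + (e - 1)"
      using card_image_le[of "{..r - e}" v'] card_image_le[of "Z - {z0}" y] cZ by simp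
    also have "\<dots> = r"
      using e0 e r by simp
    finally have dX': "vec.dim X' \<le> r"
      unfolding X'_def vec.dim_span using vec.dim_le_card'[of X] by (simp add: X_def)
    have U'X': "U' \<subseteq> X'"
      unfolding U'_def X'_def X_def by (intro vec.span_mono) auto
    have "Q \<subseteq> {p \<in> proj_line. nvec r v p \<in> X'} \<union> fib z0"
    proof
      fix p assume "p \<in> Q"
      then have p: "p \<in> proj_line" "\<pi> p \<notin> P"
        by (auto simp: Q_def)
      show "p \<in> {p \<in> proj_line. nvec r v p \<in> X'} \<union> fib z0"
      proof (cases "d (\<pi> p) = 0")
        case False
        then obtain k where "m p = k *s curve_vec f g (\<pi> p)"
          using key[OF p] by blast
        then have "m p \<in> U'"
          using muU' subspace_frame[OF frU'] by (simp add: vec.subspace_scale)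
        then show ?thesis
          using p(1) U'X' by (auto simp: m_def)
      next
        case True
        then have \<pi>Z: "\<pi> p \<in> Z"
          using \<pi>(1)[OF p(1)] by (simp add: Z_def roots_def)
        show ?thesis
        proof (cases "\<pi> p = z0")
          case True
          then show ?thesis
            using p(1) \<pi>(2)[OF p(1)] by (simp add: fib_def)
        next
          case False
          then have "y (\<pi> p) \<in> X'"
            using \<pi>Z unfolding X'_def X_def by (intro vec.span_base) auto
          then have "vec.span {curve_vec f g (\<pi> p), y (\<pi> p)} \<subseteq> X'"
            using muU' U'X' by (intro vec.span_minimal) (auto simp: X'_def)
          then have "m p \<in> X'"
            using y[OF \<pi>(1)[OF p(1)]] \<pi>(2)[OF p(1)] by blast
          then show ?thesis
            using p(1) by (simp add: m_def)
        qed
      qed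
    qed
    then have "card Q \<le> card ({p \<in> proj_line. nvec r v p \<in> X'} \<union> fib z0)"
      by (intro card_mono) auto
    also have "\<dots> \<le> card {p \<in> proj_line. nvec r v p \<in> X'} + card (fib z0)"
      by (rule card_Un_le)
    also have "\<dots> \<le> r + 2"
      using nrc_card_in_subspace[OF frU dX'] dX' fib2[OF z0(1)] by simp
    finally show False
      using cardQ by simp
  qed
  then have prim: "prim r f g"
    using pr by simp
  obtain c where c: "d = (\<lambda>p. c)"
    using d \<open>e = 0\<close> by (auto elim: bform_1E)
  have c0: "c \<noteq> 0"
    using d0 c by auto
  have "Q \<subseteq> {p \<in> proj_line. nvec r v p \<in> U'}"
  proof
    fix p assume "p \<in> Q"
    then have p: "p \<in> proj_line" "\<pi> p \<notin> P"
      by (auto simp: Q_def)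
    then obtain k where "m p = k *s curve_vec f g (\<pi> p)"
      using key[OF p] c c0 by auto
    then have "m p \<in> U'"
      using muU' subspace_frame[OF frU'] by (simp add: vec.subspace_scale)
    then show "p \<in> {p \<in> proj_line. nvec r v p \<in> U'}"
      using p(1) by (simp add: m_def)
  qed
  then have "card Q \<le> card {p \<in> proj_line. nvec r v p \<in> U'}"
    by (intro card_mono) auto
  then have "U \<subseteq> U'"
    using cardQ by (intro nrc_contained[OF frU subspace_frame[OF frU']]) simp
  then have UU': "U = U'"
    using dim_frame[OF frU] dim_frame[OF frU'] \<open>e = 0\<close>
    by (intro vec.subspace_dim_equal subU subspace_frame[OF frU']) auto
  have "N \<subseteq> curve f g"
  proof
    fix X assume "X \<in> N"
    then obtain p where p: "p \<in> proj_line" "X = ppoint (m p)"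
      by (auto simp: Nv m_def)
    have "\<exists>k. m p = k *s curve_vec f g (\<pi> p)"
    proof (cases "\<pi> p \<in> P")
      case True
      \<comment> \<open>On a chosen generator \<open>key\<close> does not apply. There both vectors
        lie in the intersection of the generator with the common span, which has rank at most
        1.\<close>
      show ?thesis
        by (rule dim_le_1_multiple[OF dimP[OF True]])
          (use curve_vec_in_gen[of f g "\<pi> p"] muU' UU' \<pi>[OF p(1)] mU mu0 in auto)
    next
      case False
      then show ?thesis
        using key[OF p(1)] c c0 by auto
    qed
    then obtain k where k: "m p = k *s curve_vec f g (\<pi> p)" by blast
    then have "k \<noteq> 0"
      using m0[OF p(1)] by auto
    then have "X = ppoint (curve_vec f g (\<pi> p))"
      using ppoint_eqI[OF _ k] p(2) by simp
    then show "X \<in> curve f g"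
      using \<pi>(1)[OF p(1)] by (simp add: curve_def)
  qed
  moreover have "card N = card (curve f g)"
    using card_nrc[OF N(1)] card_nrc[OF nrc_curve[OF prim r]] r by simp
  ultimately have "N = curve f g"
    by (intro card_subset_eq) (auto simp: curve_def)
  then show ?thesis
    using that prim by blast
qed

lemma card_ge_5: "5 \<le> CARD('a)"
  using card_ge_7 by simp

text \<open>If two basis vectors x and y of the line lay on different generators, then
  \<open>x + y\<close> would lie on a third one, giving a relation between three distinct
  generators. So the whole line lies in one generator.\<close>

lemma lines_in_surface: "{l. line l \<and> l \<subseteq> surface} = gens"
proof (intro equalityI subsetI)
  fix l assume "l \<in> gens"
  then obtain p where "p \<in> proj_line" "l = points (gen p)"
    by (auto simp: gens_def)
  then show "l \<in> {l. line l \<and> l \<subseteq> surface}"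
    using dim_gen[of p] subspace_gen[of p] unfolding line_def rspace_def surface_def by auto
next
  fix l assume "l \<in> {l. line l \<and> l \<subseteq> surface}"
  then obtain U where U: "vec.subspace U" "vec.dim U = 2" "l = points U" and lS: "points U \<subseteq> surface"
    by (auto simp: line_def rspace_def)
  have inL: "\<exists>p\<in>proj_line. x \<in> gen p" if "x \<in> U" "x \<noteq> 0" for x
    using ppoint_in_surface_iff[OF that(2)] lS ppoint_in_points_iff[OF U(1) that(2)] that(1) by blast
  obtain B where B: "B \<subseteq> U" "vec.independent B" "U \<subseteq> vec.span B" "card B = vec.dim U"
    by (rule vec.basis_exists)
  obtain x y where xy: "B = {x, y}" "x \<noteq> y"
    using B(4) U(2) by (auto simp: card_2_iff)
  have nz: "x \<noteq> 0" "y \<noteq> 0"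
    using B(2) vec.dependent_zero[of B] xy by auto
  have sum_nz: "x + y \<noteq> 0"
  proof
    assume "x + y = 0"
    then have "y = (- 1) *s x"
      by (simp add: eq_neg_iff_add_eq_0 add.commute)
    moreover have "x \<in> vec.span (B - {y})"
      using xy by (intro vec.span_base) auto
    ultimately have "y \<in> vec.span (B - {y})"
      using vec.span_scale by metis
    then show False
      using B(2) xy unfolding vec.dependent_def by blast
  qed
  have xyU: "x \<in> U" "y \<in> U" "x + y \<in> U"
    using B(1) xy U(1) by (auto intro: vec.subspace_add)
  obtain p1 where p1: "p1 \<in> proj_line" "x \<in> gen p1"
    using inL[OF xyU(1) nz(1)] by blast
  obtain p2 where p2: "p2 \<in> proj_line" "y \<in> gen p2"
    using inL[OF xyU(2) nz(2)] by blast
  obtain p3 where p3: "p3 \<in> proj_line" "x + y \<in> gen p3"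
    using inL[OF xyU(3) sum_nz] by blast
  have "p1 = p2"
  proof (rule ccontr)
    assume p12: "p1 \<noteq> p2"
    have p31: "p3 \<noteq> p1"
    proof
      assume "p3 = p1"
      then have "y \<in> gen p1"
        using vec.subspace_diff[OF subspace_gen, of "x + y" p1 x] p1 p3 by simp
      then show False
        using gen_disjoint[OF p1(1) p2(1) p12 _ p2(2)] nz by blast
    qed
    have p32: "p3 \<noteq> p2"
    proof
      assume "p3 = p2"
      then have "x \<in> gen p2"
        using vec.subspace_diff[OF subspace_gen, of "x + y" p2 y] p2 p3 by simp
      then show False
        using gen_disjoint[OF p1(1) p2(1) p12 p1(2)] nz by blast
    qed
    obtain a1 b1 where x: "x = a1 *s c2 p1 + b1 *s c3 p1"
      using p1(2) unfolding gen_iff by blast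
    obtain a2 b2 where y: "y = a2 *s c2 p2 + b2 *s c3 p2"
      using p2(2) unfolding gen_iff by blast
    obtain a3 b3 where xy: "x + y = a3 *s c2 p3 + b3 *s c3 p3"
      using p3(2) unfolding gen_iff by blast
    define A where "A = (\<lambda>p. if p = p1 then a1 else if p = p2 then a2 else - a3)"
    define B where "B = (\<lambda>p. if p = p1 then b1 else if p = p2 then b2 else - b3)"
    have "(\<Sum>p\<in>{p1, p2, p3}. A p *s c2 p + B p *s c3 p) =
      (a1 *s c2 p1 + b1 *s c3 p1) + (a2 *s c2 p2 + b2 *s c3 p2) - (a3 *s c2 p3 + b3 *s c3 p3)"
      using p12 p31 p32 by (simp add: A_def B_def)
    also have "\<dots> = 0"
      unfolding x[symmetric] y[symmetric] xy[symmetric] by simp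
    finally have "A p1 = 0 \<and> B p1 = 0"
      by (rule generators_independent[rotated 2]) (use p1 p2 p3 in \<open>auto simp: card_insert_if\<close>)
    then show False
      using x nz by (simp add: A_def B_def)
  qed
  then have "vec.span B \<subseteq> gen p1"
    using p1 p2 xy by (intro vec.span_minimal subspace_gen) auto
  then have "U \<subseteq> gen p1"
    using B(3) by blast
  then have "U = gen p1"
    using U dim_gen[OF p1(1)] by (intro vec.subspace_dim_equal subspace_gen) auto
  then show "l \<in> gens"
    using U(3) p1(1) by (auto simp: gens_def)
qed

lemma card_gens: "card gens = CARD('a) + 1"
  unfolding gens_def using inj_generators card_proj_line[where 'a = 'a] by (simp add: card_image)

lemma curve_vec_cmult: "curve_vec (\<lambda>p. k * f p) (\<lambda>p. k * g p) p = k *s curve_vec f g p"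
  by (simp add: curve_vec_def vec.scale_right_diff_distrib)

lemma curve_cmult: "k \<noteq> 0 \<Longrightarrow> curve (\<lambda>p. k * f p) (\<lambda>p. k * g p) = curve f g"
  unfolding curve_def curve_vec_cmult using ppoint_eqI[OF _ refl] by (intro image_cong) auto

text \<open>Distinct generators are disjoint, so equal curves have the same point on each generator.
  This makes the pairs proportional at every parameter, and the degrees are small enough to conclude
  that the forms are proportional.\<close>

lemma curve_eqD:
  assumes p: "prim r f g" "r \<in> {2..5}" and p': "prim r f' g'" and eq: "curve f' g' = curve f g"
  shows "\<exists>k. k \<noteq> 0 \<and> f' = (\<lambda>p. k * f p) \<and> g' = (\<lambda>p. k * g p)"
proof -
  have loc: "f' t * g t = g' t * f t" if t: "t \<in> proj_line" for t
  proof -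
    have nz: "curve_vec f' g' t \<noteq> 0"
      using curve_vec_nonzero[OF t] prim_no_common_root[OF p' proj_line_nonzero[OF t]] by blast
    have "ppoint (curve_vec f' g' t) \<in> curve f g"
      using t eq by (auto simp: curve_def)
    then obtain s where s: "s \<in> proj_line" "ppoint (curve_vec f g s) = ppoint (curve_vec f' g' t)"
      by (auto simp: curve_def)
    then obtain k where k: "curve_vec f' g' t = k *s curve_vec f g s"
      using ppoint_eqD by blast
    then have "curve_vec f' g' t \<in> gen s"
      using curve_vec_in_gen subspace_gen by (simp add: vec.subspace_scale)
    then have "s = t"
      using gen_disjoint[OF t s(1)] curve_vec_in_gen nz by blast
    moreover have "(g' t - k * g t) *s c2 t + (k * f t - f' t) *s c3 t = curve_vec f' g' t - k *s curve_vec f g t"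
      by (simp add: curve_vec_def vec.scale_left_diff_distrib vec.scale_right_diff_distrib)
    ultimately have "(g' t - k * g t) *s c2 t + (k * f t - f' t) *s c3 t = 0"
      using k by simp
    from generator_coeffs_unique[OF t this] have "g' t = k * g t" "f' t = k * f t"
      by simp_all
    then show ?thesis
      by simp
  qed
  have "(\<lambda>t. f' t * g t) \<in> bform (r + r - 4)" "(\<lambda>t. g' t * f t) \<in> bform (r + r - 4)"
    by (rule bform_mult[OF primD(1)[OF p'] primD(2)[OF p(1)]]
      bform_mult[OF primD(2)[OF p'] primD(1)[OF p(1)]]; use p in auto)+
  then have "(\<lambda>t. f' t * g t) = (\<lambda>t. g' t * f t)"
    by (rule bform_eqI) (use p card_ge_7 loc in auto)
  then show ?thesis
    using prim_unique[OF card_ge_5 p p' p(2)] by (auto simp: fun_eq_iff)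
qed

text \<open>A curve determines its primitive pair up to a nonzero scalar, so the map from pairs to
  curves is \<open>q - 1\<close> to one.\<close>

lemma card_nrcs:
  assumes r: "r \<in> {2..5}"
  shows "card (primset r :: (('a ^ 2 \<Rightarrow> 'a) \<times> ('a ^ 2 \<Rightarrow> 'a)) set) = (CARD('a) - 1) * card {N. nrc r N \<and> N \<subseteq> surface}"
proof (rule card_eq_mult_fibres[where \<phi> = "\<lambda>(f, g). curve f g"])
  show "(\<lambda>(f, g). curve f g) ` primset r = {N. nrc r N \<and> N \<subseteq> surface}"
  proof (intro equalityI subsetI)
    fix N assume "N \<in> {N. nrc r N \<and> N \<subseteq> surface}"
    then obtain f g where "prim r f g" "N = curve f g"
      using nrc_in_surface[OF _ _ r] by blast
    then show "N \<in> (\<lambda>(f, g). curve f g) ` primset r"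
      by (force simp: primset_def)
  next
    fix N assume "N \<in> (\<lambda>(f, g). curve f g) ` primset r"
    then obtain f g where "prim r f g" "N = curve f g"
      by (auto simp: primset_def)
    then show "N \<in> {N. nrc r N \<and> N \<subseteq> surface}"
      using nrc_curve[OF _ r] curve_subset_surface by blast
  qed
  fix x :: "('a ^ 2 \<Rightarrow> 'a) \<times> ('a ^ 2 \<Rightarrow> 'a)" assume "x \<in> primset r"
  then obtain f g where x: "x = (f, g)" and p: "prim r f g"
    by (auto simp: primset_def)
  define \<psi> where "\<psi> = (\<lambda>k. (\<lambda>p. k * f p, \<lambda>p. k * g p))"
  have "{y \<in> primset r. (case y of (f, g) \<Rightarrow> curve f g) = (case x of (f, g) \<Rightarrow> curve f g)} = \<psi> ` (UNIV - {0})"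
  proof (intro equalityI subsetI)
    fix y assume "y \<in> {y \<in> primset r. (case y of (f, g) \<Rightarrow> curve f g) = (case x of (f, g) \<Rightarrow> curve f g)}"
    then obtain f' g' where y: "y = (f', g')" "prim r f' g'" "curve f' g' = curve f g"
      using x by (auto simp: primset_def)
    then obtain k where "k \<noteq> 0" "f' = (\<lambda>p. k * f p)" "g' = (\<lambda>p. k * g p)"
      using curve_eqD[OF p r] by blast
    then show "y \<in> \<psi> ` (UNIV - {0})"
      using y(1) by (auto simp: \<psi>_def)
  next
    fix y assume "y \<in> \<psi> ` (UNIV - {0})"
    then obtain k where "k \<noteq> 0" "y = (\<lambda>p. k * f p, \<lambda>p. k * g p)"
      by (auto simp: \<psi>_def)
    then show "y \<in> {y \<in> primset r. (case y of (f, g) \<Rightarrow> curve f g) = (case x of (f, g) \<Rightarrow> curve f g)}"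
      using x curve_cmult prim_cmult[OF p] by (auto simp: primset_def)
  qed
  moreover have "inj_on \<psi> (UNIV - {0})"
    using prim_nonzero[OF p] by (auto simp: inj_on_def \<psi>_def fun_eq_iff)
  ultimately show "card {y \<in> primset r. (case y of (f, g) \<Rightarrow> curve f g) = (case x of (f, g) \<Rightarrow> curve f g)} = CARD('a) - 1"
    by (simp add: card_image card_Diff_singleton)
qed simp

definition conic :: "('a ^ 7) set set" where
  "conic = (\<lambda>p. ppoint (c2 p)) ` proj_line"

text \<open>For \<open>r = 2\<close> the form f has degree -1 and is zero, while g is a nonzero
  constant, so every such pair gives the directrix.\<close>

lemma curve_conic:
  assumes "prim 2 f g"
  shows "curve f g = conic"
proof -
  have f: "f = (\<lambda>p. 0)"
    using primD(1)[OF assms] by (simp add: bform_0)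
  obtain k where k: "g = (\<lambda>p. k)"
    using primD(2)[OF assms] by (auto elim: bform_1E)
  have "k \<noteq> 0"
    using prim_nonzero[OF assms] f k by auto
  then have "ppoint (curve_vec f g p) = ppoint (c2 p)" for p
    by (rule ppoint_eqI) (simp add: curve_vec_def f k)
  then show ?thesis
    by (simp add: curve_def conic_def)
qed

lemma nrc_conic: "nrc 2 conic"
proof -
  have "(\<lambda>p. 0, \<lambda>p. 1) \<in> (primset 2 :: (('a ^ 2 \<Rightarrow> 'a) \<times> ('a ^ 2 \<Rightarrow> 'a)) set)"
    unfolding primset_2 using bform_const[of 1] by (auto simp: fun_eq_iff)
  then show ?thesis
    using nrc_curve[of 2] curve_conic by (auto simp: primset_def)
qed

section \<open>Classification and counting of the 5-spaces\<close>

lemma hyperplane_factor: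
  assumes "w \<noteq> 0"
  obtains r d f g where "r \<in> {2..5}" "d \<in> bform (6 - r)" "d \<noteq> (\<lambda>p. 0)" "prim r f g"
    "\<And>p. dotp w (c2 p) = d p * f p" "\<And>p. dotp w (c3 p) = d p * g p"
proof -
  have F: "(\<lambda>p. dotp w (c2 p)) \<in> bform (5 - 2)" and G: "(\<lambda>p. dotp w (c3 p)) \<in> bform (5 - 1)"
    using c2_bform c3_bform by auto
  have nz: "(\<lambda>p. dotp w (c2 p)) \<noteq> (\<lambda>p. 0) \<or> (\<lambda>p. dotp w (c3 p)) \<noteq> (\<lambda>p. 0)"
    using nondegenerate[of w] assms by (auto simp: fun_eq_iff)
  obtain e d f g where e: "e \<le> 5 - 2" "d \<in> bform (Suc e)" "prim (5 - e) f g"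
    "(\<lambda>p. dotp w (c2 p)) = (\<lambda>p. d p * f p)" "(\<lambda>p. dotp w (c3 p)) = (\<lambda>p. d p * g p)"
    by (rule prim_factor[OF F G nz]) auto
  have "6 - (5 - e) = Suc e" "5 - e \<in> {2..5}"
    using e(1) by auto
  moreover have "d \<noteq> (\<lambda>p. 0)"
    using nz e(4,5) by auto
  ultimately show ?thesis
    using e by (intro that[of "5 - e" d f g]) (auto simp: fun_eq_iff)
qed

context
  fixes r d f g w
  assumes r: "r \<in> {2..5}" and d: "d \<in> bform (6 - r)" "d \<noteq> (\<lambda>p. 0)" and p: "prim r f g"
    and w: "\<And>p. dotp w (c2 p) = d p * f p" "\<And>p. dotp w (c3 p) = d p * g p"
begin

text \<open>N may share points with the generators in the section, so it is not identified, only its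
  dimension is. The points of the known curve outside these generators must lie on N; there are at
  least \<open>r + 3\<close> of them, more than curves of different dimensions can share.\<close>

lemma section_degree_unique:
  assumes N: "nrc s N" and s: "s \<in> {2..5}"
    and eq: "surface \<inter> points (hyp w) = N \<union> \<Union> (generators_in gens (hyp w))"
  shows "s = r"
proof -
  define Y where "Y = (\<lambda>p. ppoint (curve_vec f g p)) ` (proj_line - roots d)"
  have nrcM: "nrc r (curve f g)"
    by (rule nrc_curve[OF p r])
  obtain v where fr: "frame r v (vec.span (v ` {..r}))" and v: "curve_vec f g = nvec r v"
    by (rule curve_vec_frame[OF p r])
  have "inj_on (\<lambda>p. ppoint (curve_vec f g p)) proj_line"
    unfolding v using inj_nrc_points[OF fr] r by simp
  then have "card Y = card (proj_line - roots d)"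
    unfolding Y_def by (intro card_image) (auto intro: inj_on_subset)
  also have "\<dots> = CARD('a) + 1 - card (roots d)"
    using card_proj_line[where 'a = 'a] by (subst card_Diff_subset) (auto simp: roots_def)
  finally have cY: "r + 3 \<le> card Y"
    using card_roots_less[OF d] card_ge_7 r by auto
  have YM: "Y \<subseteq> curve f g"
    by (auto simp: Y_def curve_def)
  have YN: "Y \<subseteq> N"
  proof
    fix X assume "X \<in> Y"
    then obtain t where t: "t \<in> proj_line" "t \<notin> roots d" "X = ppoint (curve_vec f g t)"
      by (auto simp: Y_def)
    have nz: "curve_vec f g t \<noteq> 0"
      using curve_vec_nonzero[OF t(1)] prim_no_common_root[OF p proj_line_nonzero[OF t(1)]] by blast
    have "X \<notin> \<Union> (generators_in gens (hyp w))"
    proof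
      assume "X \<in> \<Union> (generators_in gens (hyp w))"
      then obtain t' where t': "t' \<in> roots d" "X \<in> points (gen t')"
        unfolding generators_in_hyp(1)[OF p w] by blast
      then have "curve_vec f g t \<in> gen t'"
        using t(3) ppoint_in_points_iff[OF subspace_gen nz] by simp
      moreover have "t' \<in> proj_line" "t' \<noteq> t"
        using t t' by (auto simp: roots_def)
      ultimately show False
        using gen_disjoint[of t' t] t(1) curve_vec_in_gen nz by blast
    qed
    moreover have "X \<in> curve f g"
      using t by (auto simp: curve_def)
    ultimately show "X \<in> N"
      using eq surface_inter_hyp[OF p w] by blast
  qed
  show ?thesis
  proof (rule ccontr)
    assume "s \<noteq> r"
    then consider "s < r" | "r < s" by linarith
    then show False
    proof cases
      case 1
      then show False
        using nrc_common_points[OF nrcM N 1 YM YN] cY by simp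
    next
      case 2
      then show False
        using nrc_common_points[OF N nrcM 2 YN YM] cY by simp
    qed
  qed
qed

lemma meets_in_Nrc_iff:
  assumes "s \<in> {3..5}"
  shows "meets_in surface conic gens (hyp w) (Nrc_Gens s i) \<longleftrightarrow> s = r \<and> i = card (roots d)"
proof
  assume m: "meets_in surface conic gens (hyp w) (Nrc_Gens s i)"
  then show "s = r \<and> i = card (roots d)"
    using section_degree_unique assms generators_in_hyp(2)[OF p w] by auto
next
  assume "s = r \<and> i = card (roots d)"
  then show "meets_in surface conic gens (hyp w) (Nrc_Gens s i)"
    using surface_inter_hyp[OF p w] generators_in_hyp(2)[OF p w] nrc_curve[OF p r] by auto
qed

lemma meets_in_Conic_iff:
  "meets_in surface conic gens (hyp w) (Conic_Gens i) \<longleftrightarrow> r = 2 \<and> i = card (roots d)"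
proof
  assume m: "meets_in surface conic gens (hyp w) (Conic_Gens i)"
  then show "r = 2 \<and> i = card (roots d)"
    using section_degree_unique[OF nrc_conic] generators_in_hyp(2)[OF p w] by auto
next
  assume r2: "r = 2 \<and> i = card (roots d)"
  then have "curve f g = conic"
    using curve_conic p by blast
  then show "meets_in surface conic gens (hyp w) (Conic_Gens i)"
    using surface_inter_hyp[OF p w] generators_in_hyp(2)[OF p w] r2 by auto
qed

end

text \<open>For \<open>r = 2\<close> the curve is the directrix, which has its own constructor. This
  notation lets one statement treat all r.\<close>

definition conf :: "nat \<Rightarrow> nat \<Rightarrow> configuration" where
  "conf r i = (if r = 2 then Conic_Gens i else Nrc_Gens r i)"

lemma meets_in_conf_iff:
  assumes "r \<in> {2..5}" "d \<in> bform (6 - r)" "d \<noteq> (\<lambda>p. 0)" "prim r f g"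
    "\<And>p. dotp w (c2 p) = d p * f p" "\<And>p. dotp w (c3 p) = d p * g p" "s \<in> {2..5}"
  shows "meets_in surface conic gens (hyp w) (conf s i) \<longleftrightarrow> s = r \<and> i = card (roots d)"
  using meets_in_Nrc_iff[OF assms(1-6), of s i] meets_in_Conic_iff[OF assms(1-6), of i] assms(7)
  unfolding conf_def by auto

lemma rspace_5_iff: "rspace 5 T \<longleftrightarrow> (\<exists>w. w \<noteq> 0 \<and> T = hyp w)" for T :: "('a ^ 7) set"
proof
  assume T: "rspace 5 T"
  then have "vec.subspace T" "vec.dim T + 1 = CARD(7)"
    by (auto simp: rspace_def)
  then obtain w where "w \<noteq> 0" "T = hyp w"
    by (rule hyperplane_obtain)
  then show "\<exists>w. w \<noteq> 0 \<and> T = hyp w" by blast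
next
  assume "\<exists>w. w \<noteq> 0 \<and> T = hyp w"
  then show "rspace 5 T"
    using subspace_hyp dim_hyp by (fastforce simp: rspace_def)
qed

text \<open>A section has type \<open>conf r n\<close>, where n is the number of roots of d, of
  degree \<open>5 - r\<close>. For \<open>r = 4\<close> the form d is linear and has exactly one
  root, which is why a 4-dim nrc never occurs without a generator; for r equal to 2 or 3 every n up
  to the degree is on the list.\<close>

lemma configuration_unique:
  assumes "rspace 5 T"
  shows "\<exists>!c. c \<in> {Nrc_Gens 5 0, Nrc_Gens 4 1, Nrc_Gens 3 0, Nrc_Gens 3 1, Nrc_Gens 3 2,
      Conic_Gens 0, Conic_Gens 1, Conic_Gens 2, Conic_Gens 3} \<and> meets_in surface conic gens T c"
    (is "\<exists>!c. c \<in> ?C \<and> _")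
proof -
  obtain w where w0: "w \<noteq> 0" and T: "T = hyp w"
    using assms rspace_5_iff by blast
  obtain r d f g where r: "r \<in> {2..5}" and d: "d \<in> bform (6 - r)" "d \<noteq> (\<lambda>p. 0)" and p: "prim r f g"
    and w: "\<And>p. dotp w (c2 p) = d p * f p" "\<And>p. dotp w (c3 p) = d p * g p"
    by (rule hyperplane_factor[OF w0]) blast
  note iff = meets_in_conf_iff[OF r d p w]
  have lt: "card (roots d) < 6 - r"
    by (rule card_roots_less[OF d])
  have lin: "card (roots d) = 1" if "r = 4"
    using card_roots_linear[of d] d that by simp
  have "r = 2 \<or> r = 3 \<or> r = 4 \<or> r = 5"
    using r by auto
  moreover define n where "n = card (roots d)"
  ultimately have "r = 5 \<and> n = 0 \<or> r = 4 \<and> n = 1 \<or> r = 3 \<and> n \<in> {0, 1, 2} \<or> r = 2 \<and> n \<in> {0, 1, 2, 3}"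
    using lt lin unfolding n_def[symmetric] by (elim disjE) auto
  then have inC: "conf r n \<in> ?C"
    by (auto simp: conf_def)
  have uniq: "c = conf r n" if c: "c \<in> ?C" "meets_in surface conic gens T c" for c
  proof -
    have "\<exists>s\<in>{2..5}. \<exists>i. c = conf s i"
    proof (cases c)
      case (Nrc_Gens s i)
      then show ?thesis using c(1) by (intro bexI[of _ s]) (auto simp: conf_def)
    next
      case (Conic_Gens i)
      then show ?thesis by (intro bexI[of _ 2]) (auto simp: conf_def)
    qed
    then show ?thesis
      using c(2) iff unfolding T n_def by auto
  qed
  have "meets_in surface conic gens T (conf r n)"
    unfolding T n_def using iff[OF r] by blast
  with inC have "conf r n \<in> ?C \<and> meets_in surface conic gens T (conf r n)" ..
  then show ?thesis
    by (rule ex1I) (erule conjE, rule uniq)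
qed

definition functional :: "('a ^ 2 \<Rightarrow> 'a) \<Rightarrow> ('a ^ 2 \<Rightarrow> 'a) \<Rightarrow> 'a ^ 7" where
  "functional f g = (SOME w. (\<forall>p. dotp w (c2 p) = f p) \<and> (\<forall>p. dotp w (c3 p) = g p))"

lemma dotp_functional:
  assumes "f \<in> bform 3" "g \<in> bform 4"
  shows "dotp (functional f g) (c2 p) = f p" "dotp (functional f g) (c3 p) = g p"
proof -
  have "\<exists>w. (\<forall>p. dotp w (c2 p) = f p) \<and> (\<forall>p. dotp w (c3 p) = g p)"
    using functional_exists[OF assms] by metis
  then have "(\<forall>p. dotp (functional f g) (c2 p) = f p) \<and> (\<forall>p. dotp (functional f g) (c3 p) = g p)"
    unfolding functional_def by (rule someI_ex)
  then show "dotp (functional f g) (c2 p) = f p" "dotp (functional f g) (c3 p) = g p"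
    by auto
qed

lemma functional_eqI:
  assumes "f \<in> bform 3" "g \<in> bform 4" "\<And>p. dotp w (c2 p) = f p" "\<And>p. dotp w (c3 p) = g p"
  shows "functional f g = w"
proof -
  have "functional f g - w = 0"
    by (rule nondegenerate) (simp_all add: dotp_left_diff dotp_functional[OF assms(1,2)] assms(3,4))
  then show ?thesis by simp
qed

text \<open>A hyperplane fixes the pair \<open>(d f, d g)\<close> up to a scalar. Uniqueness of the
  decomposition then leaves independent scalars for d and for (f, g), so every fibre has
  \<open>(q - 1)^2\<close> elements.\<close>

lemma card_5spaces:
  assumes r: "r \<in> {2..5}"
  shows "card (rooted (6 - r) i \<times> primset r :: (('a ^ 2 \<Rightarrow> 'a) \<times> ('a ^ 2 \<Rightarrow> 'a) \<times> ('a ^ 2 \<Rightarrow> 'a)) set)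
    = (CARD('a) - 1)\<^sup>2 * num_5spaces surface conic gens (conf r i)"
  unfolding num_5spaces_def
proof (rule card_eq_mult_fibres)
  define A where "A = (rooted (6 - r) i \<times> primset r :: (('a ^ 2 \<Rightarrow> 'a) \<times> ('a ^ 2 \<Rightarrow> 'a) \<times> ('a ^ 2 \<Rightarrow> 'a)) set)"
  define \<phi> where "\<phi> = (\<lambda>(d, f, g). hyp (functional (\<lambda>p. d p * f p) (\<lambda>p. d p * g p)))"
  have A_iff: "(d, f, g) \<in> A \<longleftrightarrow> d \<in> bform (6 - r) \<and> d \<noteq> (\<lambda>p. 0) \<and> card (roots d) = i \<and> prim r f g" for d f g
    by (auto simp: A_def rooted_def primset_def)
  have prods: "(\<lambda>p. d p * f p) \<in> bform 3" "(\<lambda>p. d p * g p) \<in> bform 4" if "(d, f, g) \<in> A" for d f g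
  proof -
    have d: "d \<in> bform (6 - r)" and p: "prim r f g"
      using that by (auto simp: A_iff)
    show "(\<lambda>p. d p * f p) \<in> bform 3" "(\<lambda>p. d p * g p) \<in> bform 4"
      by (rule bform_mult[OF d primD(1)[OF p]] bform_mult[OF d primD(2)[OF p]]; use r in auto)+
  qed
  have nonzero: "functional (\<lambda>p. d p * f p) (\<lambda>p. d p * g p) \<noteq> 0" if a: "(d, f, g) \<in> A" for d f g
  proof
    assume "functional (\<lambda>p. d p * f p) (\<lambda>p. d p * g p) = 0"
    then have z: "d p * f p = 0" "d p * g p = 0" for p
      using dotp_functional[OF prods[OF a], of p] by (simp_all add: dotp_def)
    have d: "d \<in> bform (6 - r)" "d \<noteq> (\<lambda>p. 0)" and p: "prim r f g"
      using a by (auto simp: A_iff)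
    have "f = (\<lambda>p. 0)" "g = (\<lambda>p. 0)"
      by (rule bform_mult_eq_0[OF d(1) primD(1)[OF p] _ _ d(2)] bform_mult_eq_0[OF d(1) primD(2)[OF p] _ _ d(2)];
          use z r card_ge_5 in auto)+
    then show False
      using prim_nonzero[OF p] by simp
  qed
  show "\<phi> ` A = {T. rspace 5 T \<and> meets_in surface conic gens T (conf r i)}"
  proof (intro equalityI subsetI)
    fix T assume "T \<in> \<phi> ` A"
    then obtain d f g where a: "(d, f, g) \<in> A" and T: "T = hyp (functional (\<lambda>p. d p * f p) (\<lambda>p. d p * g p))"
      by (auto simp: \<phi>_def)
    have d: "d \<in> bform (6 - r)" "d \<noteq> (\<lambda>p. 0)" and p: "prim r f g" and i: "card (roots d) = i"
      using a by (auto simp: A_iff)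
    show "T \<in> {T. rspace 5 T \<and> meets_in surface conic gens T (conf r i)}"
      using meets_in_conf_iff[OF r d p dotp_functional[OF prods[OF a]] r, of i] i nonzero[OF a] T
      by (auto simp: rspace_5_iff)
  next
    fix T assume "T \<in> {T. rspace 5 T \<and> meets_in surface conic gens T (conf r i)}"
    then obtain w where w0: "w \<noteq> 0" and T: "T = hyp w" and m: "meets_in surface conic gens (hyp w) (conf r i)"
      by (auto simp: rspace_5_iff)
    obtain s d f g where s: "s \<in> {2..5}" and d: "d \<in> bform (6 - s)" "d \<noteq> (\<lambda>p. 0)" and p: "prim s f g"
      and w: "\<And>p. dotp w (c2 p) = d p * f p" "\<And>p. dotp w (c3 p) = d p * g p"
      by (rule hyperplane_factor[OF w0]) blast
    have "r = s" "i = card (roots d)"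
      using m meets_in_conf_iff[OF s d p w r] by auto
    then have a: "(d, f, g) \<in> A"
      using d p by (auto simp: A_iff)
    have "functional (\<lambda>p. d p * f p) (\<lambda>p. d p * g p) = w"
      by (rule functional_eqI[OF prods[OF a] w])
    then show "T \<in> \<phi> ` A"
      using a T by (force simp: \<phi>_def)
  qed
  fix a assume "a \<in> A"
  then obtain d f g where a: "a = (d, f, g)" "(d, f, g) \<in> A"
    by (cases a) auto
  have d: "d \<in> bform (6 - r)" "d \<noteq> (\<lambda>p. 0)" and p: "prim r f g" and i: "card (roots d) = i"
    using a by (auto simp: A_iff)
  define \<psi> where "\<psi> = (\<lambda>(k, l). ((\<lambda>p. k * d p), (\<lambda>p. l * f p), (\<lambda>p. l * g p)))"
  have "{x \<in> A. \<phi> x = \<phi> a} = \<psi> ` ((UNIV - {0}) \<times> (UNIV - {0}))"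
  proof (intro equalityI subsetI)
    fix x assume "x \<in> {x \<in> A. \<phi> x = \<phi> a}"
    then obtain d' f' g' where x: "x = (d', f', g')" "(d', f', g') \<in> A"
      and eq: "hyp (functional (\<lambda>p. d' p * f' p) (\<lambda>p. d' p * g' p)) = hyp (functional (\<lambda>p. d p * f p) (\<lambda>p. d p * g p))"
      using a by (cases x) (auto simp: \<phi>_def)
    have d': "d' \<in> bform (6 - r)" "d' \<noteq> (\<lambda>p. 0)" and p': "prim r f' g'"
      using x by (auto simp: A_iff)
    obtain c where c: "functional (\<lambda>p. d' p * f' p) (\<lambda>p. d' p * g' p) = c *s functional (\<lambda>p. d p * f p) (\<lambda>p. d p * g p)"
      using hyp_eqD[OF nonzero[OF a(2)] eq] by blast
    have c0: "c \<noteq> 0"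
      using nonzero[OF x(2)] c by auto
    have e: "d' p * f' p = c * d p * f p" "d' p * g' p = c * d p * g p" for p
      using arg_cong[OF c, of "\<lambda>w. dotp w (c2 p)"] arg_cong[OF c, of "\<lambda>w. dotp w (c3 p)"]
      by (simp_all add: dotp_left_scale dotp_functional[OF prods[OF a(2)]] dotp_functional[OF prods[OF x(2)]])
    \<comment> \<open>The scalar c between the two functionals is absorbed into d, so that the two
      products agree as \<open>prim_factor_unique\<close> requires.\<close>
    have "r = r \<and> (\<exists>k. k \<noteq> 0 \<and> (\<lambda>p. c * d p) = (\<lambda>p. k * d' p) \<and> f' = (\<lambda>p. k * f p) \<and> g' = (\<lambda>p. k * g p))"
      by (rule prim_factor_unique[OF card_ge_5 p r p' r bform_cmult[OF d(1)] _ d' e])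
        (use d(2) c0 in \<open>auto simp: fun_eq_iff\<close>)
    then obtain k where k: "k \<noteq> 0" "(\<lambda>p. c * d p) = (\<lambda>p. k * d' p)" "f' = (\<lambda>p. k * f p)" "g' = (\<lambda>p. k * g p)"
      by blast
    have "d' p = c / k * d p" for p
      using fun_cong[OF k(2), of p] k(1) by (simp add: field_simps)
    then have "x = \<psi> (c / k, k)"
      using x(1) k by (simp add: \<psi>_def fun_eq_iff)
    then show "x \<in> \<psi> ` ((UNIV - {0}) \<times> (UNIV - {0}))"
      using k(1) c0 by auto
  next
    fix x assume "x \<in> \<psi> ` ((UNIV - {0}) \<times> (UNIV - {0}))"
    then obtain k l where kl: "k \<noteq> 0" "l \<noteq> 0" and x: "x = ((\<lambda>p. k * d p), (\<lambda>p. l * f p), (\<lambda>p. l * g p))"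
      by (auto simp: \<psi>_def)
    have "roots (\<lambda>p. k * d p) = roots d"
      using kl by (simp add: roots_def)
    moreover have "(\<lambda>p. k * d p) \<noteq> (\<lambda>p. 0)"
      using d(2) kl by (auto simp: fun_eq_iff)
    ultimately have xA: "x \<in> A"
      using x i bform_cmult[OF d(1)] prim_cmult[OF p kl(2)] by (auto simp: A_iff)
    have "functional (\<lambda>p. k * d p * (l * f p)) (\<lambda>p. k * d p * (l * g p)) = (k * l) *s functional (\<lambda>p. d p * f p) (\<lambda>p. d p * g p)"
      by (rule functional_eqI) (use prods xA x in \<open>auto simp: dotp_left_scale dotp_functional[OF prods[OF a(2)]]\<close>)
    then have "\<phi> x = \<phi> a"
      using x a(1) hyp_scale[of "k * l"] kl by (simp add: \<phi>_def)
    then show "x \<in> {x \<in> A. \<phi> x = \<phi> a}"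
      using xA by simp
  qed
  moreover have "inj_on \<psi> ((UNIV - {0}) \<times> (UNIV - {0}))"
    using prim_nonzero[OF p] d(2) by (auto simp: inj_on_def \<psi>_def fun_eq_iff)
  ultimately show "card {x \<in> A. \<phi> x = \<phi> a} = (CARD('a) - 1)\<^sup>2"
    by (simp add: card_image card_Diff_singleton card_cartesian_product power2_eq_square)
qed simp

end

subsection \<open>Ruled quintic surfaces\<close>

text \<open>Negating all five nonzero elements multiplies their nonzero product by
  \<open>(- 1) ^ 5\<close>, so the characteristic would be 2. Then \<open>{0, 1, a, a + 1}\<close>
  would be an additive subgroup of order 4, and together with a coset it would have 8
  elements.\<close>

lemma card_field_neq_6: "CARD('a::{field,finite}) \<noteq> 6"
proof
  assume 6: "CARD('a) = 6"
  define P where "P = (\<Prod>x\<in>UNIV - {0::'a}. x)"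
  have "P = (\<Prod>x\<in>UNIV - {0::'a}. - x)"
    unfolding P_def by (rule prod.reindex_bij_witness[where i = uminus and j = uminus]) auto
  also have "\<dots> = (\<Prod>x\<in>UNIV - {0::'a}. - 1 * x)"
    by simp
  also have "\<dots> = (- 1) ^ card (UNIV - {0::'a}) * P"
    unfolding prod.distrib prod_constant P_def ..
  also have "card (UNIV - {0::'a}) = 5"
    using 6 by (simp add: card_Diff_singleton)
  finally have "P = - P"
    by simp
  moreover have "P \<noteq> 0"
    unfolding P_def by simp
  ultimately have "P * - 1 = P * 1"
    by simp
  then have m1: "- 1 = (1 :: 'a)"
    using \<open>P \<noteq> 0\<close> by (metis mult_cancel_left)
  have "- x = x" for x :: 'a
    using arg_cong[OF m1, of "\<lambda>c. c * x"] by simp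
  then have two: "x + x = 0" for x :: 'a
    by (metis add.right_inverse)
  have ex: "\<exists>a. a \<notin> X" if "card X < 6" for X :: "'a set"
  proof (rule ccontr)
    assume "\<nexists>a. a \<notin> X"
    then have "X = UNIV" by blast
    then show False using that 6 by simp
  qed
  obtain a :: 'a where a: "a \<notin> {0, 1}"
    using ex[of "{0, 1}"] by auto
  define K where "K = {0, 1, a, a + 1}"
  have "card K \<le> 4"
    by (simp add: K_def card_insert_if)
  then obtain b where b: "b \<notin> K"
    using ex[of K] by auto
  have e: "x + (x + y) = y" for x y :: 'a
    using two[of x] by (simp flip: add.assoc)
  have "a + 1 \<noteq> 0"
  proof
    assume "a + 1 = 0"
    then have "a = - 1"
      by (simp only: eq_neg_iff_add_eq_0)
    then show False
      using a unfolding m1 by simp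
  qed
  then have cK: "card K = 4"
    using a by (auto simp: K_def card_insert_if)
  have closed: "x + y \<in> K" if "x \<in> K" "y \<in> K" for x y
    using that unfolding K_def by (auto simp: two e add_ac)
  have "K \<inter> (+) b ` K = {}"
  proof (rule ccontr)
    assume "K \<inter> (+) b ` K \<noteq> {}"
    then obtain x where x: "x \<in> K" "b + x \<in> K" by blast
    then have "x + (b + x) \<in> K"
      by (rule closed)
    then show False
      using b e by (metis add.commute)
  qed
  then have "card (K \<union> (+) b ` K) = 8"
    using cK by (simp add: card_Un_disjoint card_image)
  then show False
    using card_mono[of UNIV "K \<union> (+) b ` K"] 6 by simp
qed

text \<open>Nondegeneracy is the point to check. A functional that vanishes along both curves
  vanishes on both frames, as the coefficients of a form are unique, hence on the plane and the
  3-space; these are disjoint and together span rank 7.\<close>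

lemma ruled_quintic_surface_scroll:
  fixes V C :: "('a::{field,finite} ^ 7) set set"
  assumes sf: "ruled_quintic_surface V C G" and q: "7 \<le> CARD('a)"
  obtains c2 c3 where "scroll c2 c3" "V = scroll.surface c2 c3" "C = scroll.conic c2" "G = scroll.gens c2 c3"
proof -
  obtain \<alpha> \<tau> u v and \<phi> :: "'a ^ 2 ^ 2" where
    s: "rspace 2 \<alpha>" "rspace 3 \<tau>" "points \<alpha> \<inter> points \<tau> = {}" and
    u: "frame 2 u \<alpha>" and v: "frame 3 v \<tau>" and \<phi>: "invertible \<phi>" and
    C: "C = {nrc_point 2 u p | p. p \<noteq> 0}" and
    G: "G = {join (nrc_point 2 u p) (nrc_point 3 v (\<phi> *v p)) | p. p \<noteq> 0}" and
    V: "V = \<Union>G"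
    using sf unfolding ruled_quintic_surface_def by blast
  define c2 where "c2 = nvec 2 u"
  define c3 where "c3 = (\<lambda>p. nvec 3 v (\<phi> *v p))"
  have ann: "U \<subseteq> hyp w" if fr: "frame n x U" and n: "n \<le> 3" and z: "\<And>p. dotp w (nvec n x p) = 0"
    for n x w and U :: "('a ^ 7) set"
  proof -
    have "dotp w (x i) = 0" if i: "i \<le> n" for i
    proof (rule bform_coeff_unique[of "Suc n" "\<lambda>i. dotp w (x i)" "\<lambda>i. 0"])
      fix p :: "'a ^ 2"
      show "(\<Sum>i<Suc n. dotp w (x i) * ((p $ 1) ^ (Suc n - 1 - i) * (p $ 2) ^ i))
        = (\<Sum>i<Suc n. 0 * ((p $ 1) ^ (Suc n - 1 - i) * (p $ 2) ^ i))"
        using z[of p] unfolding nvec_def dotp_sum dotp_scale lessThan_Suc_atMost by (simp add: mult_ac)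
    qed (use n q i in auto)
    then have "vec.span (x ` {..n}) \<subseteq> hyp w"
      by (intro vec.span_minimal subspace_hyp) (auto simp: hyp_def)
    then show ?thesis
      using fr by (simp add: frame_def)
  qed
  have scr: "scroll c2 c3"
  proof
    show "(\<lambda>p. dotp w (c2 p)) \<in> bform 3" for w
      using dotp_nvec_bform[of w 2 u] by (simp add: c2_def)
    show "(\<lambda>p. dotp w (c3 p)) \<in> bform 4" for w
      using bform_compose[OF dotp_nvec_bform[of w 3 v], of \<phi>] by (simp add: c3_def)
    show "w = 0" if z2: "\<And>p. dotp w (c2 p) = 0" and z3: "\<And>p. dotp w (c3 p) = 0" for w
    proof -
      have "\<alpha> \<subseteq> hyp w"
        by (rule ann[OF u]) (use z2 in \<open>auto simp: c2_def\<close>)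
      moreover have "\<tau> \<subseteq> hyp w"
      proof (rule ann[OF v])
        fix p :: "'a ^ 2"
        \<comment> \<open>A right inverse of the projectivity shows that c3 runs through the whole
          twisted cubic.\<close>
        obtain \<psi> where "\<phi> ** \<psi> = mat 1"
          using \<phi> by (auto simp: invertible_def)
        then have "\<phi> *v (\<psi> *v p) = p"
          by (simp add: matrix_vector_mul_assoc)
        then show "dotp w (nvec 3 v p) = 0"
          using z3[of "\<psi> *v p"] by (simp add: c3_def)
      qed simp
      ultimately have sub: "{x + y | x y. x \<in> \<alpha> \<and> y \<in> \<tau>} \<subseteq> hyp w"
        using subspace_hyp by (auto intro!: vec.subspace_add)
      \<comment> \<open>A nonzero common vector would span a common point. The ranks 3 and 4 then
        add up to 7.\<close>
      have "\<alpha> \<inter> \<tau> \<subseteq> {0}"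
        using s(3) unfolding points_def by blast
      then have "vec.dim (\<alpha> \<inter> \<tau>) = 0"
        by simp
      moreover have "vec.dim {x + y | x y. x \<in> \<alpha> \<and> y \<in> \<tau>} + vec.dim (\<alpha> \<inter> \<tau>) = 7"
        using vec.dim_sums_Int[of \<alpha> \<tau>] s(1,2) by (simp add: rspace_def)
      ultimately have "vec.dim {x + y | x y. x \<in> \<alpha> \<and> y \<in> \<tau>} = 7"
        by linarith
      then have "7 \<le> vec.dim (hyp w)"
        using vec.dim_subset[OF sub] by simp
      then show "w = 0"
        using dim_hyp[of w] by fastforce
    qed
  qed (rule q)
  interpret scroll c2 c3 by (rule scr)
  \<comment> \<open>The two directrix vectors scale by different powers of k. Each still spans the
    same point, so the generator does not depend on the chosen coordinates of the parameter.\<close>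
  have sc2: "c2 (k *s p) = k ^ 2 *s c2 p" and sc3: "c3 (k *s p) = k ^ 3 *s c3 p" for k p
    by (simp_all add: c2_def c3_def nvec_scale vector_scalar_commute)
  have "C = {ppoint (c2 p) | p. p \<noteq> 0}"
    unfolding C c2_def nrc_point_def nvec_def ..
  also have "\<dots> = conic"
    unfolding conic_def
    by (rule image_proj_line) (rule ppoint_eqI[OF _ sc2], simp)
  finally have "C = conic" .
  moreover have "G = gens"
  proof -
    have j: "join (nrc_point 2 u p) (nrc_point 3 v (\<phi> *v p)) = points (gen p)" for p
    proof -
      have "nrc_point 2 u p = vec.span {c2 p}" "nrc_point 3 v (\<phi> *v p) = vec.span {c3 p}"
        unfolding c2_def c3_def nrc_point_def nvec_def ppoint_def by simp_all
      moreover have "vec.span (vec.span {c2 p} \<union> vec.span {c3 p}) = gen p"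
        unfolding gen_def
      proof (intro equalityI vec.span_minimal)
        show "vec.span {c2 p} \<union> vec.span {c3 p} \<subseteq> vec.span {c2 p, c3 p}"
          by (simp add: vec.span_mono)
        show "{c2 p, c3 p} \<subseteq> vec.span (vec.span {c2 p} \<union> vec.span {c3 p})"
          by (auto intro!: vec.span_base)
      qed auto
      ultimately show ?thesis
        by (simp add: join_def)
    qed
    have "gen (k *s p) = gen p" if "k \<noteq> 0" for k p
    proof (intro equalityI subsetI)
      fix x assume "x \<in> gen (k *s p)"
      then obtain a b where "x = (a * k ^ 2) *s c2 p + (b * k ^ 3) *s c3 p"
        by (auto simp: gen_iff sc2 sc3)
      then show "x \<in> gen p"
        unfolding gen_iff by blast
    next
      fix x assume "x \<in> gen p"
      then obtain a b where "x = a *s c2 p + b *s c3 p"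
        by (auto simp: gen_iff)
      then have "x = (a / k ^ 2) *s c2 (k *s p) + (b / k ^ 3) *s c3 (k *s p)"
        using that by (simp add: sc2 sc3)
      then show "x \<in> gen (k *s p)"
        unfolding gen_iff by blast
    qed
    then show ?thesis
      unfolding G j gens_def by (intro image_proj_line) auto
  qed
  moreover from this have "V = surface"
    by (simp add: V surface_def gens_def)
  ultimately show ?thesis
    using that scr by blast
qed

theorem theorem4p8:
  fixes V C :: "('a::{field,finite} ^ 7) set set"
    and G :: "('a ^ 7) set set set"
    and q :: real
  assumes "ruled_quintic_surface V C G"
    and "q = real CARD('a)"
    and "q \<ge> 6"
  shows
    "(real (card {l. line l \<and> l \<subseteq> V}) = q + 1
      \<and> card {N. nondegenerate_conic N \<and> N \<subseteq> V} = 1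
      \<and> real (card {N. twisted_cubic N \<and> N \<subseteq> V}) = q^2
      \<and> real (card {N. nrc 4 N \<and> N \<subseteq> V}) = q^4 - q^2
      \<and> real (card {N. nrc 5 N \<and> N \<subseteq> V}) = q^6 - q^4)
     \<and> (\<forall>S. rspace 5 S \<longrightarrow>
          (\<exists>!c. c \<in> {Nrc_Gens 5 0, Nrc_Gens 4 1,
                      Nrc_Gens 3 0, Nrc_Gens 3 1, Nrc_Gens 3 2,
                      Conic_Gens 0, Conic_Gens 1, Conic_Gens 2, Conic_Gens 3}
                \<and> meets_in V C G S c))
     \<and> real (num_5spaces V C G (Nrc_Gens 5 0)) = q^6 - q^4
     \<and> real (num_5spaces V C G (Nrc_Gens 4 1)) = q^5 + q^4 - q^3 - q^2
     \<and> real (num_5spaces V C G (Nrc_Gens 3 0)) = (q^4 - q^3) / 2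
     \<and> real (num_5spaces V C G (Nrc_Gens 3 1)) = q^3 + q^2
     \<and> real (num_5spaces V C G (Nrc_Gens 3 2)) = (q^4 + q^3) / 2
     \<and> real (num_5spaces V C G (Conic_Gens 0)) = (q^3 - q) / 3
     \<and> real (num_5spaces V C G (Conic_Gens 1)) = q^3 / 2 + q / 2 + 1
     \<and> real (num_5spaces V C G (Conic_Gens 2)) = q^2 + q
     \<and> real (num_5spaces V C G (Conic_Gens 3)) = (q^3 - q) / 6"
proof -
  have "6 \<le> CARD('a)"
    using assms(2,3) by simp
  then have q7: "7 \<le> CARD('a)"
    using card_field_neq_6[where 'a = 'a] by linarith
  obtain c2 c3 where scr: "scroll c2 c3" and V: "V = scroll.surface c2 c3" "C = scroll.conic c2" "G = scroll.gens c2 c3"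
    by (rule ruled_quintic_surface_scroll[OF assms(1) q7])
  interpret scroll c2 c3 by (rule scr)
  note q = assms(2)
  have q1: "q - 1 \<noteq> 0"
    using assms(3) by simp
  have qm1: "real (CARD('a) - 1) = q - 1"
    using q q7 by (simp add: of_nat_diff)
  have nrcs: "real (card {N. nrc r N \<and> N \<subseteq> surface}) = x"
    if "real (card (primset r :: (('a ^ 2 \<Rightarrow> 'a) \<times> ('a ^ 2 \<Rightarrow> 'a)) set)) = (q - 1) * x" "r \<in> {2..5}" for r x
    using arg_cong[OF card_nrcs[OF that(2)], of real] that(1) q1 unfolding of_nat_mult qm1 by simp
  \<comment> \<open>Both factors of the product carry a factor \<open>q - 1\<close> for scalars;
    together they cancel the size \<open>(q - 1)^2\<close> of the fibres.\<close>
  have spaces: "real (num_5spaces surface conic gens (conf r i)) = y * x"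
    if "real (card (rooted n i :: ('a ^ 2 \<Rightarrow> 'a) set)) = (q - 1) * y"
      "real (card (primset r :: (('a ^ 2 \<Rightarrow> 'a) \<times> ('a ^ 2 \<Rightarrow> 'a)) set)) = (q - 1) * x" "r \<in> {2..5}" "n = 6 - r" for n r i x y
  proof -
    have "(q - 1) * y * ((q - 1) * x) = (q - 1)\<^sup>2 * real (num_5spaces surface conic gens (conf r i))"
      using arg_cong[OF card_5spaces[OF that(3), of i], of real] that(1,2,4)
      unfolding of_nat_mult of_nat_power qm1 card_cartesian_product by simp
    then have "(q - 1)\<^sup>2 * (y * x) = (q - 1)\<^sup>2 * real (num_5spaces surface conic gens (conf r i))"
      by (simp add: power2_eq_square mult_ac)
    then show ?thesis
      using q1 by simp
  qed
  note P = card_primset[OF q card_ge_5] and R = card_rooted[OF q card_ge_5]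
  have P2: "real (card (primset 2 :: (('a ^ 2 \<Rightarrow> 'a) \<times> ('a ^ 2 \<Rightarrow> 'a)) set)) = (q - 1) * 1"
    using P(1) by simp
  have R1: "real (card (rooted 1 0 :: ('a ^ 2 \<Rightarrow> 'a) set)) = (q - 1) * 1"
    using R(1) by simp
  show ?thesis
    unfolding V
  proof (intro conjI allI impI)
    show "real (card {l. line l \<and> l \<subseteq> surface}) = q + 1"
      unfolding lines_in_surface card_gens using q by simp
    have "real (card {N. nrc 2 N \<and> N \<subseteq> surface}) = 1"
      by (rule nrcs[OF P2]) simp
    then show "card {N. nrc 2 N \<and> N \<subseteq> surface} = 1"
      by simp
    show "real (card {N. nrc 3 N \<and> N \<subseteq> surface}) = q^2"
      by (rule nrcs[OF P(2)]) simp
    show "real (card {N. nrc 4 N \<and> N \<subseteq> surface}) = q^4 - q^2"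
      by (rule nrcs[OF P(3)]) simp
    show "real (card {N. nrc 5 N \<and> N \<subseteq> surface}) = q^6 - q^4"
      by (rule nrcs[OF P(4)]) simp
    show "real (num_5spaces surface conic gens (Nrc_Gens 5 0)) = q^6 - q^4"
      using spaces[OF R1 P(4)] by (simp add: conf_def)
    show "real (num_5spaces surface conic gens (Nrc_Gens 4 1)) = q^5 + q^4 - q^3 - q^2"
      using spaces[OF R(2) P(3)] by (simp add: conf_def eval_nat_numeral algebra_simps)
    show "real (num_5spaces surface conic gens (Nrc_Gens 3 0)) = (q^4 - q^3) / 2"
      using spaces[OF R(3) P(2)] by (simp add: conf_def eval_nat_numeral algebra_simps)
    show "real (num_5spaces surface conic gens (Nrc_Gens 3 1)) = q^3 + q^2"
      using spaces[OF R(4) P(2)] by (simp add: conf_def eval_nat_numeral algebra_simps)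
    show "real (num_5spaces surface conic gens (Nrc_Gens 3 2)) = (q^4 + q^3) / 2"
      using spaces[OF R(5) P(2)] by (simp add: conf_def eval_nat_numeral algebra_simps)
    show "real (num_5spaces surface conic gens (Conic_Gens 0)) = (q^3 - q) / 3"
      using spaces[OF R(6) P2] by (simp add: conf_def)
    show "real (num_5spaces surface conic gens (Conic_Gens 1)) = q^3 / 2 + q / 2 + 1"
      using spaces[OF R(7) P2] by (simp add: conf_def)
    show "real (num_5spaces surface conic gens (Conic_Gens 2)) = q^2 + q"
      using spaces[OF R(8) P2] by (simp add: conf_def)
    show "real (num_5spaces surface conic gens (Conic_Gens 3)) = (q^3 - q) / 6"
      using spaces[OF R(9) P2] by (simp add: conf_def)
  qed (rule configuration_unique)
qed

end
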